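(* For any $\tau\in(0,\infty)$, $$\dim_{\rm H}\left\{x\in\mathbb I:\limsup_{n\to\infty}\frac{\log M_n(x)}n=\tau\right\}=\theta(\tau)$$ and $$\dim_{\rm H}\left\{x\in\mathbb I:\liminf_{n\to\infty}\frac{\log M_n(x)}n=\tau\right\}=\widehat\theta(\tau),$$ where $\theta(\tau)$ is the unique solution $\theta\in(1/2,\infty)$ of $\mathrm P(\theta)=\tau\theta$, and $\widehat\theta(\tau)$ is the unique solution $\theta\in(1/2,\infty)$ of $\mathrm P(\theta)=\tau(\sqrt\theta+\sqrt{2\theta-1})^2$.
   Context: $\mathbb N=\{1,2,3,\dots\}$ and $\mathbb I:=[0,1)\setminus\mathbb Q$. For $x\in\mathbb I$, $a_1(x),a_2(x),\dots\in\mathbb N$ are the coefficients (partial quotients) of its continued fraction expansion $x=[a_1(x),a_2(x),\dots]=1/(a_1(x)+1/(a_2(x)+\cdots))$, and $M_n(x):=\max\{a_1(x),\dots,a_n(x)\}$. For positive integers $a_1,\dots,a_n$, $q_n(a_1,\dots,a_n)$ is the denominator (in lowest terms) of the rational number $[a_1,\dots,a_n]=1/(a_1+1/(a_2+\cdots+1/a_n))$. The Diophantine pressure function is $$\mathrm P(\theta):=\lim_{n\to\infty}\frac1n\log\sum_{a_1,\dots,a_n\in\mathbb N}q_n(a_1,\dots,a_n)^{-2\theta},\qquad \theta>\tfrac12.$$ $\dim_{\rm H}$ denotes Hausdorff dimension. *)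

theory Defs
  imports "HOL-Analysis.Analysis"
begin

definition unit_irrationals :: "real set" where
  "unit_irrationals = {0..<1} - \<rat>"

fun cf_value :: "nat list \<Rightarrow> 'a::field" where
  "cf_value [] = 0"
| "cf_value (a # as) = 1 / (of_nat a + cf_value as)"

definition gauss_map :: "real \<Rightarrow> real" where
  "gauss_map x = frac (1 / x)"

text \<open>Partial quotients are indexed from 1, so index 0 is meaningless. The lemma
  \<open>cf_expansion\<close> below confirms that they expand every \<open>x\<close> in \<^term>\<open>unit_irrationals\<close>.\<close>

definition partial_quotient :: "real \<Rightarrow> nat \<Rightarrow> nat" where
  "partial_quotient x n = nat \<lfloor>1 / (gauss_map ^^ (n - 1)) x\<rfloor>"

definition max_quotient :: "nat \<Rightarrow> real \<Rightarrow> nat" where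
  "max_quotient n x = Max (partial_quotient x ` {1..n})"

text \<open>\<^const>\<open>quotient_of\<close> returns the coprime representation with positive denominator.\<close>

definition cf_denom :: "nat list \<Rightarrow> int" where
  "cf_denom as = snd (quotient_of (cf_value as))"

text \<open>Only meaningful for \<open>\<theta> > 1/2\<close>: otherwise the sums diverge and \<^const>\<open>infsum\<close> is 0.\<close>

definition pressure :: "real \<Rightarrow> real" where
  "pressure \<theta> = lim (\<lambda>n. 1 / real n *
     ln (\<Sum>\<^sub>\<infinity>as\<in>{as. length as = n \<and> (\<forall>a\<in>set as. 1 \<le> a)}. of_int (cf_denom as) powr (- 2 * \<theta>)))"

definition hausdorff_premeasure :: "real \<Rightarrow> real \<Rightarrow> 'a::metric_space set \<Rightarrow> ennreal" where
  "hausdorff_premeasure s \<delta> A =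
     (INF U\<in>{U :: nat \<Rightarrow> 'a set. A \<subseteq> (\<Union>i. U i) \<and> (\<forall>i. bounded (U i) \<and> diameter (U i) \<le> \<delta>)}.
        \<Sum>i. ennreal (diameter (U i) powr s))"

definition hausdorff_measure :: "real \<Rightarrow> 'a::metric_space set \<Rightarrow> ennreal" where
  "hausdorff_measure s A = (SUP \<delta>\<in>{0<..}. hausdorff_premeasure s \<delta> A)"

text \<open>Restricting to \<open>s > 0\<close> leaves the infimum unchanged and avoids the value of \<open>0 powr 0\<close>,
  which is 0 here.\<close>

definition hausdorff_dim :: "'a::metric_space set \<Rightarrow> ereal" where
  "hausdorff_dim A = (INF s\<in>{s. 0 < s \<and> hausdorff_measure s A = 0}. ereal s)"

text \<open>\<open>cf_tail [a1, \<dots>, an] t = 1/(a1 + \<dots> + 1/(an + t))\<close>\<close>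

fun cf_tail :: "nat list \<Rightarrow> real \<Rightarrow> real" where
  "cf_tail [] t = t"
| "cf_tail (a # as) t = 1 / (real a + cf_tail as t)"

lemma cf_tail_0: "cf_tail as 0 = cf_value as"
  by (induction as) auto

lemma cf_tail_append: "cf_tail (as @ bs) t = cf_tail as (cf_tail bs t)"
  by (induction as) auto

lemma cf_tail_range:
  assumes "\<forall>a\<in>set as. 1 \<le> a" "0 \<le> t" "t \<le> 1"
  shows "0 \<le> cf_tail as t \<and> cf_tail as t \<le> 1"
  using assms
proof (induction as)
  case (Cons a as)
  then have "0 \<le> cf_tail as t" "1 \<le> real a" by auto
  then show ?case by (auto simp: divide_simps)
qed auto

lemma cf_tail_diff:
  assumes "\<forall>a\<in>set as. 1 \<le> a" "0 \<le> s" "s \<le> 1" "0 \<le> t" "t \<le> 1"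
  shows "\<bar>cf_tail as s - cf_tail as t\<bar> \<le> (1 / 4) ^ (length as div 2)"
  using assms(1)
proof (induction as rule: induct_list012)
  case 1
  then show ?case using assms by auto
next
  case (2 a)
  then have "0 \<le> cf_tail [a] s \<and> cf_tail [a] s \<le> 1" "0 \<le> cf_tail [a] t \<and> cf_tail [a] t \<le> 1"
    using cf_tail_range[of "[a]" s] cf_tail_range[of "[a]" t] assms by simp_all
  then have "\<bar>cf_tail [a] s - cf_tail [a] t\<bar> \<le> 1" by linarith
  then show ?case by simp
next
  case (3 a b as)
  define u v where "u = cf_tail as s" and "v = cf_tail as t"
  have u: "0 \<le> u" "0 \<le> v" using cf_tail_range[of as] 3 assms by (auto simp: u_def v_def)
  have ab: "1 \<le> real a" "1 \<le> real b" using 3 by auto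
  define x y where "x = real a * (real b + u) + 1" and "y = real a * (real b + v) + 1"
  have "1 * 1 \<le> real a * (real b + u)" "1 * 1 \<le> real a * (real b + v)"
    using ab u by (intro mult_mono; simp)+
  then have xy: "2 \<le> x" "2 \<le> y" by (auto simp: x_def y_def)
  have 1: "1 / (real a + 1 / (real b + u)) = (real b + u) / x"
    "1 / (real a + 1 / (real b + v)) = (real b + v) / y"
    using ab u by (auto simp: x_def y_def field_simps)
  have "(real b + u) * y - (real b + v) * x = u - v"
    by (simp add: x_def y_def algebra_simps)
  then have 2: "(real b + u) / x - (real b + v) / y = (u - v) / (x * y)"
    using xy by (simp add: diff_frac_eq mult.commute)
  have "2 * 2 \<le> x * y" using xy by (intro mult_mono) auto
  then have "\<bar>u - v\<bar> / (x * y) \<le> \<bar>u - v\<bar> / 4"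
    by (intro frac_le) auto
  then have "\<bar>(u - v) / (x * y)\<bar> \<le> \<bar>u - v\<bar> / 4"
    using xy by (simp add: abs_mult)
  also have "\<dots> \<le> (1 / 4) ^ (length as div 2) / 4"
    using 3 by (auto simp: u_def v_def)
  finally have "\<bar>1 / (real a + 1 / (real b + u)) - 1 / (real a + 1 / (real b + v))\<bar>
      \<le> (1 / 4) ^ (length as div 2) / 4"
    unfolding 1 2 .
  moreover have "(1 / 4 :: real) ^ (length (a # b # as) div 2) = (1 / 4) ^ (length as div 2) / 4"
    by simp
  ultimately show ?case by (simp only: cf_tail.simps u_def v_def)
qed

lemma gauss_map_irrational:
  assumes "x \<in> unit_irrationals"
  shows "gauss_map x \<in> unit_irrationals" "1 \<le> nat \<lfloor>1 / x\<rfloor>"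
    "x = 1 / (real (nat \<lfloor>1 / x\<rfloor>) + gauss_map x)"
proof -
  have "0 \<le> x" and "x < 1" and "x \<notin> \<rat>"
    using assms by (auto simp: unit_irrationals_def)
  moreover from this have "x \<noteq> 0" by (metis Rats_0)
  ultimately have x: "0 < x" "x < 1" "x \<notin> \<rat>" by linarith+
  have fl: "1 \<le> \<lfloor>1 / x\<rfloor>" using x by (simp add: le_floor_iff)
  show "1 \<le> nat \<lfloor>1 / x\<rfloor>" using fl by (simp only: le_nat_iff of_nat_1)
  show "x = 1 / (real (nat \<lfloor>1 / x\<rfloor>) + gauss_map x)"
    using fl x by (simp add: gauss_map_def frac_def)
  have "gauss_map x \<notin> \<rat>"
  proof
    assume "gauss_map x \<in> \<rat>"
    then have "1 / (gauss_map x + of_int \<lfloor>1 / x\<rfloor>) \<in> \<rat>" by (intro Rats_divide Rats_add) auto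
    then show False using x by (simp add: gauss_map_def frac_def)
  qed
  then show "gauss_map x \<in> unit_irrationals"
    by (auto simp: unit_irrationals_def gauss_map_def frac_ge_0 frac_lt_1)
qed

lemma cf_expansion:
  assumes "x \<in> unit_irrationals"
  shows "1 \<le> n \<Longrightarrow> 1 \<le> partial_quotient x n"
    and "(\<lambda>n. cf_value (map (partial_quotient x) [1..<Suc n])) \<longlonglongrightarrow> x"
proof -
  have it: "(gauss_map ^^ n) x \<in> unit_irrationals" for n
    using assms by (induction n) (simp_all add: gauss_map_irrational(1))
  have pos: "1 \<le> partial_quotient x n" for n
    using gauss_map_irrational(2)[OF it] by (simp add: partial_quotient_def)
  then show "1 \<le> n \<Longrightarrow> 1 \<le> partial_quotient x n" .
  let ?l = "\<lambda>n. map (partial_quotient x) [1..<Suc n]"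
  have eq: "cf_tail (?l n) ((gauss_map ^^ n) x) = x" for n
  proof (induction n)
    case (Suc n)
    have "cf_tail [partial_quotient x (Suc n)] ((gauss_map ^^ Suc n) x) = (gauss_map ^^ n) x"
      using gauss_map_irrational(3)[OF it[of n]] by (simp add: partial_quotient_def)
    moreover have "?l (Suc n) = ?l n @ [partial_quotient x (Suc n)]" by simp
    ultimately show ?case using Suc by (simp only: cf_tail_append)
  qed simp
  have bound: "\<bar>cf_value (?l n) - x\<bar> \<le> (1 / 4) ^ (n div 2)" for n
  proof -
    have "\<bar>cf_tail (?l n) 0 - cf_tail (?l n) ((gauss_map ^^ n) x)\<bar> \<le> (1 / 4) ^ (length (?l n) div 2)"
      using it[of n] pos by (intro cf_tail_diff) (auto simp: unit_irrationals_def)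
    moreover have "length (?l n) = n" by simp
    ultimately show ?thesis by (simp only: eq cf_tail_0)
  qed
  have lim0: "(\<lambda>n. (1 / 4 :: real) ^ (n div 2)) \<longlonglongrightarrow> 0"
  proof (rule filterlim_compose[of "\<lambda>n. (1 / 4 :: real) ^ n"])
    show "(\<lambda>n. (1 / 4 :: real) ^ n) \<longlonglongrightarrow> 0" by (rule LIMSEQ_power_zero) simp
    show "filterlim (\<lambda>n::nat. n div 2) sequentially sequentially"
      unfolding filterlim_at_top
    proof
      fix Z :: nat
      show "\<forall>\<^sub>F n in sequentially. Z \<le> n div 2"
        using eventually_ge_at_top[of "2 * Z"] by eventually_elim auto
    qed
  qed
  have "(\<lambda>n. cf_value (?l n) - x) \<longlonglongrightarrow> 0"
  proof (rule Lim_null_comparison[OF _ lim0], rule always_eventually, rule allI)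
    show "norm (cf_value (?l n) - x) \<le> (1 / 4) ^ (n div 2)" for n
      using bound[of n] by (simp only: real_norm_def)
  qed
  then show "(\<lambda>n. cf_value (?l n)) \<longlonglongrightarrow> x" by (rule LIM_zero_cancel)
qed

end

theory Submission
  imports Defs
begin

text \<open>
  Upper bounds: a cylinder of a word \<open>as\<close> of length \<open>n\<close> has diameter about \<open>q(as)\<^sup>-\<^sup>2\<close>, and it shrinks by the
  factor \<open>1 / A\<close> if the next digit is required to be at least \<open>A\<close>. For the limsup set one covers by
  cylinders followed by a digit \<open>\<ge> exp (\<tau> n)\<close>, at total cost \<open>\<Sum>\<^sub>n exp (n (P(\<theta>) - \<tau> \<theta>))\<close>. For the
  liminf set let \<open>n\<^sub>1 < n\<^sub>2 < \<dots>\<close> be the record positions; the record at \<open>n\<^sub>j\<close> must exceed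
  \<open>exp (\<tau> n\<^sub>j\<^sub>+\<^sub>1)\<close>, and each earlier record contributes a factor \<open>exp (- \<tau> (2 \<theta> - 1) n\<^sub>j\<^sub>+\<^sub>1)\<close>. Whatever
  the sequence is, \<open>(2 \<theta> - 1) (n\<^sub>2 + \<dots> + n\<^sub>k) + \<theta> n\<^sub>k\<^sub>+\<^sub>1 \<ge> c n\<^sub>k\<close> holds infinitely often for every
  \<open>c < (\<surd>\<theta> + \<surd>(2 \<theta> - 1))\<^sup>2\<close>, and the sum over all possible record positions converges because each
  record carries an exponentially small factor.

  Lower bounds: place digits of size \<open>exp (t n\<^sub>k)\<close> at positions \<open>n\<^sub>k\<close> that grow like \<open>\<Lambda>\<^sup>k\<close>, and fill the gaps with
  blocks of bounded digits distributed according to \<open>q\<^sup>-\<^sup>2\<^sup>\<theta>\<close>. The mass distribution principle gives positive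
  measure if \<open>P(\<theta>) > t ((2 \<theta> - 1) / (\<Lambda> - 1) + \<theta>)\<close>; the limsup is \<open>t\<close> and the liminf is \<open>t / \<Lambda>\<close>.
  Take \<open>t = \<tau>\<close> and \<open>\<Lambda>\<close> large in the first case, and \<open>t = \<tau> \<Lambda>\<close> with the optimal
  \<open>\<Lambda> = 1 + \<surd>((2 \<theta> - 1) / \<theta>)\<close> in the second.\<close>

text \<open>The number (sqrt \<theta> + sqrt (2 \<theta> - 1))^2 is the minimum over \<Lambda> > 1
  of \<Lambda> ((2 \<theta> - 1) / (\<Lambda> - 1) + \<theta>), which is why covers and Cantor sets
  meet at the same equation. The exponent 2 \<theta> - 1 of a digit near A comes from counting:
  about A digits, each of weight A^(-2 \<theta>). The last large digit enters with \<theta> instead,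
  because one interval contains all continuations by digits at least A. The obstacle is that the
  weights are multiplicative only up to a factor 4^\<theta> per concatenation and that the alphabet
  is infinite. In the covers of the liminf set this loss occurs once per record and is absorbed by
  the exponentially small factors of the records. In the Cantor set it occurs once per block and is
  absorbed by long blocks; then finitely many digits suffice, since a finite part of the partition
  sum is already large enough. No measure on the limit set is constructed: finite products of masses
  are compared with an open cover at a single level of a tree.\<close>

section \<open>Continued fraction denominators\<close>

text \<open>Evaluated at a tail \<open>t\<close>, the denominator satisfies an exact cocycle identity, which replaces
  the matrix form of the recursion for convergents; \<open>cf_den as 0\<close> is the usual \<open>q\<^sub>n\<close>.\<close>

fun cf_den :: "nat list \<Rightarrow> real \<Rightarrow> real" where
  "cf_den [] t = 1"
| "cf_den (a # as) t = (real a + cf_tail as t) * cf_den as t"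

abbreviation pos_word :: "nat list \<Rightarrow> bool" where
  "pos_word as \<equiv> \<forall>a\<in>set as. 1 \<le> a"

lemma cf_den_append: "cf_den (as @ bs) t = cf_den as (cf_tail bs t) * cf_den bs t"
  by (induction as) (auto simp: cf_tail_append)

text \<open>Here p, p', q, q' are the numerators and denominators of the last two convergents. The
  inequality \<open>p' + q' \<le> p + q\<close> is carried along because \<open>p' \<le> p\<close>
  fails for the empty word; added to \<open>(a - 1) * q' \<le> (a - 1) * q\<close> it gives
  \<open>q' \<le> q\<close> for the longer word.\<close>

lemma cf_den_affine:
  assumes "pos_word as"
  shows "\<exists>p p' q q'. 0 \<le> p \<and> 0 \<le> p' \<and> 1 \<le> q \<and> 0 \<le> q' \<and> q' \<le> q \<and> p' + q' \<le> p + q \<and>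
    (\<forall>t\<ge>0. cf_den as t = q + q' * t \<and> cf_tail as t * cf_den as t = p + p' * t)"
  using assms
proof (induction as)
  case Nil
  have "\<forall>t\<ge>0::real. cf_den [] t = 1 + 0 * t \<and> cf_tail [] t * cf_den [] t = 0 + 1 * t" by simp
  then show ?case by (intro exI[of _ 0] exI[of _ 1]) auto
next
  case (Cons a as)
  then obtain p p' q q' where *: "0 \<le> p" "0 \<le> p'" "1 \<le> q" "0 \<le> q'" "q' \<le> q" "p' + q' \<le> p + q"
    and t: "\<And>t. t \<ge> 0 \<Longrightarrow> cf_den as t = q + q' * t \<and> cf_tail as t * cf_den as t = p + p' * t"
    by auto
  have a: "1 \<le> real a" using Cons.prems by auto
  have "(real a - 1) * q' \<le> (real a - 1) * q" using a * by (intro mult_left_mono) auto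
  then have 1: "real a * q' + p' \<le> real a * q + p" using * by (simp add: algebra_simps)
  have 2: "1 \<le> real a * q + p" using mult_mono[of 1 "real a" 1 q] a * by auto
  have 3: "cf_den (a # as) t = (real a * q + p) + (real a * q' + p') * t
      \<and> cf_tail (a # as) t * cf_den (a # as) t = q + q' * t" if "t \<ge> 0" for t
  proof
    have 4: "cf_den (a # as) t = real a * cf_den as t + cf_tail as t * cf_den as t"
      by (simp add: algebra_simps)
    have "cf_tail as t * cf_den as t = p + p' * t" "cf_den as t = q + q' * t"
      using t[OF that] by auto
    then show 5: "cf_den (a # as) t = (real a * q + p) + (real a * q' + p') * t"
      unfolding 4 by (simp only:) (simp add: algebra_simps)
    have "0 < cf_den (a # as) t" unfolding 5 using 2 * a that by (auto intro!: add_pos_nonneg)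
    then have "real a + cf_tail as t \<noteq> 0" by auto
    then have "cf_tail (a # as) t * cf_den (a # as) t = cf_den as t" by simp
    also have "\<dots> = q + q' * t" using t[OF that] by simp
    finally show "cf_tail (a # as) t * cf_den (a # as) t = q + q' * t" .
  qed
  have "0 \<le> q" "q' + (real a * q' + p') \<le> q + (real a * q + p)" "0 \<le> real a * q' + p'"
    using 1 * a by auto
  with 1 2 3 *(4) show ?case by blast
qed

text \<open>The factor 2 is the whole distortion over tails in [0, 1]; squared, or raised to the
  power 2 \<theta>, it becomes the constants 4 and \<open>4 powr \<theta>\<close> of the later
  estimates.\<close>

lemma cf_den_bounds:
  assumes "pos_word as"
  shows "1 \<le> cf_den as 0" "0 \<le> s \<Longrightarrow> s \<le> t \<Longrightarrow> cf_den as s \<le> cf_den as t"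
    "0 \<le> t \<Longrightarrow> t \<le> 1 \<Longrightarrow> cf_den as t \<le> 2 * cf_den as 0"
proof -
  obtain p p' q q' where *: "1 \<le> q" "0 \<le> q'" "q' \<le> q"
    and t: "\<And>t. t \<ge> 0 \<Longrightarrow> cf_den as t = q + q' * t"
    using cf_den_affine[OF assms] by blast
  show "1 \<le> cf_den as 0" using * t[of 0] by simp
  show "cf_den as s \<le> cf_den as t" if "0 \<le> s" "s \<le> t"
    using that * t[of s] t[of t] by (simp add: mult_left_mono)
  show "cf_den as t \<le> 2 * cf_den as 0" if "0 \<le> t" "t \<le> 1"
    using that * t[of 0] t[of t] mult_left_mono[of t 1 q'] by simp
qed

lemma cf_den_ge_1: "pos_word as \<Longrightarrow> 0 \<le> t \<Longrightarrow> 1 \<le> cf_den as t"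
  using cf_den_bounds(1)[of as] cf_den_bounds(2)[of as 0 t] by linarith

lemma cf_den_append_ge:
  assumes "pos_word as" "pos_word bs"
  shows "cf_den as 0 * cf_den bs 0 \<le> cf_den (as @ bs) 0"
  unfolding cf_den_append
  using assms cf_den_bounds[of as] cf_den_bounds(1)[of bs] cf_tail_range[of bs 0]
  by (intro mult_right_mono) auto

lemma cf_den_append_le:
  assumes "pos_word as" "pos_word bs"
  shows "cf_den (as @ bs) 0 \<le> 2 * cf_den as 0 * cf_den bs 0"
  unfolding cf_den_append
  using assms cf_den_bounds[of as] cf_den_bounds(1)[of bs] cf_tail_range[of bs 0]
  by (intro mult_right_mono) auto

text \<open>\<open>cf_tail as\<close> is a Moebius map of determinant 1 or -1 with denominator
  \<open>cf_den as t\<close>, so the distance formula is exact.\<close>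

lemma cf_tail_dist:
  assumes "pos_word as" "0 \<le> s" "0 \<le> t"
  shows "\<bar>cf_tail as s - cf_tail as t\<bar> = \<bar>s - t\<bar> / (cf_den as s * cf_den as t)"
  using assms(1)
proof (induction as)
  case (Cons a as)
  define u v where "u = cf_tail as s" and "v = cf_tail as t"
  have nonneg: "0 \<le> cf_tail bs r" if "0 \<le> r" for bs r using that by (induction bs) auto
  have pos: "0 < real a + u" "0 < real a + v"
    using Cons.prems nonneg[of s as] nonneg[of t as] assms by (auto simp: u_def v_def)
  have "\<bar>1 / (real a + u) - 1 / (real a + v)\<bar> = \<bar>u - v\<bar> / ((real a + u) * (real a + v))"
    using pos by (simp add: diff_frac_eq abs_mult abs_minus_commute)
  also have "\<bar>u - v\<bar> = \<bar>s - t\<bar> / (cf_den as s * cf_den as t)"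
    using Cons by (simp add: u_def v_def)
  finally show ?case by (simp add: u_def v_def mult_ac)
qed simp

lemma cf_tail_dist_le:
  assumes "pos_word as" "0 \<le> s" "0 \<le> t"
  shows "\<bar>cf_tail as s - cf_tail as t\<bar> \<le> \<bar>s - t\<bar> / (cf_den as 0)\<^sup>2"
proof -
  have "(cf_den as 0)\<^sup>2 \<le> cf_den as s * cf_den as t" unfolding power2_eq_square
    using assms cf_den_bounds[of as] cf_den_ge_1[of as 0] cf_den_ge_1[of as s]
    by (intro mult_mono) auto
  moreover have "0 < (cf_den as 0)\<^sup>2" using cf_den_bounds(1)[OF assms(1)] by simp
  ultimately show ?thesis unfolding cf_tail_dist[OF assms]
    by (intro divide_left_mono mult_pos_pos[of "cf_den as s * cf_den as t"]) linarith+
qed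

lemma cf_tail_dist_ge:
  assumes "pos_word as" "0 \<le> s" "s \<le> 1" "0 \<le> t" "t \<le> 1"
  shows "\<bar>s - t\<bar> / (4 * (cf_den as 0)\<^sup>2) \<le> \<bar>cf_tail as s - cf_tail as t\<bar>"
proof -
  have "cf_den as s * cf_den as t \<le> (2 * cf_den as 0) * (2 * cf_den as 0)"
    using assms cf_den_bounds[of as] cf_den_ge_1[of as 0] cf_den_ge_1[of as t]
    by (intro mult_mono) auto
  moreover have "0 < cf_den as s * cf_den as t"
    using assms cf_den_ge_1[of as s] cf_den_ge_1[of as t] by (intro mult_pos_pos) auto
  ultimately show ?thesis unfolding cf_tail_dist[OF assms(1,2,4)]
    by (intro divide_left_mono) (auto simp: power2_eq_square)
qed

text \<open>The recursion sends a fraction p / q to q / (a q + p), which preserves coprimality. The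
  fraction it produces is therefore already the reduced one returned by
  \<open>quotient_of\<close>.\<close>

lemma cf_denom_eq:
  assumes "pos_word as"
  shows "real_of_int (cf_denom as) = cf_den as 0"
proof -
  have "\<exists>p q :: int. coprime p q \<and> 0 \<le> p \<and> 0 < q \<and> (cf_value as :: rat) = of_int p / of_int q
      \<and> cf_den as 0 = of_int q \<and> cf_tail as 0 * of_int q = of_int p"
    using assms
  proof (induction as)
    case Nil
    show ?case by (intro exI[of _ 0] exI[of _ 1]) auto
  next
    case (Cons a as)
    then obtain p q :: int where *: "coprime p q" "0 \<le> p" "0 < q"
      "(cf_value as :: rat) = of_int p / of_int q" "cf_den as 0 = of_int q"
      "cf_tail as 0 * of_int q = of_int p" by auto
    have a: "1 \<le> int a" using Cons.prems by auto
    have q: "0 < int a * q" using a * by (intro mult_pos_pos) auto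
    have cop: "coprime q (int a * q + p)" using *(1)
      by (simp add: coprime_iff_gcd_eq_1 gcd_add_mult gcd.commute)
    have "(of_nat a + cf_value as :: rat) = of_int (int a * q + p) / of_int q"
      using * by (simp add: add_divide_distrib)
    then have 1: "(cf_value (a # as) :: rat) = of_int q / of_int (int a * q + p)"
      by simp
    have 2: "cf_den (a # as) 0 = of_int (int a * q + p)"
      using * by (simp add: distrib_right)
    have "real a + cf_tail as 0 \<noteq> 0"
      using a Cons.prems cf_tail_range[of as 0] by auto
    then have 3: "cf_tail (a # as) 0 * of_int (int a * q + p) = of_int q"
      using * by (simp add: divide_simps) (simp add: algebra_simps flip: *(6))
    have "0 \<le> q" "0 < int a * q + p" using *(2,3) q by linarith+
    with 1 2 3 cop show ?case by blast
  qed
  then obtain p q :: int where *: "coprime p q" "0 < q" "(cf_value as :: rat) = of_int p / of_int q"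
    "cf_den as 0 = of_int q" by blast
  have "quotient_of (cf_value as) = (p, q)"
    using * by (simp add: quotient_of_Fract normalize_def flip: Fract_of_int_quotient)
  then show ?thesis using * by (simp add: cf_denom_def)
qed

section \<open>Partition sums\<close>

text \<open>Bounding all finite subsums carries summability with it for nonnegative terms, whereas
  \<open>infsum f S \<le> C\<close> also holds for a divergent sum if 0 \<le> C, because
  \<open>infsum\<close> is then 0.\<close>

definition sums_bounded :: "('a \<Rightarrow> real) \<Rightarrow> 'a set \<Rightarrow> real \<Rightarrow> bool" where
  "sums_bounded f S C \<longleftrightarrow> (\<forall>F. finite F \<and> F \<subseteq> S \<longrightarrow> sum f F \<le> C)"

lemma sums_boundedI: "(\<And>F. finite F \<Longrightarrow> F \<subseteq> S \<Longrightarrow> sum f F \<le> C) \<Longrightarrow> sums_bounded f S C"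
  by (auto simp: sums_bounded_def)

lemma sums_boundedD: "sums_bounded f S C \<Longrightarrow> finite F \<Longrightarrow> F \<subseteq> S \<Longrightarrow> sum f F \<le> C"
  by (auto simp: sums_bounded_def)

lemma sums_bounded_nonneg: "sums_bounded f S C \<Longrightarrow> 0 \<le> C"
  using sums_boundedD[of f S C "{}"] by simp

lemma sums_bounded_singleton: "f x \<le> C \<Longrightarrow> 0 \<le> C \<Longrightarrow> sums_bounded f {x} C"
  by (rule sums_boundedI, drule subset_singletonD) auto

lemma sums_bounded_mono:
  assumes "sums_bounded f T C" "S \<subseteq> T" "C \<le> D" "\<And>x. x \<in> S \<Longrightarrow> g x \<le> f x"
  shows "sums_bounded g S D"
proof (rule sums_boundedI)
  fix F assume F: "finite F" "F \<subseteq> S"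
  then have "sum g F \<le> sum f F" using assms by (intro sum_mono) auto
  also have "\<dots> \<le> C" using F assms by (intro sums_boundedD[of f T]) auto
  finally show "sum g F \<le> D" using assms by simp
qed

lemma sums_bounded_cmult:
  assumes "sums_bounded f S C" "0 \<le> c"
  shows "sums_bounded (\<lambda>x. c * f x) S (c * C)"
  using assms by (auto simp: sums_bounded_def simp flip: sum_distrib_left intro!: mult_left_mono)

lemma sums_bounded_summable_on:
  assumes "sums_bounded f S C" "\<And>x. x \<in> S \<Longrightarrow> 0 \<le> f x"
  shows "f summable_on S"
proof (rule nonneg_bdd_above_summable_on)
  show "bdd_above (sum f ` {F. F \<subseteq> S \<and> finite F})"
    using assms(1) by (intro bdd_aboveI[of _ C]) (auto simp: sums_bounded_def)
qed (use assms in auto)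

lemma sums_bounded_infsum_le:
  assumes "sums_bounded f S C" "\<And>x. x \<in> S \<Longrightarrow> 0 \<le> f x"
  shows "infsum f S \<le> C"
  using sums_bounded_summable_on[OF assms] assms(1)
  by (intro infsum_le_finite_sums) (auto simp: sums_bounded_def)

lemma sums_bounded_infsum:
  fixes f :: "'a \<Rightarrow> real"
  assumes "f summable_on S" "\<And>x. x \<in> S \<Longrightarrow> 0 \<le> f x"
  shows "sums_bounded f S (infsum f S)"
  using assms by (intro sums_boundedI finite_sum_le_infsum) auto

text \<open>The pieces may overlap: each element of a finite set is charged to one chosen
  index.\<close>

lemma sums_bounded_SUN:
  assumes "\<And>i. i \<in> I \<Longrightarrow> sums_bounded f (S i) (c i)" "sums_bounded c I C"
    and "\<And>x. 0 \<le> f x"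
  shows "sums_bounded f (\<Union>i\<in>I. S i) C"
proof (rule sums_boundedI)
  fix F assume F: "finite F" "F \<subseteq> (\<Union>i\<in>I. S i)"
  then obtain g where g: "\<And>x. x \<in> F \<Longrightarrow> g x \<in> I \<and> x \<in> S (g x)" by (metis UN_E subsetD)
  have "sum f F = (\<Sum>i\<in>g ` F. sum f {x \<in> F. g x = i})"
    using F(1) by (rule sum.image_gen)
  also have "\<dots> \<le> (\<Sum>i\<in>g ` F. c i)"
    using F g by (intro sum_mono sums_boundedD[OF assms(1)]) (auto, metis)
  also have "\<dots> \<le> C"
    using F g by (intro sums_boundedD[OF assms(2)]) auto
  finally show "sum f F \<le> C" .
qed

text \<open>\<open>k\<close> may fail to be injective: each value is charged to one chosen pair
  \<open>e z\<close>, and \<open>e\<close> is injective because \<open>k\<close> inverts it.\<close>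

lemma sums_bounded_prod:
  assumes "sums_bounded f S C" "sums_bounded g T D"
    and "\<And>x. x \<in> S \<Longrightarrow> 0 \<le> f x" "\<And>y. y \<in> T \<Longrightarrow> 0 \<le> g y"
    and "\<And>x y. x \<in> S \<Longrightarrow> y \<in> T \<Longrightarrow> h (k x y) \<le> f x * g y"
    and "\<And>z. 0 \<le> h z"
  shows "sums_bounded h {k x y | x y. x \<in> S \<and> y \<in> T} (C * D)"
proof (rule sums_boundedI)
  fix F assume F: "finite F" "F \<subseteq> {k x y | x y. x \<in> S \<and> y \<in> T}"
  then have "\<forall>z\<in>F. \<exists>p. fst p \<in> S \<and> snd p \<in> T \<and> z = k (fst p) (snd p)" by fastforce
  then obtain e where e: "\<And>z. z \<in> F \<Longrightarrow> fst (e z) \<in> S \<and> snd (e z) \<in> T \<and> z = k (fst (e z)) (snd (e z))"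
    by metis
  define X Y where "X = fst ` e ` F" and "Y = snd ` e ` F"
  have XY: "finite X" "finite Y" "X \<subseteq> S" "Y \<subseteq> T" using F e by (auto simp: X_def Y_def)
  have inj: "inj_on e F" by (rule inj_on_inverseI[of _ "\<lambda>p. k (fst p) (snd p)"]) (use e in auto)
  have "sum h F \<le> (\<Sum>z\<in>F. f (fst (e z)) * g (snd (e z)))"
    using e assms(5) by (intro sum_mono) metis
  also have "\<dots> = (\<Sum>p\<in>e ` F. f (fst p) * g (snd p))" using inj by (simp add: sum.reindex)
  also have "\<dots> \<le> (\<Sum>p\<in>X \<times> Y. f (fst p) * g (snd p))"
  proof (rule sum_mono2)
    show "e ` F \<subseteq> X \<times> Y"
      unfolding X_def Y_def by (intro subsetI) (simp only: mem_Times_iff imageI)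
  qed (use XY assms(3,4) in \<open>auto simp: mem_Times_iff subset_iff\<close>)
  also have "\<dots> = sum f X * sum g Y"
    by (simp add: sum_product sum.cartesian_product case_prod_beta)
  also have "\<dots> \<le> C * D"
    using XY assms sums_bounded_nonneg[OF assms(1)]
    by (intro mult_mono sums_boundedD[of f S C] sums_boundedD[of g T D] sum_nonneg) auto
  finally show "sum h F \<le> C * D" .
qed

section \<open>Weights of words and their partition sums\<close>

definition words :: "nat \<Rightarrow> nat list set" where
  "words n = {as. length as = n \<and> pos_word as}"

text \<open>Up to a constant this is the \<theta>-th power of the length of the cylinder of
  \<open>as\<close>, hence its cost in a cover.\<close>

definition wt :: "real \<Rightarrow> nat list \<Rightarrow> real" where
  "wt \<theta> as = cf_den as 0 powr (- 2 * \<theta>)"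

lemma wt_nonneg [simp]: "0 \<le> wt \<theta> as"
  by (simp add: wt_def)

lemma wt_pos: "pos_word as \<Longrightarrow> 0 < wt \<theta> as"
  using cf_den_bounds(1)[of as] by (simp add: wt_def)

lemma wt_single: "wt \<theta> [a] = real a powr (- 2 * \<theta>)"
  by (simp add: wt_def)

definition part_sum :: "real \<Rightarrow> nat \<Rightarrow> real" where
  "part_sum \<theta> n = infsum (wt \<theta>) (words n)"

lemma pressure_eq: "pressure \<theta> = lim (\<lambda>n. ln (part_sum \<theta> n) / real n)"
proof -
  have "(\<Sum>\<^sub>\<infinity>as\<in>{as. length as = n \<and> pos_word as}. of_int (cf_denom as) powr (- 2 * \<theta>))
      = part_sum \<theta> n" for n
    unfolding part_sum_def words_def by (intro infsum_cong) (auto simp: cf_denom_eq wt_def)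
  then show ?thesis unfolding pressure_def by simp
qed

lemma wt_append_le:
  assumes "pos_word as" "pos_word bs" "0 \<le> \<theta>"
  shows "wt \<theta> (as @ bs) \<le> wt \<theta> as * wt \<theta> bs"
proof -
  have "1 \<le> cf_den as 0" "1 \<le> cf_den bs 0" using assms cf_den_bounds by auto
  moreover from this have "1 * 1 \<le> cf_den as 0 * cf_den bs 0" by (intro mult_mono) auto
  ultimately show ?thesis using cf_den_append_ge[OF assms(1,2)] assms(3) unfolding wt_def
    by (subst powr_mult[symmetric]) (auto intro!: powr_mono2')
qed

text \<open>The factor 2 in \<open>cf_den_append_le\<close>, raised to the power 2 \<theta>, is
  \<open>4 powr \<theta>\<close>.\<close>

lemma wt_append_ge:
  assumes "pos_word as" "pos_word bs" "0 \<le> \<theta>"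
  shows "wt \<theta> as * wt \<theta> bs \<le> 4 powr \<theta> * wt \<theta> (as @ bs)"
proof -
  have "pos_word (as @ bs)" using assms by auto
  with assms have 1: "1 \<le> cf_den as 0" "1 \<le> cf_den bs 0" "1 \<le> cf_den (as @ bs) 0"
    by (intro cf_den_bounds(1); simp)+
  have "(4::real) powr \<theta> = (2 powr 2) powr \<theta>" by simp
  then have 4: "(4::real) powr \<theta> = 2 powr (2 * \<theta>)" by (simp only: powr_powr)
  have "2 powr (- 2 * \<theta>) * (wt \<theta> as * wt \<theta> bs) = (2 * cf_den as 0 * cf_den bs 0) powr (- 2 * \<theta>)"
    using 1 by (simp add: powr_mult wt_def)
  also have "\<dots> \<le> wt \<theta> (as @ bs)"
    using cf_den_append_le[OF assms(1,2)] assms(3) 1 unfolding wt_def by (intro powr_mono2') auto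
  finally have "4 powr \<theta> * (2 powr (- 2 * \<theta>) * (wt \<theta> as * wt \<theta> bs)) \<le> 4 powr \<theta> * wt \<theta> (as @ bs)"
    by (intro mult_left_mono) auto
  then show ?thesis by (simp add: 4 powr_minus field_simps)
qed

text \<open>Integral test with the antiderivative \<open>- \<phi>\<close> of x^(-2 \<theta>). The
  summand 1 of the constant pays for the first term, bounded by m^(1 - 2 \<theta>) as m \<ge> 1; the
  other summand is the integral.\<close>

lemma powr_sum_tail:
  assumes "1 / 2 < \<theta>" "0 < A"
  shows "sums_bounded (\<lambda>a. real a powr (- 2 * \<theta>)) {a::nat. 1 \<le> a \<and> A \<le> real a}
    ((1 + 1 / (2 * \<theta> - 1)) * A powr (1 - 2 * \<theta>))"
proof (rule sums_boundedI)
  fix F assume F: "finite F" "F \<subseteq> {a::nat. 1 \<le> a \<and> A \<le> real a}"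
  define m where "m = max 1 (nat \<lceil>A\<rceil>)"
  define c where "c = 2 * \<theta> - 1"
  have c: "0 < c" using assms by (simp add: c_def)
  have m: "1 \<le> m" "A \<le> real m" unfolding m_def by linarith+
  define \<phi> where "\<phi> x = x powr (- c) / c" for x :: real
  have step: "real (Suc a) powr (- 2 * \<theta>) \<le> \<phi> (real a) - \<phi> (real (Suc a))" if "1 \<le> a" for a
  proof -
    have "\<exists>z. real a < z \<and> z < real (Suc a) \<and>
        \<phi> (real (Suc a)) - \<phi> (real a) = (real (Suc a) - real a) * (- (z powr (- 2 * \<theta>)))"
    proof (rule MVT2)
      fix x assume "real a \<le> x" "x \<le> real (Suc a)"
      then have x: "0 < x" using that by linarith
      have "(\<phi> has_real_derivative - (x powr (- c - 1))) (at x)"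
        unfolding \<phi>_def using x c by (auto intro!: derivative_eq_intros)
      moreover have "- c - 1 = - 2 * \<theta>" by (simp add: c_def)
      ultimately show "(\<phi> has_real_derivative - (x powr (- 2 * \<theta>))) (at x)" by (simp only:)
    qed simp
    then obtain z where z: "real a < z" "z < real (Suc a)"
      "\<phi> (real (Suc a)) - \<phi> (real a) = - (z powr (- 2 * \<theta>))" by auto
    have "real (Suc a) powr (- 2 * \<theta>) \<le> z powr (- 2 * \<theta>)"
      using z that assms by (intro powr_mono2') auto
    then show ?thesis using z by simp
  qed
  have sum_bound: "(\<Sum>a=Suc m..m + k. real a powr (- 2 * \<theta>)) \<le> \<phi> (real m) - \<phi> (real (m + k))" for k
  proof (induction k)
    case (Suc k)
    have "(\<Sum>a=Suc m..m + Suc k. real a powr (- 2 * \<theta>))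
        = (\<Sum>a=Suc m..m + k. real a powr (- 2 * \<theta>)) + real (Suc (m + k)) powr (- 2 * \<theta>)"
      by simp
    then show ?case using Suc step[of "m + k"] m by simp
  qed simp
  obtain k where k: "F \<subseteq> {..m + k}" using F finite_nat_iff_bounded_le[of F]
    by (metis atMost_subset_iff le_add2 order_trans)
  have Fm: "m \<le> a" if "a \<in> F" for a using F that unfolding m_def by (auto simp: ceiling_le_iff nat_le_iff)
  have "(\<Sum>a\<in>F. real a powr (- 2 * \<theta>)) \<le> (\<Sum>a=m..m + k. real a powr (- 2 * \<theta>))"
    using F k Fm by (intro sum_mono2) auto
  also have "\<dots> = real m powr (- 2 * \<theta>) + (\<Sum>a=Suc m..m + k. real a powr (- 2 * \<theta>))"
    by (simp add: sum.atLeast_Suc_atMost)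
  also have "\<dots> \<le> real m powr (- c) + real m powr (- c) / c"
    using sum_bound[of k] c m by (intro add_mono powr_mono) (auto simp: \<phi>_def c_def intro: order_trans)
  also have "\<dots> = (1 + 1 / c) * real m powr (- c)" by (simp add: algebra_simps)
  also have "\<dots> \<le> (1 + 1 / c) * A powr (- c)"
    using m assms c by (intro mult_left_mono powr_mono2') auto
  finally show "(\<Sum>a\<in>F. real a powr (- 2 * \<theta>)) \<le> (1 + 1 / (2 * \<theta> - 1)) * A powr (1 - 2 * \<theta>)"
    by (simp add: c_def)
qed

lemma words_0 [simp]: "words 0 = {[]}"
  by (auto simp: words_def)

lemma words_add: "words (n + m) = {as @ bs | as bs. as \<in> words n \<and> bs \<in> words m}"
proof (intro set_eqI iffI)
  fix w assume "w \<in> words (n + m)"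
  then have "w = take n w @ drop n w" "take n w \<in> words n" "drop n w \<in> words m"
    by (auto simp: words_def dest: in_set_takeD in_set_dropD)
  then show "w \<in> {as @ bs | as bs. as \<in> words n \<and> bs \<in> words m}" by blast
qed (auto simp: words_def)

lemma words_1: "words 1 = (\<lambda>a. [a]) ` {1..}"
  by (auto simp: words_def length_Suc_conv)

context
  fixes \<theta> :: real
  assumes \<theta>: "1 / 2 < \<theta>"
begin

lemma wt_summable: "wt \<theta> summable_on words n"
proof -
  define C where "C = (1 + 1 / (2 * \<theta> - 1)) * 1 powr (1 - 2 * \<theta>)"
  have 1: "sums_bounded (wt \<theta>) (words 1) C"
  proof (rule sums_boundedI)
    fix F assume F: "finite F" "F \<subseteq> words 1"
    define G where "G = hd ` F"
    have hd: "x = [hd x]" if "x \<in> F" for x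
      using subsetD[OF F(2) that] unfolding words_1 by auto
    have inj: "inj_on hd F" by (rule inj_on_inverseI[of _ "\<lambda>a. [a]"]) (use hd in simp)
    have "sum (wt \<theta>) F = (\<Sum>a\<in>G. real a powr (- 2 * \<theta>))"
      unfolding G_def sum.reindex[OF inj] using hd by (intro sum.cong) (simp_all only: o_def, metis wt_single)
    also have "\<dots> \<le> C"
      unfolding C_def using F \<theta> hd
      by (intro sums_boundedD[OF powr_sum_tail]) (auto simp: G_def words_def subset_iff, metis list.set_intros(1))
    finally show "sum (wt \<theta>) F \<le> C" .
  qed
  have "sums_bounded (wt \<theta>) (words n) (C ^ n)"
  proof (induction n)
    case (Suc n)
    have "sums_bounded (wt \<theta>) (words (1 + n)) (C * C ^ n)"
      unfolding words_add by (rule sums_bounded_prod[OF 1 Suc])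
        (use \<theta> in \<open>auto simp: words_def intro!: wt_append_le\<close>)
    then show ?case by simp
  qed (auto intro!: sums_bounded_singleton simp: wt_def)
  then show ?thesis by (rule sums_bounded_summable_on) auto
qed

lemma wt_sums_bounded: "sums_bounded (wt \<theta>) (words n) (part_sum \<theta> n)"
  unfolding part_sum_def by (intro sums_bounded_infsum wt_summable) auto

lemma part_sum_le: "sums_bounded (wt \<theta>) (words n) C \<Longrightarrow> part_sum \<theta> n \<le> C"
  unfolding part_sum_def by (intro sums_bounded_infsum_le) auto

lemma part_sum_pos: "0 < part_sum \<theta> n"
proof -
  have "replicate n 1 \<in> words n" by (auto simp: words_def)
  then have "sum (wt \<theta>) {replicate n 1} \<le> part_sum \<theta> n"
    by (intro sums_boundedD[OF wt_sums_bounded]) auto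
  moreover have "0 < wt \<theta> (replicate n 1)" by (intro wt_pos) auto
  ultimately show ?thesis by simp
qed

lemma part_sum_add_le: "part_sum \<theta> (n + m) \<le> part_sum \<theta> n * part_sum \<theta> m"
  unfolding words_add using \<theta>
  by (intro part_sum_le, unfold words_add, intro sums_bounded_prod[OF wt_sums_bounded wt_sums_bounded])
    (auto simp: words_def intro!: wt_append_le)

text \<open>Concatenation is injective on words of fixed lengths, so finite sums multiply. The two
  infinite sums are then reached one after the other, each time dividing by a positive factor that
  is held fixed.\<close>

lemma part_sum_add_ge: "part_sum \<theta> n * part_sum \<theta> m \<le> 4 powr \<theta> * part_sum \<theta> (n + m)"
proof -
  have 1: "sum (wt \<theta>) F * sum (wt \<theta>) G \<le> 4 powr \<theta> * part_sum \<theta> (n + m)"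
    if "finite F" "F \<subseteq> words n" "finite G" "G \<subseteq> words m" for F G
  proof -
    have inj: "inj_on (\<lambda>(x, y). x @ y) (F \<times> G)"
      using that by (auto simp: inj_on_def words_def subset_iff)
    have "sum (wt \<theta>) F * sum (wt \<theta>) G = (\<Sum>(x, y)\<in>F \<times> G. wt \<theta> x * wt \<theta> y)"
      by (simp add: sum_product sum.cartesian_product)
    also have "\<dots> \<le> (\<Sum>(x, y)\<in>F \<times> G. 4 powr \<theta> * wt \<theta> (x @ y))"
      using that \<theta> by (intro sum_mono) (auto simp: words_def subset_iff intro!: wt_append_ge)
    also have "\<dots> = 4 powr \<theta> * sum (wt \<theta>) ((\<lambda>(x, y). x @ y) ` (F \<times> G))"
      unfolding sum.reindex[OF inj] sum_distrib_left by (simp add: case_prod_beta)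
    also have "\<dots> \<le> 4 powr \<theta> * part_sum \<theta> (n + m)"
      using that by (intro mult_left_mono sums_boundedD[OF wt_sums_bounded]) (auto simp: words_add)
    finally show ?thesis .
  qed
  have 2: "sum (wt \<theta>) F * part_sum \<theta> m \<le> 4 powr \<theta> * part_sum \<theta> (n + m)"
    if "finite F" "F \<subseteq> words n" for F
  proof (cases "sum (wt \<theta>) F = 0")
    case True then show ?thesis using part_sum_pos[of "n + m"] by simp
  next
    case False
    then have pos: "0 < sum (wt \<theta>) F" by (simp add: order_less_le sum_nonneg)
    have "part_sum \<theta> m \<le> 4 powr \<theta> * part_sum \<theta> (n + m) / sum (wt \<theta>) F"
      using 1[OF that] pos by (intro part_sum_le sums_boundedI) (simp add: field_simps)
    then show ?thesis using pos by (simp add: field_simps)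
  qed
  have "part_sum \<theta> n \<le> 4 powr \<theta> * part_sum \<theta> (n + m) / part_sum \<theta> m"
    using 2 part_sum_pos[of m] by (intro part_sum_le sums_boundedI) (simp add: field_simps)
  then show ?thesis using part_sum_pos[of m] by (simp add: field_simps)
qed

end

section \<open>The pressure function\<close>

text \<open>Comparing a (n m) with n a(m) and with m a(n) gives |a n / n - a m / m| \<le> C / n + C
  / m, hence a Cauchy sequence. Letting n grow along multiples of m yields bounds whose error C does
  not depend on m.\<close>

lemma almost_additive_limit:
  fixes a :: "nat \<Rightarrow> real"
  assumes le: "\<And>n m. a (n + m) \<le> a n + a m" and ge: "\<And>n m. a n + a m \<le> a (n + m) + C"
  shows "\<exists>L. (\<lambda>n. a n / real n) \<longlonglongrightarrow> L \<and> (\<forall>n. real n * L \<le> a n \<and> a n \<le> real n * L + C)"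
proof -
  have C: "0 \<le> C" using le[of 0 0] ge[of 0 0] by simp
  have a0: "0 \<le> a 0" "a 0 \<le> C" using le[of 0 0] ge[of 0 0] by simp_all
  have up: "a (n * m) \<le> real n * a m" if "1 \<le> n" for n m
    using that
  proof (induction n rule: dec_induct)
    case (step n)
    then show ?case using le[of "n * m" m] by (simp add: algebra_simps)
  qed simp
  have lo: "real n * a m - real n * C \<le> a (n * m)" if "1 \<le> n" for n m
    using that
  proof (induction n rule: dec_induct)
    case (step n)
    then show ?case using ge[of "n * m" m] by (simp add: algebra_simps)
  qed (use C in simp)
  have up': "a (n * m) / real (n * m) \<le> a m / real m" if "1 \<le> n" "1 \<le> m" for n m
    using up[OF that(1), of m] that by (simp add: field_simps)
  have lo': "a m / real m - C / real m \<le> a (n * m) / real (n * m)" if "1 \<le> n" "1 \<le> m" for n m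
  proof -
    have "a m / real m - C / real m = (real n * a m - real n * C) / real (n * m)"
      using that by (simp add: field_simps)
    then show ?thesis using lo[OF that(1), of m] by (metis divide_right_mono of_nat_0_le_iff)
  qed
  have diff: "\<bar>a n / real n - a m / real m\<bar> \<le> C / real n + C / real m" if "1 \<le> n" "1 \<le> m" for n m
    using up'[OF that] lo'[OF that] up'[OF that(2,1)] lo'[OF that(2,1)] C
    by (simp add: mult.commute abs_le_iff add_increasing add_increasing2)
  have "Cauchy (\<lambda>n. a n / real n)"
  proof (rule metric_CauchyI)
    fix e :: real assume e: "0 < e"
    obtain M' :: nat where "2 * C / e < real M'" using reals_Archimedean2 by blast
    then obtain M where M: "1 \<le> M" "2 * C / e < real M" by (intro that[of "max 1 M'"]) auto
    have "dist (a m / real m) (a n / real n) < e" if "M \<le> m" "M \<le> n" for m n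
    proof -
      have "C / real m \<le> C / real M" "C / real n \<le> C / real M"
        using that M C by (auto intro!: divide_left_mono)
      moreover have "C / real M < e / 2" using M e by (simp add: field_simps)
      ultimately show ?thesis using diff[of m n] that M unfolding dist_real_def by linarith
    qed
    then show "\<exists>M. \<forall>m\<ge>M. \<forall>n\<ge>M. dist (a m / real m) (a n / real n) < e" by blast
  qed
  then obtain L where L: "(\<lambda>n. a n / real n) \<longlonglongrightarrow> L"
    using Cauchy_convergent_iff convergent_def by blast
  have "real m * L \<le> a m \<and> a m \<le> real m * L + C" for m
  proof (cases "m = 0")
    case True then show ?thesis using a0 by simp
  next
    case False
    have sub: "(\<lambda>n. a (n * m) / real (n * m)) \<longlonglongrightarrow> L"
      using LIMSEQ_subseq_LIMSEQ[OF L, of "\<lambda>n. n * m"] False by (auto simp: strict_mono_def o_def)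
    have "L \<le> a m / real m"
      using sub up'[of _ m] False by (intro LIMSEQ_le_const2[OF sub] exI[of _ 1]) auto
    moreover have "a m / real m - C / real m \<le> L"
      using sub lo'[of _ m] False by (intro LIMSEQ_le_const[OF sub] exI[of _ 1]) auto
    ultimately show ?thesis using False by (simp add: field_simps)
  qed
  then show ?thesis using L by blast
qed

text \<open>The two exponential bounds are free of subexponential errors. The lower one makes long
  blocks heavy in the Cantor set, the upper one makes the cost of the covers summable.\<close>

lemma pressure_props:
  assumes "1 / 2 < \<theta>"
  shows "(\<lambda>n. ln (part_sum \<theta> n) / real n) \<longlonglongrightarrow> pressure \<theta>"
    and "exp (real n * pressure \<theta>) \<le> part_sum \<theta> n"
    and "part_sum \<theta> n \<le> 4 powr \<theta> * exp (real n * pressure \<theta>)"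
proof -
  let ?a = "\<lambda>n. ln (part_sum \<theta> n)"
  note pos = part_sum_pos[OF assms]
  have "\<exists>L. (\<lambda>n. ?a n / real n) \<longlonglongrightarrow> L
      \<and> (\<forall>n. real n * L \<le> ?a n \<and> ?a n \<le> real n * L + ln (4 powr \<theta>))"
  proof (rule almost_additive_limit)
    show "?a (n + m) \<le> ?a n + ?a m" for n m
    proof -
      have "?a (n + m) \<le> ln (part_sum \<theta> n * part_sum \<theta> m)"
        using part_sum_add_le[OF assms, of n m] pos[of n] pos[of m] pos[of "n + m"]
        by (subst ln_le_cancel_iff) auto
      then show ?thesis using pos[of n] pos[of m] by (simp add: ln_mult_pos)
    qed
    show "?a n + ?a m \<le> ?a (n + m) + ln (4 powr \<theta>)" for n m
    proof -
      have "ln (part_sum \<theta> n * part_sum \<theta> m) \<le> ln (4 powr \<theta> * part_sum \<theta> (n + m))"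
        using part_sum_add_ge[OF assms, of n m] pos[of n] pos[of m] pos[of "n + m"]
        by (subst ln_le_cancel_iff) auto
      then show ?thesis using pos[of n] pos[of m] pos[of "n + m"] by (simp add: ln_mult_pos ln_powr)
    qed
  qed
  then obtain L where L: "(\<lambda>n. ?a n / real n) \<longlonglongrightarrow> L"
    "\<And>n. real n * L \<le> ?a n" "\<And>n. ?a n \<le> real n * L + ln (4 powr \<theta>)" by blast
  have P: "pressure \<theta> = L" unfolding pressure_eq using L(1) by (rule limI)
  show "(\<lambda>n. ?a n / real n) \<longlonglongrightarrow> pressure \<theta>" using L P by simp
  show "exp (real n * pressure \<theta>) \<le> part_sum \<theta> n"
    using L(2)[of n] pos[of n] P by (metis exp_le_cancel_iff exp_ln)
  have "part_sum \<theta> n = exp (?a n)" using pos[of n] by simp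
  also have "\<dots> \<le> exp (real n * L + ln (4 powr \<theta>))" using L(3)[of n] by simp
  also have "\<dots> = 4 powr \<theta> * exp (real n * L)" by (simp add: exp_add powr_def)
  finally show "part_sum \<theta> n \<le> 4 powr \<theta> * exp (real n * pressure \<theta>)" using P by simp
qed

lemma pressure_mono:
  assumes "1 / 2 < \<theta>" "\<theta> \<le> \<theta>'"
  shows "pressure \<theta>' \<le> pressure \<theta>"
proof (rule LIMSEQ_le[OF pressure_props(1) pressure_props(1)])
  have 1: "1 / 2 < \<theta>'" using assms by simp
  have "part_sum \<theta>' n \<le> part_sum \<theta> n" for n
  proof (rule part_sum_le[OF 1], rule sums_bounded_mono[OF wt_sums_bounded[OF assms(1)]])
    show "wt \<theta>' as \<le> wt \<theta> as" if "as \<in> words n" for as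
      using that assms cf_den_bounds(1)[of as] unfolding wt_def
      by (intro powr_mono) (auto simp: words_def)
  qed auto
  then have "ln (part_sum \<theta>' n) / real n \<le> ln (part_sum \<theta> n) / real n" for n
    using part_sum_pos[OF 1, of n] part_sum_pos[OF assms(1), of n]
    by (intro divide_right_mono) (auto simp: ln_le_cancel_iff)
  then show "\<exists>N. \<forall>n\<ge>N. ln (part_sum \<theta>' n) / real n \<le> ln (part_sum \<theta> n) / real n" by blast
qed (use assms in auto)

text \<open>Hoelder's inequality: Young's inequality is applied to the weights normalised by their
  total sums X and Y, and then summed.\<close>

lemma part_sum_log_convex:
  assumes "1 / 2 < x" "1 / 2 < y" "0 \<le> u" "0 \<le> v" "u + v = 1"
  shows "part_sum (u * x + v * y) n \<le> part_sum x n powr u * part_sum y n powr v"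
proof -
  define z where "z = u * x + v * y"
  have z: "1 / 2 < z"
  proof -
    have "u * (1 / 2) + v * (1 / 2) < z"
    proof (cases "u = 0")
      case True then show ?thesis using assms by (simp add: z_def)
    next
      case False
      then have "u * (1 / 2) < u * x" using assms by simp
      moreover have "v * (1 / 2) \<le> v * y" using assms by (intro mult_left_mono) auto
      ultimately show ?thesis by (simp add: z_def)
    qed
    then show ?thesis using assms(5) by (simp flip: distrib_right)
  qed
  define X Y where "X = part_sum x n" and "Y = part_sum y n"
  have XY: "0 < X" "0 < Y" using part_sum_pos assms by (auto simp: X_def Y_def)
  have "sums_bounded (wt z) (words n) (X powr u * Y powr v)"
  proof (rule sums_boundedI)
    fix F assume F: "finite F" "F \<subseteq> words n"
    have 1: "wt z as \<le> X powr u * Y powr v * (u * (wt x as / X) + v * (wt y as / Y))"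
      if "as \<in> F" for as
    proof -
      have q: "0 < wt x as" "0 < wt y as" "0 < cf_den as 0"
        using F that cf_den_bounds(1)[of as] by (auto intro!: wt_pos simp: words_def)
      have "(wt x as / X) powr u * (wt y as / Y) powr v \<le> u * (wt x as / X) + v * (wt y as / Y)"
        using q XY assms by (intro Youngs_inequality_0) auto
      moreover have "wt x as powr u * wt y as powr v = wt z as"
        by (simp add: wt_def powr_powr z_def algebra_simps flip: powr_add)
      then have "wt z as = X powr u * Y powr v * ((wt x as / X) powr u * (wt y as / Y) powr v)"
        using q XY by (simp add: powr_divide)
      ultimately show ?thesis using XY by (simp add: mult_left_mono)
    qed
    have "sum (wt z) F \<le> (\<Sum>as\<in>F. X powr u * Y powr v * (u * (wt x as / X) + v * (wt y as / Y)))"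
      using 1 by (rule sum_mono)
    also have "\<dots> = X powr u * Y powr v * (u * (sum (wt x) F / X) + v * (sum (wt y) F / Y))"
      by (simp only: sum_distrib_left[symmetric] sum.distrib sum_divide_distrib[symmetric])
    also have "\<dots> \<le> X powr u * Y powr v * (u * 1 + v * 1)"
      using F assms XY sums_boundedD[OF wt_sums_bounded] unfolding X_def Y_def
      by (intro mult_left_mono add_mono) auto
    finally show "sum (wt z) F \<le> X powr u * Y powr v" using assms by simp
  qed
  then show ?thesis unfolding X_def Y_def z_def using z[unfolded z_def] by (intro part_sum_le)
qed

text \<open>Convexity serves to obtain continuity on the open half-line.\<close>

lemma pressure_convex: "convex_on {1 / 2<..} pressure"
proof (rule convex_onI)
  fix t x y :: real assume t: "0 < t" "t < 1" and xy: "x \<in> {1 / 2<..}" "y \<in> {1 / 2<..}"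
  define z where "z = (1 - t) * x + t * y"
  have z: "1 / 2 < z" using convexD[OF convex_real_interval(3)[of "1/2"] xy, of "1 - t" t] t
    by (simp add: z_def)
  have "ln (part_sum z n) / real n \<le> (1 - t) * (ln (part_sum x n) / real n) + t * (ln (part_sum y n) / real n)" for n
  proof -
    have pos: "0 < part_sum x n" "0 < part_sum y n" "0 < part_sum z n"
      using part_sum_pos xy z by auto
    have "ln (part_sum z n) \<le> ln (part_sum x n powr (1 - t) * part_sum y n powr t)"
      using part_sum_log_convex[of x y "1 - t" t n] xy t pos unfolding z_def
      by (subst ln_le_cancel_iff) auto
    also have "\<dots> = (1 - t) * ln (part_sum x n) + t * ln (part_sum y n)"
      using pos by (simp add: ln_mult_pos ln_powr)
    finally have "ln (part_sum z n) / real n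
        \<le> ((1 - t) * ln (part_sum x n) + t * ln (part_sum y n)) / real n"
      by (rule divide_right_mono) simp
    then show ?thesis by (simp add: add_divide_distrib)
  qed
  then have "pressure z \<le> (1 - t) * pressure x + t * pressure y"
    using xy by (intro LIMSEQ_le[OF pressure_props(1)[OF z] tendsto_add[OF tendsto_mult_left
      [OF pressure_props(1)] tendsto_mult_left[OF pressure_props(1)]]]) auto
  then show "pressure ((1 - t) *\<^sub>R x + t *\<^sub>R y) \<le> (1 - t) * pressure x + t * pressure y"
    by (simp add: z_def)
qed auto

lemma pressure_continuous: "continuous_on {1 / 2<..} pressure"
  by (intro convex_on_continuous pressure_convex) auto

text \<open>The cylinder of a word has length \<open>1 / (cf_den as 0 * cf_den as 1)\<close>; the cylinders of a
  given level are disjoint subintervals of the unit interval.\<close>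

lemma cylinder_lengths:
  "sums_bounded (\<lambda>as. 1 / (cf_den as 0 * cf_den as 1)) (words n) 1"
proof (induction n)
  case 0
  then show ?case by (auto intro!: sums_bounded_singleton)
next
  case (Suc n)
  let ?f = "\<lambda>as. 1 / (cf_den as 0 * cf_den as 1)"
  have nonneg: "0 \<le> ?f as" for as
  proof -
    have "0 \<le> cf_tail bs t" if "0 \<le> t" for bs t using that by (induction bs) auto
    then have "0 \<le> cf_den bs t" if "0 \<le> t" for bs t using that by (induction bs) auto
    then show ?thesis by simp
  qed
  have last: "sums_bounded ?f ((\<lambda>a. as @ [a]) ` {1..}) (?f as)" if as: "as \<in> words n" for as
  proof (rule sums_boundedI)
    fix F assume F: "finite F" "F \<subseteq> (\<lambda>a. as @ [a]) ` {1::nat..}"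
    obtain p p' q q' where q: "1 \<le> q" "0 \<le> q'"
      and t: "\<And>t. t \<ge> 0 \<Longrightarrow> cf_den as t = q + q' * t"
      using cf_den_affine[of as] as unfolding words_def by blast
    obtain G where G: "G \<subseteq> {1..}" "F = (\<lambda>a. as @ [a]) ` G" "finite G"
      using F by (metis finite_subset_image)
    obtain k where k: "G \<subseteq> {1..<1 + k}"
    proof -
      obtain k where "\<forall>a\<in>G. a < k" using G(3) finite_nat_set_iff_bounded[of G] by auto
      then have "G \<subseteq> {1..<1 + k}" using G(1) by (auto simp: subset_iff)
      then show ?thesis by (rule that)
    qed
    let ?d = "\<lambda>a::nat. real a * q + q'"
    have d: "0 < ?d a" if "1 \<le> a" for a using q that by (auto intro!: add_pos_nonneg)
    \<comment> \<open>The denominators at the two ends of the subcylinder with digit a are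
      \<open>?d a\<close> and \<open>?d (Suc a)\<close>, which differ by q; hence the lengths
      telescope over a.\<close>
    have eq: "?f (as @ [a]) = 1 / q * (1 / ?d a - 1 / ?d (Suc a))" if "1 \<le> a" for a
    proof -
      have "cf_den (as @ [a]) 0 = ?d a" "cf_den (as @ [a]) 1 = ?d (Suc a)"
        using that by (auto simp: cf_den_append t field_simps)
      then show ?thesis using d[OF that] d[of "Suc a"] that q by (simp add: field_simps)
    qed
    have "sum ?f F = (\<Sum>a\<in>G. ?f (as @ [a]))"
      unfolding G(2) by (rule sum.reindex_cong[OF _ refl refl]) (simp add: inj_on_def)
    also have "\<dots> \<le> (\<Sum>a=1..<1 + k. ?f (as @ [a]))" using k nonneg by (intro sum_mono2) auto
    also have "\<dots> = 1 / q * (\<Sum>a=1..<1 + k. 1 / ?d a - 1 / ?d (Suc a))"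
      unfolding sum_distrib_left by (intro sum.cong eq) auto
    also have "(\<Sum>a=1..<1 + k. 1 / ?d a - 1 / ?d (Suc a)) = 1 / ?d 1 - 1 / ?d (1 + k)"
      by (induction k) auto
    also have "1 / q * (1 / ?d 1 - 1 / ?d (1 + k)) \<le> 1 / q * (1 / ?d 1)"
      using d[of "1 + k"] q by (intro mult_left_mono) auto
    also have "\<dots> = ?f as" using t[of 0] t[of 1] q by (simp add: field_simps)
    finally show "sum ?f F \<le> ?f as" .
  qed
  have "words (Suc n) = (\<Union>as\<in>words n. (\<lambda>a. as @ [a]) ` {1..})"
    using words_add[of n 1] unfolding words_1 by auto
  then show ?case using sums_bounded_SUN[OF last Suc nonneg] by simp
qed

text \<open>At \<theta> = 1 the weights are cylinder lengths up to a factor 2, and these have total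
  at most 1. So exp (n P(1)) stays bounded.\<close>

lemma pressure_1: "pressure 1 \<le> 0"
proof -
  have "part_sum 1 n \<le> 2 * 1" for n
  proof (rule part_sum_le, simp, rule sums_bounded_mono[OF sums_bounded_cmult[OF cylinder_lengths[of n], of 2]])
    fix as assume "as \<in> words n"
    then have *: "1 \<le> cf_den as 0" "cf_den as 1 \<le> 2 * cf_den as 0" "1 \<le> cf_den as 1"
      using cf_den_bounds[of as] cf_den_ge_1[of as 1] by (auto simp: words_def)
    have "wt 1 as = 2 / (cf_den as 0 * (2 * cf_den as 0))"
      using * by (simp add: wt_def powr_minus powr_numeral power2_eq_square field_simps)
    also have "\<dots> \<le> 2 / (cf_den as 0 * cf_den as 1)"
      using * by (intro divide_left_mono mult_left_mono mult_pos_pos) auto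
    finally show "wt 1 as \<le> 2 * (1 / (cf_den as 0 * cf_den as 1))" by simp
  qed auto
  then have "exp (real n * pressure 1) \<le> 2" for n
    using order_trans[OF pressure_props(2)[of 1 n], of 2] by simp
  then have 1: "1 + real n * pressure 1 \<le> 2" for n
    using exp_ge_add_one_self[of "real n * pressure 1"] order_trans by blast
  show ?thesis
  proof (rule ccontr)
    assume "\<not> pressure 1 \<le> 0"
    then obtain n where "1 < real n * pressure 1"
      using reals_Archimedean3[of "pressure 1"] by force
    then show False using 1[of n] by simp
  qed
qed

text \<open>One-digit words suffice: their weights tend to the terms of the harmonic series as
  \<theta> decreases to 1/2, and \<open>part_sum \<theta> 1\<close> is at most a constant times exp
  P(\<theta>).\<close>

lemma pressure_unbounded: "\<exists>\<theta>. 1 / 2 < \<theta> \<and> \<theta> < 1 \<and> K < pressure \<theta>"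
proof -
  have "\<not> summable (\<lambda>n. inverse (real (Suc n)))"
    using not_summable_harmonic[where 'a = real] summable_Suc_iff[of "\<lambda>n. inverse (real n)"] by blast
  then obtain N where N: "4 * exp K < (\<Sum>n<N. inverse (real (Suc n)))"
    using summableI_nonneg_bounded[of "\<lambda>n. inverse (real (Suc n))" "4 * exp K"]
    by (force simp: not_less)
  define g where "g \<theta> = (\<Sum>n<N. real (Suc n) powr (- 2 * \<theta>))" for \<theta>
  have "(g \<longlongrightarrow> (\<Sum>n<N. real (Suc n) powr (- 2 * (1 / 2)))) (at_right (1 / 2))"
    unfolding g_def by (intro tendsto_intros) auto
  then have "(g \<longlongrightarrow> (\<Sum>n<N. inverse (real (Suc n)))) (at_right (1 / 2))"
    by (simp add: powr_minus)
  then have "\<forall>\<^sub>F \<theta> in at_right (1 / 2). 4 * exp K < g \<theta>" using N by (rule order_tendstoD)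
  moreover have "\<forall>\<^sub>F \<theta> in at_right (1 / 2 :: real). 1 / 2 < \<theta> \<and> \<theta> < 1"
    by (auto simp: eventually_at_right_field intro: exI[of _ 1])
  ultimately obtain \<theta> where \<theta>: "4 * exp K < g \<theta>" "1 / 2 < \<theta>" "\<theta> < 1"
    using eventually_happens'[OF _ eventually_conj] trivial_limit_at_right_real by (metis (no_types, lifting))
  have "g \<theta> = (\<Sum>as\<in>(\<lambda>n. [Suc n]) ` {..<N}. wt \<theta> as)"
    by (subst sum.reindex) (auto simp: inj_on_def g_def wt_single)
  also have "\<dots> \<le> part_sum \<theta> 1"
    using \<theta> by (intro sums_boundedD[OF wt_sums_bounded]) (auto simp: words_def)
  also have "\<dots> \<le> 4 powr \<theta> * exp (pressure \<theta>)" using pressure_props(3)[OF \<theta>(2), of 1] by simp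
  also have "\<dots> \<le> 4 powr 1 * exp (pressure \<theta>)" using \<theta> by (intro mult_right_mono powr_mono) auto
  also have "\<dots> = 4 * exp (pressure \<theta>)" by simp
  finally have "4 * exp K < 4 * exp (pressure \<theta>)" using \<theta>(1) by linarith
  then have "K < pressure \<theta>" by simp
  then show ?thesis using \<theta> by blast
qed

text \<open>\<open>c - pressure\<close> is continuous and strictly increasing, negative near 1/2 and
  positive at 1. That the root lies below 1 matters: the mass estimate for large digits is made for
  \<theta> < 1.\<close>

lemma pressure_root:
  fixes c :: "real \<Rightarrow> real"
  assumes c: "continuous_on {1 / 2<..} c" "strict_mono_on {1 / 2<..} c" "\<And>x. 1 / 2 < x \<Longrightarrow> 0 < c x"
  obtains \<theta>\<^sub>0 where "1 / 2 < \<theta>\<^sub>0" "\<theta>\<^sub>0 < 1" "pressure \<theta>\<^sub>0 = c \<theta>\<^sub>0"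
    "\<And>\<theta>. 1 / 2 < \<theta> \<Longrightarrow> \<theta> < \<theta>\<^sub>0 \<Longrightarrow> c \<theta> < pressure \<theta>"
    "\<And>\<theta>. \<theta>\<^sub>0 < \<theta> \<Longrightarrow> pressure \<theta> < c \<theta>"
proof -
  obtain l where l: "1 / 2 < l" "l < 1" "c 1 < pressure l" using pressure_unbounded by blast
  define f where "f \<theta> = c \<theta> - pressure \<theta>" for \<theta>
  have mono: "f x < f y" if "1 / 2 < x" "x < y" for x y
    using pressure_mono[of x y] that strict_mono_onD[OF c(2), of x y] by (auto simp: f_def)
  have "continuous_on {l..1} f" unfolding f_def
    using l by (intro continuous_intros continuous_on_subset[OF c(1)]
      continuous_on_subset[OF pressure_continuous]) auto
  moreover have "f l < 0" using l strict_mono_onD[OF c(2), of l 1] by (auto simp: f_def)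
  moreover have "0 < f 1" using c(3)[of 1] pressure_1 by (auto simp: f_def)
  ultimately obtain r where r: "l \<le> r" "r \<le> 1" "f r = 0"
    using IVT'[of f l 0 1] l by auto
  have "r \<noteq> 1" using r \<open>0 < f 1\<close> by auto
  moreover have "c \<theta> < pressure \<theta>" if "1 / 2 < \<theta>" "\<theta> < r" for \<theta>
    using mono[of \<theta> r] that r by (simp add: f_def)
  moreover have "pressure \<theta> < c \<theta>" if "r < \<theta>" for \<theta>
    using mono[of r \<theta>] that r l by (simp add: f_def)
  ultimately show ?thesis
    using r l by (intro that[of r]) (auto simp: f_def)
qed

section \<open>Hausdorff measure\<close>

lemma hausdorff_measure_subset:
  assumes "A \<subseteq> B"
  shows "hausdorff_measure s A \<le> hausdorff_measure s B"
  unfolding hausdorff_measure_def hausdorff_premeasure_def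
  using assms by (intro SUP_mono' INF_superset_mono) auto

lemma hausdorff_measure_eq_0_iff:
  "hausdorff_measure s A = 0 \<longleftrightarrow> (\<forall>\<delta>>0. hausdorff_premeasure s \<delta> A = 0)"
proof -
  have "hausdorff_measure s A = 0 \<longleftrightarrow> (SUP \<delta>\<in>{0<..}. hausdorff_premeasure s \<delta> A) \<le> 0"
    unfolding hausdorff_measure_def by simp
  also have "\<dots> \<longleftrightarrow> (\<forall>\<delta>>0. hausdorff_premeasure s \<delta> A = 0)"
    unfolding SUP_le_iff by auto
  finally show ?thesis .
qed

lemma hausdorff_measure_mono_exponent:
  fixes A :: "'a::metric_space set"
  assumes "hausdorff_measure s A = 0" "s \<le> t"
  shows "hausdorff_measure t A = 0"
  unfolding hausdorff_measure_eq_0_iff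
proof (intro allI impI)
  fix \<delta> :: real assume \<delta>: "0 < \<delta>"
  \<comment> \<open>Once diameters are at most 1, their powers decrease in the exponent.\<close>
  define \<epsilon> where "\<epsilon> = min \<delta> 1"
  have "hausdorff_premeasure t \<delta> A \<le> hausdorff_premeasure s \<epsilon> A"
    unfolding hausdorff_premeasure_def
  proof (rule INF_mono)
    fix U :: "nat \<Rightarrow> 'a set"
    assume "U \<in> {U. A \<subseteq> (\<Union>i. U i) \<and> (\<forall>i. bounded (U i) \<and> diameter (U i) \<le> \<epsilon>)}"
    then have U: "A \<subseteq> (\<Union>i. U i)" "\<And>i. bounded (U i)" "\<And>i. diameter (U i) \<le> \<epsilon>" by auto
    have "diameter (U i) powr t \<le> diameter (U i) powr s" for i
      using U(3)[of i] diameter_ge_0[OF U(2), of i] assms(2) by (intro powr_mono') (auto simp: \<epsilon>_def)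
    then have "(\<Sum>i. ennreal (diameter (U i) powr t)) \<le> (\<Sum>i. ennreal (diameter (U i) powr s))"
      by (intro suminf_le ennreal_leI) auto
    moreover have "U \<in> {U. A \<subseteq> (\<Union>i. U i) \<and> (\<forall>i. bounded (U i) \<and> diameter (U i) \<le> \<delta>)}"
      using U by (auto simp: \<epsilon>_def)
    ultimately show "\<exists>V\<in>{U. A \<subseteq> (\<Union>i. U i) \<and> (\<forall>i. bounded (U i) \<and> diameter (U i) \<le> \<delta>)}.
        (\<Sum>i. ennreal (diameter (V i) powr t)) \<le> (\<Sum>i. ennreal (diameter (U i) powr s))" by blast
  qed
  also have "\<dots> = 0" using assms(1) \<delta> by (simp add: hausdorff_measure_eq_0_iff \<epsilon>_def)
  finally show "hausdorff_premeasure t \<delta> A = 0" by simp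
qed

text \<open>Nullity passes to larger exponents, so nonvanishing needs to be known only for exponents
  in (l, d). This allows l = 1/2, above which the pressure is meaningful.\<close>

lemma hausdorff_dim_eqI:
  fixes A :: "'a::metric_space set"
  assumes "0 < d" and up: "\<And>s. d < s \<Longrightarrow> hausdorff_measure s A = 0"
    and lo: "\<And>s. l < s \<Longrightarrow> s < d \<Longrightarrow> hausdorff_measure s A \<noteq> 0" and "l < d"
  shows "hausdorff_dim A = ereal d"
proof (rule antisym)
  show "hausdorff_dim A \<le> ereal d"
  proof (rule ereal_le_epsilon2)
    fix e :: real assume "0 < e"
    then show "hausdorff_dim A \<le> ereal d + ereal e"
      unfolding hausdorff_dim_def using assms(1) by (intro INF_lower2[of "d + e"]) (auto intro!: up)
  qed
  show "ereal d \<le> hausdorff_dim A"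
    unfolding hausdorff_dim_def
  proof (rule INF_greatest)
    fix s assume "s \<in> {s. 0 < s \<and> hausdorff_measure s A = 0}"
    then have s: "hausdorff_measure s A = 0" by auto
    have "d \<le> s"
    proof (rule ccontr)
      assume "\<not> d \<le> s"
      then obtain t where "max l s < t" "t < d" using dense[of "max l s" d] assms(4) by auto
      then show False using lo[of t] hausdorff_measure_mono_exponent[OF s, of t] by auto
    qed
    then show "ereal d \<le> ereal s" by simp
  qed
qed

text \<open>Borel-Cantelli: a point in infinitely many sets is still covered after the first n sets
  of an enumeration are dropped. The remaining cost is the tail of a convergent series, whose small
  terms also make the diameters at most \<delta>.\<close>

lemma hausdorff_measure_limsup_cover:
  fixes E :: "'a::metric_space set" and G :: "'i \<Rightarrow> 'a set" and d :: "'i \<Rightarrow> real"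
  assumes "countable I" "0 < \<theta>"
    and G: "\<And>i. i \<in> I \<Longrightarrow> bounded (G i) \<and> diameter (G i) \<le> d i"
    and d: "\<And>i. i \<in> I \<Longrightarrow> 0 \<le> d i" "sums_bounded (\<lambda>i. d i powr \<theta>) I C"
    and inf: "\<And>x. x \<in> E \<Longrightarrow> infinite {i \<in> I. x \<in> G i}"
  shows "hausdorff_measure \<theta> E = 0"
proof (cases "E = {}")
  case True
  show ?thesis unfolding hausdorff_measure_eq_0_iff
  proof (intro allI impI)
    fix \<delta> :: real assume "0 < \<delta>"
    then have "hausdorff_premeasure \<theta> \<delta> E \<le> (\<Sum>i::nat. ennreal (diameter ({} :: 'a set) powr \<theta>))"
      unfolding hausdorff_premeasure_def True by (intro INF_lower) (auto simp: diameter_def)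
    also have "\<dots> = 0" by (simp add: diameter_def)
    finally show "hausdorff_premeasure \<theta> \<delta> E = 0" by simp
  qed
next
  case False
  then obtain x where "x \<in> E" by blast
  then have "infinite I" using inf[of x] finite_subset[of "{i \<in> I. x \<in> G i}" I] by auto
  then obtain f :: "nat \<Rightarrow> 'i" where f: "bij_betw f UNIV I"
    using assms(1) by (meson bij_betw_from_nat_into)
  have fI: "f i \<in> I" for i using f by (auto simp: bij_betw_def)
  define D where "D i = d (f i) powr \<theta>" for i
  have Dnn: "0 \<le> D i" for i by (simp add: D_def)
  have sum: "summable D"
  proof (rule summableI_nonneg_bounded)
    fix n
    have "sum D {..<n} = (\<Sum>i\<in>f ` {..<n}. d i powr \<theta>)"
      using f by (subst sum.reindex) (auto simp: D_def bij_betw_def inj_on_def)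
    also have "\<dots> \<le> C" using fI by (intro sums_boundedD[OF d(2)]) auto
    finally show "sum D {..<n} \<le> C" .
  qed (simp add: D_def)
  show ?thesis unfolding hausdorff_measure_eq_0_iff
  proof (intro allI impI)
    fix \<delta> :: real assume \<delta>: "0 < \<delta>"
    have "hausdorff_premeasure \<theta> \<delta> E \<le> ennreal e" if e: "0 < e" for e
    proof -
      have "\<forall>\<^sub>F n in sequentially. \<bar>\<Sum>i. D (i + n)\<bar> < e"
        using suminf_exist_split[OF e sum] by (auto simp: eventually_sequentially)
      moreover have "\<forall>\<^sub>F n in sequentially. \<forall>i. D (i + n) < \<delta> powr \<theta>"
      proof -
        have "\<forall>\<^sub>F n in sequentially. D n < \<delta> powr \<theta>"
          using summable_LIMSEQ_zero[OF sum] \<delta> by (intro order_tendstoD) auto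
        then show ?thesis unfolding eventually_sequentially by (meson trans_le_add2)
      qed
      ultimately obtain n where n: "\<bar>\<Sum>i. D (i + n)\<bar> < e" "\<And>i. D (i + n) < \<delta> powr \<theta>"
        using eventually_happens'[OF sequentially_bot eventually_conj] by blast
      define U where "U i = G (f (i + n))" for i
      have diam: "diameter (U i) \<le> d (f (i + n))" "bounded (U i)" "0 \<le> diameter (U i)" for i
        using G[OF fI] by (auto simp: U_def diameter_ge_0)
      have small: "diameter (U i) \<le> \<delta>" for i
      proof (rule ccontr)
        assume "\<not> diameter (U i) \<le> \<delta>"
        then have "\<delta> powr \<theta> \<le> d (f (i + n)) powr \<theta>"
          using diam[of i] \<delta> assms(2) by (intro powr_mono2) auto
        then show False using n(2)[of i] by (simp add: D_def)
      qed
      have "E \<subseteq> (\<Union>i. U i)"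
      proof
        fix x assume "x \<in> E"
        then have "infinite {i \<in> I. x \<in> G i}" by (rule inf)
        then have "\<not> {i \<in> I. x \<in> G i} \<subseteq> f ` {..<n}" using finite_subset[of "{i \<in> I. x \<in> G i}" "f ` {..<n}"] by auto
        then obtain i where i: "i \<in> I" "x \<in> G i" "i \<notin> f ` {..<n}" by blast
        then obtain k where k: "i = f k" using f by (auto simp: bij_betw_def)
        then have "n \<le> k" using i(3) by (meson imageI lessThan_iff not_le)
        then have "x \<in> U (k - n)" using i(2) k by (simp add: U_def)
        then show "x \<in> (\<Union>i. U i)" by blast
      qed
      then have "hausdorff_premeasure \<theta> \<delta> E \<le> (\<Sum>i. ennreal (diameter (U i) powr \<theta>))"
        unfolding hausdorff_premeasure_def using small diam by (intro INF_lower) auto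
      also have "\<dots> \<le> (\<Sum>i. ennreal (D (i + n)))"
        unfolding D_def using diam assms(2) by (intro suminf_le ennreal_leI powr_mono2) auto
      also have "\<dots> = ennreal (\<Sum>i. D (i + n))"
        using summable_ignore_initial_segment[OF sum] Dnn by (intro suminf_ennreal2)
      also have "\<dots> \<le> ennreal e" using n(1) by (intro ennreal_leI) auto
      finally show ?thesis .
    qed
    then have "hausdorff_premeasure \<theta> \<delta> E \<le> 0 + ennreal e" if "0 < e" for e using that by simp
    then have "hausdorff_premeasure \<theta> \<delta> E \<le> 0"
      by (rule ennreal_le_epsilon)
    then show "hausdorff_premeasure \<theta> \<delta> E = 0" by simp
  qed
qed

text \<open>Koenig's argument below needs an open cover; a thin neighbourhood changes the cost by as
  little as desired.\<close>

lemma enlarge_open: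
  fixes U :: "'a::metric_space set"
  assumes "bounded U" "0 < s" "0 < \<epsilon>"
  obtains V where "open V" "U \<subseteq> V" "bounded V" "diameter V powr s \<le> diameter U powr s + \<epsilon>"
proof -
  define r where "r = diameter U"
  have r: "0 \<le> r" using assms by (simp add: r_def diameter_ge_0)
  have "((\<lambda>h. (r + 2 * h) powr s) \<longlongrightarrow> (r + 2 * 0) powr s) (at_right 0)"
    using assms(2) r eventually_at_right_less[of "0::real"]
    by (intro tendsto_powr2 tendsto_intros) (auto elim!: eventually_mono)
  then have "\<forall>\<^sub>F h in at_right 0. (r + 2 * h) powr s < r powr s + \<epsilon>"
    using assms(3) by (intro order_tendstoD) auto
  then have "\<forall>\<^sub>F h in at_right 0. (r + 2 * h) powr s < r powr s + \<epsilon> \<and> 0 < h"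
    using eventually_at_right_less by (rule eventually_conj)
  then obtain h where h: "(r + 2 * h) powr s < r powr s + \<epsilon>" "0 < h"
    using eventually_happens'[OF trivial_limit_at_right_real] by blast
  define V where "V = (\<Union>x\<in>U. ball x h)"
  have dist: "dist x y \<le> r + 2 * h" if xy: "x \<in> V" "y \<in> V" for x y
  proof -
    obtain u v where uv: "u \<in> U" "v \<in> U" "dist u x < h" "dist v y < h"
      using xy by (auto simp: V_def)
    have "dist u v \<le> r" unfolding r_def using assms(1) uv by (intro diameter_bounded_bound) auto
    moreover have "dist x y \<le> dist x u + dist u v + dist v y"
      using dist_triangle[of x y u] dist_triangle[of u y v] by linarith
    ultimately show ?thesis using uv by (simp add: dist_commute)
  qed
  have bV: "bounded V" using dist by (auto simp: bounded_two_points)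
  have "diameter V \<le> r + 2 * h"
  proof (cases "V = {}")
    case True then show ?thesis using r h by (simp add: diameter_def)
  next
    case False
    then show ?thesis unfolding diameter_def using dist by (auto intro!: cSUP_least)
  qed
  then have "diameter V powr s \<le> (r + 2 * h) powr s"
    using assms(2) diameter_ge_0[OF bV] by (intro powr_mono2) auto
  then show ?thesis using h bV by (intro that[of V]) (auto simp: V_def r_def)
qed

section \<open>Upper bounds\<close>

lemma gauss_map_iterate: "x \<in> unit_irrationals \<Longrightarrow> (gauss_map ^^ n) x \<in> unit_irrationals"
  by (induction n) (simp_all add: gauss_map_irrational(1))

lemma unit_irrationals_bounds: "x \<in> unit_irrationals \<Longrightarrow> 0 < x \<and> x < 1"
  by (cases "x = 0") (auto simp: unit_irrationals_def)

lemma partial_quotient_pos: "x \<in> unit_irrationals \<Longrightarrow> 1 \<le> partial_quotient x n"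
  using gauss_map_irrational(2)[OF gauss_map_iterate] by (simp add: partial_quotient_def)

lemma gauss_map_iterate_eq:
  assumes "x \<in> unit_irrationals"
  shows "(gauss_map ^^ n) x = 1 / (real (partial_quotient x (Suc n)) + (gauss_map ^^ Suc n) x)"
  using gauss_map_irrational(3)[OF gauss_map_iterate[OF assms, of n]] by (simp add: partial_quotient_def)

lemma cf_tail_partial_quotients:
  assumes "x \<in> unit_irrationals"
  shows "cf_tail (map (partial_quotient x) [1..<Suc n]) ((gauss_map ^^ n) x) = x"
proof (induction n)
  case (Suc n)
  have "cf_tail [partial_quotient x (Suc n)] ((gauss_map ^^ Suc n) x) = (gauss_map ^^ n) x"
    using gauss_map_iterate_eq[OF assms, of n] by simp
  moreover have "map (partial_quotient x) [1..<Suc (Suc n)]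
      = map (partial_quotient x) [1..<Suc n] @ [partial_quotient x (Suc n)]" by simp
  ultimately show ?case using Suc by (simp only: cf_tail_append)
qed simp

lemma gauss_map_iterate_le:
  assumes "x \<in> unit_irrationals"
  shows "(gauss_map ^^ n) x \<le> 1 / real (partial_quotient x (Suc n))"
proof -
  have "0 < (gauss_map ^^ Suc n) x" using unit_irrationals_bounds[OF gauss_map_iterate[OF assms]] by blast
  then have "1 / (real (partial_quotient x (Suc n)) + (gauss_map ^^ Suc n) x)
      \<le> 1 / real (partial_quotient x (Suc n))"
    using partial_quotient_pos[OF assms, of "Suc n"] by (intro divide_left_mono mult_pos_pos) linarith+
  then show ?thesis using gauss_map_iterate_eq[OF assms, of n] by (simp only:)
qed

abbreviation (input) log_rate :: "real \<Rightarrow> nat \<Rightarrow> ereal" where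
  "log_rate x \<equiv> \<lambda>n. ereal (ln (real (max_quotient n x)) / real n)"

lemma partial_quotient_le_max: "1 \<le> m \<Longrightarrow> m \<le> n \<Longrightarrow> partial_quotient x m \<le> max_quotient n x"
  by (auto simp: max_quotient_def)

lemma max_quotient_attained:
  assumes "1 \<le> n"
  obtains m where "1 \<le> m" "m \<le> n" "max_quotient n x = partial_quotient x m"
proof -
  have "max_quotient n x \<in> partial_quotient x ` {1..n}"
    unfolding max_quotient_def using assms by (intro Max_in) auto
  then show ?thesis using that by auto
qed

lemma max_quotient_pos: "x \<in> unit_irrationals \<Longrightarrow> 1 \<le> n \<Longrightarrow> 1 \<le> max_quotient n x"
  using max_quotient_attained[of n x] partial_quotient_pos by metis

lemma ln_max_quotient_iff:
  assumes "x \<in> unit_irrationals" "1 \<le> n"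
  shows "t < ln (real (max_quotient n x)) / real n \<longleftrightarrow> exp (t * real n) < real (max_quotient n x)"
proof -
  have "t < ln (real (max_quotient n x)) / real n \<longleftrightarrow> t * real n < ln (real (max_quotient n x))"
    using assms by (simp add: pos_less_divide_eq)
  also have "\<dots> \<longleftrightarrow> exp (t * real n) < real (max_quotient n x)"
    using max_quotient_pos[OF assms] by (subst exp_less_cancel_iff[symmetric]) simp
  finally show ?thesis .
qed

text \<open>The bound \<open>h\<close> on the tail encodes the size of the next digit: a digit of at
  least 1 / h forces the tail into [0, h].\<close>

lemma cylinder_cover:
  assumes "pos_word as" "0 \<le> h" "h \<le> 1"
  shows "bounded (cf_tail as ` {0..h})" "diameter (cf_tail as ` {0..h}) \<le> h / (cf_den as 0)\<^sup>2"
proof -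
  have *: "\<bar>cf_tail as s - cf_tail as t\<bar> \<le> h / (cf_den as 0)\<^sup>2" if "s \<in> {0..h}" "t \<in> {0..h}" for s t
  proof (rule order_trans[OF cf_tail_dist_le[OF assms(1)] divide_right_mono])
    show "\<bar>s - t\<bar> \<le> h" using that by (simp add: abs_le_iff)
  qed (use that in auto)
  then show "bounded (cf_tail as ` {0..h})" unfolding bounded_two_points
    by (auto simp: dist_real_def intro!: exI[of _ "h / (cf_den as 0)\<^sup>2"])
  show "diameter (cf_tail as ` {0..h}) \<le> h / (cf_den as 0)\<^sup>2"
    using * assms by (intro diameter_le) auto
qed

lemma mem_cylinder:
  assumes x: "x \<in> unit_irrationals" and "1 \<le> m" "exp u \<le> real (partial_quotient x m)"
  shows "x \<in> cf_tail (map (partial_quotient x) [1..<m]) ` {0..exp (- u)}"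
proof -
  obtain n where n: "m = Suc n" using assms(2) by (cases m) auto
  have "(gauss_map ^^ n) x \<le> 1 / real (partial_quotient x m)" unfolding n by (rule gauss_map_iterate_le[OF x])
  also have "\<dots> \<le> 1 / exp u" using assms(3) by (intro frac_le) auto
  finally have "(gauss_map ^^ n) x \<le> exp (- u)" by (simp add: exp_minus inverse_eq_divide)
  moreover have "0 < (gauss_map ^^ n) x" using unit_irrationals_bounds[OF gauss_map_iterate[OF x]] by blast
  ultimately show ?thesis unfolding n
    by (intro image_eqI[where x = "(gauss_map ^^ n) x"] cf_tail_partial_quotients[OF x, symmetric]) simp
qed

lemma diam_powr: "(exp u / (cf_den as 0)\<^sup>2) powr \<theta> = exp (\<theta> * u) * wt \<theta> as" if "pos_word as"
proof -
  have "1 \<le> cf_den as 0" using that by (rule cf_den_bounds)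
  then have "((cf_den as 0)\<^sup>2) powr \<theta> = cf_den as 0 powr (2 * \<theta>)"
    by (simp add: powr_powr flip: powr_numeral)
  then show ?thesis by (simp add: powr_divide wt_def powr_minus field_simps exp_powr_real)
qed

lemma geometric_sums_bounded:
  assumes "0 \<le> r" "r < (1::real)" "0 \<le> C"
  shows "sums_bounded (\<lambda>n. C * r ^ n) UNIV (C / (1 - r))"
proof (rule sums_boundedI)
  fix F :: "nat set" assume "finite F"
  then have "(\<Sum>n\<in>F. C * r ^ n) \<le> (\<Sum>n. C * r ^ n)"
    using assms by (intro sum_le_suminf summable_mult summable_geometric) auto
  also have "\<dots> = C / (1 - r)" using assms by (simp add: suminf_mult suminf_geometric summable_geometric)
  finally show "(\<Sum>n\<in>F. C * r ^ n) \<le> C / (1 - r)" .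
qed

section \<open>Covering the limsup set\<close>

text \<open>The maximum at time n is attained at some m \<le> n, where exp (t m) \<le> exp (t n). If
  only finitely many such m existed, K would bound those maxima, while exp (t n) is
  unbounded.\<close>

lemma large_partial_quotients_infinite:
  assumes "x \<in> unit_irrationals" "0 < t" "\<exists>\<^sub>F n in sequentially. exp (t * real n) < real (max_quotient n x)"
  shows "infinite {m. 1 \<le> m \<and> exp (t * real m) < real (partial_quotient x m)}"
proof
  define S where "S = {m. 1 \<le> m \<and> exp (t * real m) < real (partial_quotient x m)}"
  assume "finite {m. 1 \<le> m \<and> exp (t * real m) < real (partial_quotient x m)}"
  then have fin: "finite S" by (simp add: S_def)
  define K where "K = (\<Sum>m\<in>S. real (partial_quotient x m))"
  have "filterlim (\<lambda>n. exp (t * real n)) at_top sequentially"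
    using assms(2) by (intro filterlim_compose[OF exp_at_top]
      filterlim_tendsto_pos_mult_at_top[OF tendsto_const _ filterlim_real_sequentially])
  then have "\<forall>\<^sub>F n in sequentially. K < exp (t * real n)" by (simp add: filterlim_at_top_dense)
  then have "\<forall>\<^sub>F n in sequentially. K < exp (t * real n) \<and> 1 \<le> n"
    using eventually_ge_at_top by (rule eventually_conj)
  from frequently_ex[OF frequently_eventually_frequently[OF assms(3) this]]
  obtain n where n: "exp (t * real n) < real (max_quotient n x)" "K < exp (t * real n)" "1 \<le> n"
    by auto
  obtain m where m: "1 \<le> m" "m \<le> n" "max_quotient n x = partial_quotient x m"
    using max_quotient_attained[OF n(3)] by blast
  have "exp (t * real m) \<le> exp (t * real n)" using m assms(2) by simp
  also have "\<dots> < real (partial_quotient x m)" using n(1) m(3) by simp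
  finally have "m \<in> S" using m(1) by (simp add: S_def)
  then have "real (partial_quotient x m) \<le> K" unfolding K_def
    using fin by (intro member_le_sum) auto
  then show False using n m by simp
qed

theorem limsup_set_null:
  assumes \<theta>: "1 / 2 < \<theta>" and P: "pressure \<theta> < \<tau> * \<theta>" and \<tau>: "0 < \<tau>"
  shows "hausdorff_measure \<theta> {x \<in> unit_irrationals.
    limsup (log_rate x) = ereal \<tau>} = 0"
proof -
  have "max 0 (pressure \<theta> / \<theta>) < \<tau>" using P \<tau> \<theta> by (simp add: pos_divide_less_eq)
  \<comment> \<open>t < \<tau> gives infinitely many large digits, while t > P(\<theta>) / \<theta>
    makes the ratio \<open>r\<close> of the cost series smaller than 1.\<close>
  then obtain t where t: "max 0 (pressure \<theta> / \<theta>) < t" "t < \<tau>" using dense by blast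
  then have t0: "0 < t" and Pt: "pressure \<theta> < t * \<theta>" using \<theta> by (auto simp: pos_divide_less_eq)
  define I where "I = {as. pos_word as}"
  \<comment> \<open>After a word of length n the digit required to be large stands at position n +
    1.\<close>
  define h where "h n = exp (- t * real (Suc n))" for n :: nat
  have h: "0 \<le> h n" "h n \<le> 1" for n using t0 by (auto simp: h_def)
  define d where "d as = h (length as) / (cf_den as 0)\<^sup>2" for as
  define G where "G as = cf_tail as ` {0..h (length as)}" for as
  define r where "r = exp (pressure \<theta> - t * \<theta>)"
  have IU: "I = (\<Union>n. words n)" by (auto simp: I_def words_def)
  define K where "K = 4 powr \<theta> * exp (- t * \<theta>)"
  have dp: "d as powr \<theta> = exp (- t * \<theta> * real (Suc (length as))) * wt \<theta> as" if "pos_word as" for as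
    using that by (simp add: d_def h_def diam_powr algebra_simps)
  have level: "sums_bounded (\<lambda>as. d as powr \<theta>) (words n) (K * r ^ n)" for n
  proof (rule sums_bounded_mono[OF sums_bounded_cmult[OF wt_sums_bounded[OF \<theta>, of n], of "exp (- t * \<theta> * real (Suc n))"]])
    have "exp (- t * \<theta> * real (Suc n)) * part_sum \<theta> n
        \<le> exp (- t * \<theta> * real (Suc n)) * (4 powr \<theta> * exp (real n * pressure \<theta>))"
      using pressure_props(3)[OF \<theta>] by (intro mult_left_mono) auto
    also have "\<dots> = K * r ^ n"
      by (simp add: K_def r_def exp_of_nat_mult[symmetric] exp_add[symmetric] algebra_simps)
    finally show "exp (- t * \<theta> * real (Suc n)) * part_sum \<theta> n \<le> K * r ^ n" .
  qed (auto simp: dp words_def)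
  have r: "0 \<le> r" "r < 1" using Pt by (auto simp: r_def)
  have "sums_bounded (\<lambda>as. d as powr \<theta>) I (K / (1 - r))"
    unfolding IU by (rule sums_bounded_SUN[OF level geometric_sums_bounded]) (use r in \<open>auto simp: K_def\<close>)
  then show ?thesis
  proof (rule hausdorff_measure_limsup_cover[where I = I and G = G, rotated 4])
    show "bounded (G as) \<and> diameter (G as) \<le> d as" if "as \<in> I" for as
      using cylinder_cover[of as "h (length as)"] h that by (simp add: G_def d_def I_def)
    show "0 \<le> d as" for as using h by (simp add: d_def)
    fix x assume "x \<in> {x \<in> unit_irrationals.
      limsup (log_rate x) = ereal \<tau>}"
    then have x: "x \<in> unit_irrationals"
      and lim: "limsup (log_rate x) = ereal \<tau>" by auto
    have "\<exists>\<^sub>F n in sequentially. t < ln (real (max_quotient n x)) / real n"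
    proof (rule ccontr)
      assume "\<not> ?thesis"
      then have "\<forall>\<^sub>F n in sequentially. ereal (ln (real (max_quotient n x)) / real n) \<le> ereal t"
        by (simp add: not_frequently not_less)
      then have "limsup (log_rate x) \<le> ereal t"
        by (rule Limsup_bounded)
      then show False using lim t by simp
    qed
    then have "\<exists>\<^sub>F n in sequentially. exp (t * real n) < real (max_quotient n x)"
    proof (rule frequently_elim1[OF frequently_eventually_frequently[OF _ eventually_ge_at_top[of 1]]])
      fix n assume "t < ln (real (max_quotient n x)) / real n \<and> 1 \<le> n"
      then show "exp (t * real n) < real (max_quotient n x)" using ln_max_quotient_iff[OF x] by blast
    qed
    note inf = large_partial_quotients_infinite[OF x t0 this]
    define S where "S = {m. 1 \<le> m \<and> exp (t * real m) < real (partial_quotient x m)}"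
    define w where "w m = map (partial_quotient x) [1..<m]" for m
    have "inj_on w S"
    proof (rule inj_onI)
      fix m m' assume "m \<in> S" "m' \<in> S" "w m = w m'"
      then have "length (w m) = length (w m')" "1 \<le> m" "1 \<le> m'" by (auto simp: S_def)
      then show "m = m'" by (simp add: w_def)
    qed
    then have "infinite (w ` S)" using inf by (simp add: S_def finite_image_iff)
    moreover have "w ` S \<subseteq> {as \<in> I. x \<in> G as}"
    proof clarify
      fix m assume m: "m \<in> S"
      then have "x \<in> cf_tail (w m) ` {0..exp (- (t * real m))}"
        unfolding w_def by (intro mem_cylinder x) (auto simp: S_def)
      moreover have "Suc (length (w m)) = m" using m by (simp add: w_def S_def)
      ultimately have "x \<in> G (w m)" by (simp add: G_def h_def del: of_nat_Suc)
      then show "w m \<in> I \<and> x \<in> G (w m)"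
        using partial_quotient_pos[OF x] by (auto simp: I_def w_def)
    qed
    ultimately show "infinite {as \<in> I. x \<in> G as}" using finite_subset by blast
  qed (use \<theta> in auto)
qed

section \<open>Covering the liminf set along record positions\<close>

text \<open>Otherwise the ratios \<open>S\<^sub>k\<^sub>+\<^sub>1 / S\<^sub>k\<close> of the partial sums of \<open>f\<close> would decrease by a fixed amount
  in each step, because \<open>\<theta> r\<^sup>2 - (c + 1 - \<theta>) r + c\<close> has no real root.\<close>

lemma frequently_linear_recursion:
  fixes f :: "nat \<Rightarrow> nat" and \<theta> c :: real
  assumes f: "strict_mono f" and \<theta>: "1 / 2 < \<theta>" and c: "\<theta> \<le> c" "c < (sqrt \<theta> + sqrt (2 * \<theta> - 1))\<^sup>2"
  shows "\<exists>\<^sub>F k in sequentially. c * real (f k)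
    \<le> (2 * \<theta> - 1) * (\<Sum>i=1..k. real (f i)) + \<theta> * real (f (Suc k))"
proof (rule ccontr)
  \<comment> \<open>The sum omits \<open>f 0\<close>: for i \<ge> 1, \<open>f i\<close> sets the
    threshold for the digit at \<open>f (i - 1)\<close>, and no earlier record is tied to
    \<open>f 0\<close>.\<close>
  define S where "S k = (\<Sum>i=1..k. real (f i))" for k
  assume "\<not> ?thesis"
  then obtain K0 where K0: "\<And>k. K0 \<le> k \<Longrightarrow> (2 * \<theta> - 1) * S k + \<theta> * real (f (Suc k)) < c * real (f k)"
    unfolding not_frequently eventually_sequentially not_le S_def by blast
  define K where "K = K0 + 2"
  have step: "S (Suc k) = S k + real (f (Suc k))" for k by (simp add: S_def)
  have fpos: "0 < f k" if "1 \<le> k" for k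
    using strict_monoD[OF f, of 0 k] that by linarith
  have Spos: "0 < S k" if "1 \<le> k" for k
    unfolding S_def using that fpos by (intro sum_pos) auto
  define r where "r k = S (Suc k) / S k" for k
  have rpos: "0 < r k" if "1 \<le> k" for k using Spos[of k] Spos[of "Suc k"] that by (simp add: r_def)
  \<comment> \<open>The guaranteed drop of \<theta> r per step, obtained from \<theta> r + c / r
    \<ge> 2 sqrt (\<theta> c); it is positive exactly by the bound on c.\<close>
  define \<delta> where "\<delta> = (2 * \<theta> - 1) - (sqrt c - sqrt \<theta>)\<^sup>2"
  have "sqrt c < sqrt \<theta> + sqrt (2 * \<theta> - 1)" using c \<theta> by (intro real_less_lsqrt) auto
  moreover have "sqrt \<theta> \<le> sqrt c" using c by simp
  ultimately have "(sqrt c - sqrt \<theta>)\<^sup>2 < (sqrt (2 * \<theta> - 1))\<^sup>2" by (intro power_strict_mono) auto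
  then have \<delta>: "0 < \<delta>" using \<theta> by (simp add: \<delta>_def)
  have drop: "\<theta> * r (Suc k) \<le> \<theta> * r k - \<delta>" if "K0 + 1 \<le> k" for k
  proof -
    have k: "1 \<le> k" using that by simp
    have pos: "0 < S k" "0 < S (Suc k)" using Spos k by auto
    have "(2 * \<theta> - 1) * S (Suc k) + \<theta> * (S (Suc (Suc k)) - S (Suc k)) < c * (S (Suc k) - S k)"
      using K0[of "Suc k"] that by (simp add: step)
    then have "((2 * \<theta> - 1) * S (Suc k) + \<theta> * (S (Suc (Suc k)) - S (Suc k))) / S (Suc k)
        < c * (S (Suc k) - S k) / S (Suc k)"
      using pos by (intro divide_strict_right_mono) auto
    moreover have "((2 * \<theta> - 1) * S (Suc k) + \<theta> * (S (Suc (Suc k)) - S (Suc k))) / S (Suc k)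
        = (2 * \<theta> - 1) + \<theta> * (r (Suc k) - 1)" using pos by (simp add: r_def field_simps)
    moreover have "c * (S (Suc k) - S k) / S (Suc k) = c - c / r k" using pos by (simp add: r_def field_simps)
    ultimately have 1: "(2 * \<theta> - 1) + \<theta> * (r (Suc k) - 1) < c - c / r k" by simp
    have "0 \<le> (sqrt (\<theta> * r k) - sqrt (c / r k))\<^sup>2" by simp
    also have "\<dots> = \<theta> * r k + c / r k - 2 * (sqrt (\<theta> * r k) * sqrt (c / r k))"
      using \<theta> c rpos[OF k] by (simp add: power2_diff)
    also have "sqrt (\<theta> * r k) * sqrt (c / r k) = sqrt \<theta> * sqrt c"
      using rpos[OF k] by (simp flip: real_sqrt_mult)
    finally have 2: "2 * (sqrt \<theta> * sqrt c) \<le> \<theta> * r k + c / r k" by simp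
    have "\<delta> = (2 * \<theta> - 1) - (c + \<theta> - 2 * (sqrt \<theta> * sqrt c))"
      using \<theta> c by (simp add: \<delta>_def power2_diff)
    then show ?thesis using 1 2 by (simp add: algebra_simps)
  qed
  have "\<theta> * r (K + j) \<le> \<theta> * r K - real j * \<delta>" for j
  proof (induction j)
    case (Suc j)
    then show ?case using drop[of "K + j"] by (simp add: K_def algebra_simps)
  qed simp
  moreover obtain j where "\<theta> * r K < real j * \<delta>" using reals_Archimedean3[OF \<delta>] by blast
  ultimately have "\<theta> * r (K + j) < 0" by (smt (verit))
  moreover have "0 < \<theta> * r (K + j)" using \<theta> rpos[of "K + j"] by (simp add: K_def)
  ultimately show False by simp
qed

text \<open>The record positions of the partial quotients: the value reached at one record
  is kept as the maximum until just before the next one.\<close>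

lemma record_sequence:
  assumes x: "x \<in> unit_irrationals" and t: "0 < t"
    and ev: "\<forall>\<^sub>F n in sequentially. exp (t * real n) < real (max_quotient n x)"
  obtains f :: "nat \<Rightarrow> nat" where "strict_mono f" "1 \<le> f 0"
    "\<And>k. exp (t * (real (f (Suc k)) - 1)) \<le> real (partial_quotient x (f k))"
proof -
  obtain N' where N': "\<And>n. N' \<le> n \<Longrightarrow> exp (t * real n) < real (max_quotient n x)"
    using ev by (auto simp: eventually_sequentially)
  define N where "N = max 1 N'"
  \<comment> \<open>Besides being a record, m must hold the maximum at some time n \<ge> N, so that
    the assumed growth applies at every later time.\<close>
  define inv where "inv m \<longleftrightarrow> (\<exists>n\<ge>N. 1 \<le> m \<and> m \<le> n \<and> max_quotient n x = partial_quotient x m)" for m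
  have "\<exists>f. \<forall>k. inv (f k) \<and> (f k < f (Suc k) \<and> exp (t * (real (f (Suc k)) - 1)) \<le> real (partial_quotient x (f k)))"
  proof (rule dependent_nat_choice)
    obtain m where "1 \<le> m" "m \<le> N" "max_quotient N x = partial_quotient x m"
      by (rule max_quotient_attained[of N]) (simp add: N_def)
    then show "\<exists>m. inv m" by (auto simp: inv_def)
  next
    fix m :: nat and k :: nat assume "inv m"
    then obtain n where n: "N \<le> n" "1 \<le> m" "m \<le> n" "max_quotient n x = partial_quotient x m"
      by (auto simp: inv_def)
    \<comment> \<open>The next record is the first l > n whose digit exceeds that of m. Digits up to
      n are bounded by the maximum at n, those between n and l by minimality of l, so the maximum at
      l - 1 is still the digit at m.\<close>
    define A where "A l \<longleftrightarrow> n < l \<and> partial_quotient x m < partial_quotient x l" for l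
    have "\<exists>l. A l"
    proof -
      have "\<exists>\<^sub>F n in sequentially. exp (t * real n) < real (max_quotient n x)"
        using ev by (simp add: eventually_frequently)
      from large_partial_quotients_infinite[OF x t this]
      have inf: "infinite {l. 1 \<le> l \<and> exp (t * real l) < real (partial_quotient x l)}" .
      obtain M :: nat where M: "real (partial_quotient x m) < real M * t"
        using reals_Archimedean3[OF t] by blast
      obtain l where l: "max M n < l" "exp (t * real l) < real (partial_quotient x l)"
        using inf[unfolded infinite_nat_iff_unbounded, rule_format, of "max M n"] by auto
      have "real M * t \<le> t * real l" using l t by simp
      then have "real (partial_quotient x m) < exp (t * real l)"
        using M exp_ge_add_one_self[of "t * real l"] by linarith
      then show ?thesis using l by (intro exI[of _ l]) (simp add: A_def)
    qed
    then have A: "A (LEAST l. A l)" by (rule LeastI_ex)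
    define l where "l = (LEAST l. A l)"
    have l: "n < l" "partial_quotient x m < partial_quotient x l" using A by (auto simp: A_def l_def)
    have l1: "1 \<le> l" "1 \<le> l - 1" using l(1) n(1) by (auto simp: N_def)
    have le: "partial_quotient x i \<le> partial_quotient x m" if "1 \<le> i" "i < l" for i
    proof (cases "i \<le> n")
      case True then show ?thesis using partial_quotient_le_max[OF that(1) True, of x] n by simp
    next
      case False
      have "\<not> A i" using not_less_Least[of i A] that(2) by (simp add: l_def)
      then show ?thesis using False by (simp add: A_def)
    qed
    obtain i where i: "1 \<le> i" "i \<le> l - 1" "max_quotient (l - 1) x = partial_quotient x i"
      using max_quotient_attained[OF l1(2), of x] by blast
    have "exp (t * real (l - 1)) < real (max_quotient (l - 1) x)" using N'[of "l - 1"] l n by (simp add: N_def)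
    also have "max_quotient (l - 1) x \<le> partial_quotient x m" using le[of i] i l by auto
    finally have "exp (t * (real l - 1)) \<le> real (partial_quotient x m)" using l by (simp add: of_nat_diff)
    moreover obtain i where i: "1 \<le> i" "i \<le> l" "max_quotient l x = partial_quotient x i"
      using max_quotient_attained[OF l1(1), of x] by blast
    have "partial_quotient x i \<le> partial_quotient x l"
      using le[of i] i l(2) by (cases "i = l") auto
    then have "max_quotient l x = partial_quotient x l"
      using partial_quotient_le_max[of l l x] i l by simp
    then have "inv l" using l n by (auto simp: inv_def intro!: exI[of _ l])
    moreover have "m < l" using n l by simp
    ultimately show "\<exists>l. inv l \<and> (m < l \<and> exp (t * (real l - 1)) \<le> real (partial_quotient x m))" by blast
  qed
  then obtain f where f: "\<And>k. inv (f k)" "\<And>k. f k < f (Suc k)"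
    "\<And>k. exp (t * (real (f (Suc k)) - 1)) \<le> real (partial_quotient x (f k))" by blast
  show ?thesis
    by (rule that[of f]) (use f in \<open>auto simp: strict_mono_Suc_iff inv_def\<close>)
qed

text \<open>Words starting after position \<open>m\<close> and ending just before the last position of the given
  list, whose digit at any earlier position \<open>n\<close> of the list exceeds \<open>b n'\<close>, where \<open>n'\<close> is the
  successor of \<open>n\<close> in the list.\<close>

fun record_words :: "(nat \<Rightarrow> real) \<Rightarrow> nat \<Rightarrow> nat list \<Rightarrow> nat list set" where
  "record_words b m [] = {}"
| "record_words b m [n] = words (n - 1 - m)"
| "record_words b m (n # n' # ns) = {as @ bs | as bs. as \<in> words (n - 1 - m) \<and>
     bs \<in> {[a] @ cs | a cs. a \<in> {a. 1 \<le> a \<and> b n' \<le> real a} \<and> cs \<in> record_words b n (n' # ns)}}"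

lemma record_words_pos: "as \<in> record_words b m ns \<Longrightarrow> pos_word as"
proof (induction b m ns arbitrary: as rule: record_words.induct)
  case (3 b m n n' ns)
  obtain as' a cs where *: "as = as' @ [a] @ cs" "as' \<in> words (n - 1 - m)" "1 \<le> a"
    "cs \<in> record_words b n (n' # ns)" using 3(2) by auto
  show ?case using 3(1)[OF *(4)] * by (auto simp: words_def)
qed (auto simp: words_def)

text \<open>Each gap between records costs at most exp (p times its length), and these factors
  telescope to the distance from m to the last position; each record costs a tail sum from
  \<open>powr_sum_tail\<close>. Nonnegativity of p allows the position of the record itself to be
  counted as part of the gap.\<close>

lemma record_words_bound:
  assumes \<theta>: "1 / 2 < \<theta>" and p: "0 \<le> p" "pressure \<theta> \<le> p" and b: "\<And>n. 0 < b n"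
    and "sorted_wrt (<) (m # n # ns)"
  shows "sums_bounded (wt \<theta>) (record_words b m (n # ns)) (4 powr \<theta> * exp (p * (real (last (n # ns)) - real m))
    * prod_list (map (\<lambda>i. 4 powr \<theta> * (1 + 1 / (2 * \<theta> - 1)) * b i powr (1 - 2 * \<theta>)) ns))"
proof -
  have gap: "sums_bounded (wt \<theta>) (words (n - 1 - m)) (4 powr \<theta> * exp (p * (real n - real m)))"
    if "m < n" for m n :: nat
  proof (rule sums_bounded_mono[OF wt_sums_bounded[OF \<theta>] subset_refl])
    have "real (n - 1 - m) * pressure \<theta> \<le> real (n - 1 - m) * p" using p by (intro mult_left_mono) auto
    also have "\<dots> \<le> (real n - real m) * p" using p that by (intro mult_right_mono) auto
    finally have "4 powr \<theta> * exp (real (n - 1 - m) * pressure \<theta>) \<le> 4 powr \<theta> * exp (p * (real n - real m))"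
      by (simp add: mult.commute)
    then show "part_sum \<theta> (n - 1 - m) \<le> 4 powr \<theta> * exp (p * (real n - real m))"
      using pressure_props(3)[OF \<theta>, of "n - 1 - m"] by linarith
  qed auto
  define C where "C = 1 + 1 / (2 * \<theta> - 1)"
  show ?thesis
    using assms(5)
  proof (induction ns arbitrary: m n)
    case (Cons n' ns)
    have mn: "m < n" "sorted_wrt (<) (n # n' # ns)" using Cons.prems by auto
    let ?R = "4 powr \<theta> * exp (p * (real (last (n' # ns)) - real n))
      * prod_list (map (\<lambda>i. 4 powr \<theta> * C * b i powr (1 - 2 * \<theta>)) ns)"
    have inner: "sums_bounded (wt \<theta>)
      {[a] @ cs | a cs. a \<in> {a. 1 \<le> a \<and> b n' \<le> real a} \<and> cs \<in> record_words b n (n' # ns)}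
      (C * b n' powr (1 - 2 * \<theta>) * ?R)"
    proof (rule sums_bounded_prod)
      show "sums_bounded (\<lambda>a. real a powr (- 2 * \<theta>)) {a. 1 \<le> a \<and> b n' \<le> real a} (C * b n' powr (1 - 2 * \<theta>))"
        unfolding C_def using \<theta> b by (rule powr_sum_tail)
      show "sums_bounded (wt \<theta>) (record_words b n (n' # ns)) ?R"
        unfolding C_def using mn by (intro Cons.IH) auto
      show "wt \<theta> ([a] @ cs) \<le> real a powr (- 2 * \<theta>) * wt \<theta> cs"
        if "a \<in> {a. 1 \<le> a \<and> b n' \<le> real a}" "cs \<in> record_words b n (n' # ns)" for a cs
        using wt_append_le[of "[a]" cs \<theta>] record_words_pos[OF that(2)] that(1) \<theta> unfolding wt_single by auto
    qed auto
    have "sums_bounded (wt \<theta>) (record_words b m (n # n' # ns))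
      ((4 powr \<theta> * exp (p * (real n - real m))) * (C * b n' powr (1 - 2 * \<theta>) * ?R))"
      unfolding record_words.simps
    proof (rule sums_bounded_prod[OF gap[OF mn(1)] inner])
      show "wt \<theta> (as @ bs) \<le> wt \<theta> as * wt \<theta> bs"
        if "as \<in> words (n - 1 - m)" "bs \<in> {[a] @ cs | a cs. a \<in> {a. 1 \<le> a \<and> b n' \<le> real a}
          \<and> cs \<in> record_words b n (n' # ns)}" for as bs
        using that \<theta> by (intro wt_append_le) (auto simp: words_def dest!: record_words_pos)
    qed auto
    also have "(4 powr \<theta> * exp (p * (real n - real m))) * (C * b n' powr (1 - 2 * \<theta>) * ?R)
      = 4 powr \<theta> * exp (p * (real (last (n # n' # ns)) - real m))
        * prod_list (map (\<lambda>i. 4 powr \<theta> * C * b i powr (1 - 2 * \<theta>)) (n' # ns))"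
      by (simp add: algebra_simps exp_diff)
    finally show ?case unfolding C_def .
  next
    case Nil
    then show ?case using gap by simp
  qed
qed

lemma record_words_mem:
  assumes x: "x \<in> unit_irrationals" and f: "strict_mono f" "m < f j"
    and b: "\<And>i. b (f (Suc i)) \<le> real (partial_quotient x (f i))"
  shows "map (partial_quotient x) [Suc m..<f (j + k)] \<in> record_words b m (map f [j..<Suc (j + k)])"
  using f(2)
proof (induction k arbitrary: m j)
  case 0
  then show ?case using partial_quotient_pos[OF x] by (auto simp: words_def)
next
  case (Suc k)
  have less: "f j < f (Suc j)" "f (Suc j) \<le> f (Suc j + k)"
    using f(1) by (auto simp: strict_mono_def strict_mono_less_eq)
  have list: "map f [j..<Suc (j + Suc k)] = f j # f (Suc j) # map f [Suc (Suc j)..<Suc (Suc j + k)]"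
    by (simp add: upt_conv_Cons del: upt_Suc)
  have list': "map f [Suc j..<Suc (Suc j + k)] = f (Suc j) # map f [Suc (Suc j)..<Suc (Suc j + k)]"
    by (simp add: upt_conv_Cons del: upt_Suc)
  have "[Suc m..<f (Suc j + k)] = [Suc m..<f j] @ [f j..<f (Suc j + k)]"
    using upt_add_eq_append[of "Suc m" "f j" "f (Suc j + k) - f j"] Suc.prems less by simp
  also have "[f j..<f (Suc j + k)] = f j # [Suc (f j)..<f (Suc j + k)]"
    using less by (simp add: upt_conv_Cons)
  finally have 1: "map (partial_quotient x) [Suc m..<f (j + Suc k)] = map (partial_quotient x) [Suc m..<f j] @
    ([partial_quotient x (f j)] @ map (partial_quotient x) [Suc (f j)..<f (Suc j + k)])" by simp
  have 2: "map (partial_quotient x) [Suc m..<f j] \<in> words (f j - 1 - m)"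
    using partial_quotient_pos[OF x] by (auto simp: words_def)
  have 3: "map (partial_quotient x) [Suc (f j)..<f (Suc j + k)]
      \<in> record_words b (f j) (f (Suc j) # map f [Suc (Suc j)..<Suc (Suc j + k)])"
    using Suc.IH[of "f j" "Suc j"] less unfolding list' by simp
  have 4: "partial_quotient x (f j) \<in> {a. 1 \<le> a \<and> b (f (Suc j)) \<le> real a}"
    using b[of j] partial_quotient_pos[OF x] by auto
  show ?case unfolding 1 list record_words.simps using 2 3 4 by blast
qed

text \<open>Strictly increasing lists are finite sets, so the sum over those with entries below M is
  bounded by the product of 1 + u n over n < M, and this by exp S. Splitting off the largest
  possible entry gives the induction. This is what makes the sum over all record positions
  converge.\<close>

lemma sorted_lists_sum:
  fixes u :: "nat \<Rightarrow> real"
  assumes u: "\<And>n. 0 \<le> u n" and S: "sums_bounded u UNIV S"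
  shows "sums_bounded (\<lambda>ns. prod_list (map u ns)) {ns. sorted_wrt (<) ns} (exp S)"
proof (rule sums_boundedI)
  let ?v = "\<lambda>ns. prod_list (map u ns)"
  let ?L = "\<lambda>M. {ns :: nat list. sorted_wrt (<) ns \<and> (\<forall>n\<in>set ns. n < M)}"
  have nonneg: "0 \<le> ?v ns" for ns using u by (induction ns) auto
  have L: "?L (Suc M) \<subseteq> ?L M \<union> (\<lambda>ns. ns @ [M]) ` ?L M" for M
  proof
    fix ns assume ns: "ns \<in> ?L (Suc M)"
    show "ns \<in> ?L M \<union> (\<lambda>ns. ns @ [M]) ` ?L M"
    proof (cases ns rule: rev_cases)
      case (snoc ms k)
      show ?thesis
      proof (cases "k = M")
        case True
        then show ?thesis using ns snoc by (auto simp: sorted_wrt_append)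
      next
        case False
        then have "k < M" using ns snoc by auto
        then show ?thesis using ns snoc by (fastforce simp: sorted_wrt_append)
      qed
    qed simp
  qed
  have bound: "finite (?L M) \<and> sum ?v (?L M) \<le> (\<Prod>n<M. 1 + u n)" for M
  proof (induction M)
    case 0
    have "?L 0 = {[]}" by auto
    then show ?case by simp
  next
    case (Suc M)
    have fin: "finite (?L M \<union> (\<lambda>ns. ns @ [M]) ` ?L M)" using Suc by simp
    have "sum ?v (?L (Suc M)) \<le> sum ?v (?L M \<union> (\<lambda>ns. ns @ [M]) ` ?L M)"
      using fin L nonneg by (intro sum_mono2) auto
    also have "\<dots> \<le> sum ?v (?L M) + sum ?v ((\<lambda>ns. ns @ [M]) ` ?L M)"
      using Suc nonneg by (subst sum_Un) (auto intro!: sum_nonneg)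
    also have "sum ?v ((\<lambda>ns. ns @ [M]) ` ?L M) = sum ?v (?L M) * u M"
      by (subst sum.reindex) (auto simp: inj_on_def sum_distrib_right)
    also have "sum ?v (?L M) + sum ?v (?L M) * u M \<le> (\<Prod>n<M. 1 + u n) * (1 + u M)"
      using Suc u[of M] by (simp add: distrib_left mult_right_mono add_mono)
    finally have "sum ?v (?L (Suc M)) \<le> (\<Prod>n<M. 1 + u n) * (1 + u M)" .
    moreover have "finite (?L (Suc M))" using L fin by (rule finite_subset)
    ultimately show ?case by simp
  qed
  fix F :: "nat list set" assume F: "finite F" "F \<subseteq> {ns. sorted_wrt (<) ns}"
  have "finite (\<Union>ns\<in>F. set ns)" using F by auto
  then obtain M where M: "\<forall>n\<in>(\<Union>ns\<in>F. set ns). n < M" using finite_nat_set_iff_bounded by auto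
  have "sum ?v F \<le> sum ?v (?L M)" using F M bound nonneg by (intro sum_mono2) auto
  also have "\<dots> \<le> (\<Prod>n<M. 1 + u n)" using bound by blast
  also have "\<dots> \<le> (\<Prod>n<M. exp (u n))" using u by (intro prod_mono) (auto simp: add_nonneg_nonneg)
  also have "\<dots> = exp (\<Sum>n<M. u n)" by (simp add: exp_sum)
  also have "\<dots> \<le> exp S" using sums_boundedD[OF S, of "{..<M}"] by simp
  finally show "sum ?v F \<le> exp S" .
qed


theorem liminf_set_null:
  assumes \<theta>: "1 / 2 < \<theta>" and P: "pressure \<theta> < \<tau> * (sqrt \<theta> + sqrt (2 * \<theta> - 1))\<^sup>2" and \<tau>: "0 < \<tau>"
  shows "hausdorff_measure \<theta> {x \<in> unit_irrationals.
    liminf (log_rate x) = ereal \<tau>} = 0"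
proof -
  define c0 where "c0 = 2 * \<theta> - 1"
  have c0: "0 < c0" using \<theta> by (simp add: c0_def)
  \<comment> \<open>The pressure may be negative, but the gap estimate needs a nonnegative
    rate.\<close>
  define p where "p = max 0 (pressure \<theta>)"
  have p: "0 \<le> p" "pressure \<theta> \<le> p" by (auto simp: p_def)
  define c1 where "c1 = (sqrt \<theta> + sqrt c0)\<^sup>2"
  have c1: "\<theta> < c1"
  proof -
    have "0 < sqrt \<theta> * sqrt c0" using \<theta> c0 by simp
    moreover have "c1 = \<theta> + c0 + 2 * (sqrt \<theta> * sqrt c0)"
      using \<theta> c0 by (simp add: c1_def power2_sum)
    ultimately show ?thesis using c0 by linarith
  qed
  have "0 < \<tau> * c1" using \<tau> c1 \<theta> by (intro mult_pos_pos) auto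
  then have "p < \<tau> * c1" using P by (simp add: p_def c1_def c0_def)
  then have "max \<theta> (p / \<tau>) < c1" using c1 \<tau> by (simp add: pos_divide_less_eq mult.commute)
  \<comment> \<open>c < c1 and c \<ge> \<theta> are what \<open>frequently_linear_recursion\<close>
    asks for, and c > p / \<tau> lets the records outweigh the pressure.\<close>
  then obtain c where c: "max \<theta> (p / \<tau>) < c" "c < c1" using dense by blast
  then have c': "\<theta> \<le> c" "0 < c" "p < \<tau> * c" using \<theta> \<tau> by (auto simp: pos_divide_less_eq mult.commute)
  have "p / c < \<tau>" using c' by (simp add: pos_divide_less_eq)
  \<comment> \<open>The rate \<open>t2\<close> pays for the pressure. The slack between
    \<open>t2\<close> and a slightly larger t < \<tau> is kept to make the sums over record
    positions converge.\<close>
  then obtain t2 where t2: "p / c < t2" "t2 < \<tau>" using dense by blast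
  obtain t where t: "t2 < t" "t < \<tau>" using t2 dense by blast
  have "0 \<le> p / c" using p c' by simp
  then have pos: "0 < t2" "0 < t" using t2 t by auto
  have pc: "p \<le> t2 * c" using t2 c' by (simp add: pos_divide_less_eq)
  define e where "e = t - t2"
  have e: "0 < e" using t by (simp add: e_def)
  define b where "b n = exp (t * (real n - 1))" for n :: nat
  define D where "D = (4 powr \<theta> :: real)"
  define C where "C = 1 + 1 / (2 * \<theta> - 1)"
  have D: "0 < D" by (simp add: D_def)
  have C: "0 < C" using \<theta> by (simp add: C_def add_pos_pos)
  \<comment> \<open>The decay left for each position: half of e \<theta> L goes to the first
    position and half to L, while e c0 n goes to each further position n.\<close>
  define k where "k = min (e * \<theta> / 2) (e * c0)"
  have k: "0 < k" "k \<le> e * \<theta> / 2" "k \<le> e * c0" using e \<theta> c0 by (auto simp: k_def)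
  \<comment> \<open>K absorbs the constants of one record. K \<ge> 1 permits one more factor K for
    the first position, which carries no record term.\<close>
  define K where "K = max 1 (D * C * exp (t * c0))"
  have K: "1 \<le> K" "D * C * exp (t * c0) \<le> K" by (auto simp: K_def)
  define u where "u n = K * exp (- k * real n)" for n :: nat
  \<comment> \<open>\<open>ns\<close> lists the records so far and \<open>L\<close> is the next one.
    The last condition is the inequality that holds infinitely often; \<open>tl\<close> drops the
    first position as in the recursion lemma.\<close>
  define J where "J = {(ns, L). sorted_wrt (<) ns \<and> ns \<noteq> [] \<and> 1 \<le> hd ns \<and> last ns < L \<and>
    c * real (last ns) \<le> c0 * (\<Sum>n\<leftarrow>tl ns. real n) + \<theta> * real L}"
  \<comment> \<open>The pair is kept in the index because one word can occur for several record
    lists; each occurrence is paid for separately.\<close>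
  define I where "I = (\<Union>j\<in>J. {j} \<times> record_words b 0 (fst j))"
  define h where "h L = exp (- t * (real L - 1))" for L :: nat
  define d where "d i = h (snd (fst i)) / (cf_den (snd i) 0)\<^sup>2" for i :: "(nat list \<times> nat) \<times> nat list"
  define G where "G i = cf_tail (snd i) ` {0..h (snd (fst i))}" for i :: "(nat list \<times> nat) \<times> nat list"
  have h: "0 \<le> h L" "1 \<le> L \<Longrightarrow> h L \<le> 1" for L using pos by (auto simp: h_def mult_nonneg_nonneg)
  have posI: "pos_word (snd i)" "1 \<le> snd (fst i)" if "i \<in> I" for i
    using that record_words_pos by (auto simp: I_def J_def)
  have dp: "d i powr \<theta> = exp (- t * \<theta> * (real (snd (fst i)) - 1)) * wt \<theta> (snd i)" if "pos_word (snd i)" for i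
    using that by (simp add: d_def h_def diam_powr algebra_simps)
  define g where "g j = D * exp (t * \<theta>) * (prod_list (map u (fst j)) * exp (- k * real (snd j)))"
    for j :: "nat list \<times> nat"
  have fibre: "sums_bounded (\<lambda>i. d i powr \<theta>) ({j} \<times> record_words b 0 (fst j)) (g j)" if j: "j \<in> J" for j
  proof -
    obtain ns L where jL: "j = (ns, L)" by (cases j)
    then obtain n ms where ns: "ns = n # ms" using j by (cases ns) (auto simp: J_def)
    have *: "sorted_wrt (<) (0 # n # ms)" "last (n # ms) < L"
      "c * real (last (n # ms)) \<le> c0 * (\<Sum>n\<leftarrow>ms. real n) + \<theta> * real L"
      using j unfolding jL ns J_def by auto
    let ?N = "real (last (n # ms))" and ?s = "\<Sum>n\<leftarrow>ms. real n"
    let ?B = "D * exp (p * ?N) * prod_list (map (\<lambda>i. D * C * b i powr (1 - 2 * \<theta>)) ms)"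
    have words: "sums_bounded (wt \<theta>) (record_words b 0 (n # ms)) ?B"
      using record_words_bound[OF \<theta> p _ *(1), of b] by (simp add: b_def D_def C_def)
    have "sums_bounded (\<lambda>i. d i powr \<theta>) ({j} \<times> record_words b 0 (fst j)) (exp (- t * \<theta> * (real L - 1)) * ?B)"
    proof (rule sums_boundedI)
      fix F assume F: "finite F" "F \<subseteq> {j} \<times> record_words b 0 (fst j)"
      have "(\<Sum>i\<in>F. d i powr \<theta>) = (\<Sum>i\<in>F. exp (- t * \<theta> * (real L - 1)) * wt \<theta> (snd i))"
        using F record_words_pos by (intro sum.cong) (auto simp: dp jL)
      also have "\<dots> = exp (- t * \<theta> * (real L - 1)) * sum (wt \<theta>) (snd ` F)"
        using F by (subst sum.reindex) (auto simp: inj_on_def sum_distrib_left)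
      also have "\<dots> \<le> exp (- t * \<theta> * (real L - 1)) * ?B"
        using F by (intro mult_left_mono sums_boundedD[OF words]) (auto simp: jL ns)
      finally show "(\<Sum>i\<in>F. d i powr \<theta>) \<le> exp (- t * \<theta> * (real L - 1)) * ?B" .
    qed
    moreover have "exp (- t * \<theta> * (real L - 1)) * ?B \<le> g j"
    proof -
      have prod: "prod_list (map (\<lambda>i. D * C * b i powr (1 - 2 * \<theta>)) ms)
          = (D * C * exp (t * c0)) ^ length ms * exp (- t * c0 * ?s)"
      proof (induction ms)
        case (Cons a ms)
        have "b a powr (1 - 2 * \<theta>) = exp (t * c0) * exp (- t * c0 * real a)"
          by (simp add: b_def exp_powr_real c0_def algebra_simps flip: exp_add)
        moreover have "exp (- t * c0 * (\<Sum>n\<leftarrow>a # ms. real n))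
            = exp (- t * c0 * real a) * exp (- t * c0 * (\<Sum>n\<leftarrow>ms. real n))"
          by (simp add: algebra_simps flip: exp_add)
        ultimately show ?case using Cons by (simp only: list.map prod_list.Cons list.size power_Suc
              add_Suc_right add_0_right mult_ac)
      qed simp
      have prod': "prod_list (map u ns) = K ^ length ns * exp (- k * (\<Sum>n\<leftarrow>ns. real n))" for ns
        by (induction ns) (simp_all add: u_def distrib_left exp_add exp_diff exp_minus field_simps)
      have "c * ?N * t2 \<le> (c0 * ?s + \<theta> * real L) * t2"
        using pos by (intro mult_right_mono *(3)) auto
      moreover have "p * ?N \<le> t2 * c * ?N" using pc by (intro mult_right_mono) auto
      \<comment> \<open>The whole pressure cost is now charged to the records at rate
        \<open>t2\<close>; what remains of the exponent is -e (c0 s + \<theta> L), with s the sum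
        over \<open>ms\<close>.\<close>
      ultimately have 1: "p * ?N \<le> t2 * c0 * ?s + t2 * \<theta> * real L" by (simp add: algebra_simps)
      have s0: "0 \<le> ?s" by (intro sum_list_nonneg) auto
      have 2: "k * ?s \<le> e * c0 * ?s" using k s0 by (intro mult_right_mono) auto
      have "n \<le> last (n # ms)" using *(1) by (cases ms) (auto, metis last_in_set less_imp_le list.set_intros(1) list.simps(3))
      then have nL: "real n \<le> real L" using * by simp
      have "k * (real n + real L) \<le> (e * \<theta> / 2) * (real L + real L)"
        using k nL by (intro mult_mono) auto
      then have 3: "k * real n + k * real L \<le> e * \<theta> * real L" by (simp add: algebra_simps)
      have expo: "- t * \<theta> * real L + p * ?N - t * c0 * ?s \<le> - k * (real n + ?s) - k * real L"
        using 1 2 3 unfolding e_def by (simp add: algebra_simps)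
      have "exp (- t * \<theta> * (real L - 1)) * ?B = D * exp (t * \<theta>) * ((D * C * exp (t * c0)) ^ length ms
          * exp (- t * \<theta> * real L + p * ?N - t * c0 * ?s))"
        unfolding prod by (simp add: algebra_simps exp_add exp_diff exp_minus field_simps)
      also have "\<dots> \<le> D * exp (t * \<theta>) * (K ^ length ns * exp (- k * (real n + ?s) - k * real L))"
      proof (intro mult_left_mono mult_mono)
        have "(D * C * exp (t * c0)) ^ length ms \<le> K ^ length ms" using K C D by (intro power_mono) auto
        also have "\<dots> \<le> K ^ length ns" using K ns by (intro power_increasing) auto
        finally show "(D * C * exp (t * c0)) ^ length ms \<le> K ^ length ns" .
      qed (use expo D K in auto)
      also have "\<dots> = g j" unfolding g_def jL fst_conv snd_conv prod'
        by (simp add: ns distrib_left exp_add exp_diff exp_minus field_simps)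
      finally show ?thesis .
    qed
    ultimately show ?thesis using sums_bounded_mono[OF _ subset_refl _ order_refl] by blast
  qed
  define r where "r = exp (- k)"
  have r: "0 \<le> r" "r < 1" using k by (auto simp: r_def)
  have exp_r: "exp (- k * real n) = r ^ n" for n by (simp add: r_def exp_of_nat_mult[symmetric] mult.commute)
  have u: "sums_bounded u UNIV (K / (1 - r))"
    unfolding u_def exp_r using geometric_sums_bounded[OF r, of K] K by simp
  have "sums_bounded g {(ns, L) | ns L. ns \<in> {ns. sorted_wrt (<) ns} \<and> L \<in> UNIV}
    (D * exp (t * \<theta>) * exp (K / (1 - r)) * (1 / (1 - r)))"
  proof (rule sums_bounded_prod[OF sums_bounded_cmult[OF sorted_lists_sum[OF _ u]] geometric_sums_bounded[OF r, of 1]])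
    show unn: "0 \<le> u n" for n using K by (simp add: u_def)
    have pnn: "0 \<le> prod_list (map u ns)" for ns using unn by (induction ns) auto
    show "0 \<le> D * exp (t * \<theta>) * prod_list (map u ns)" for ns using pnn D by simp
    show "g (ns, L) \<le> D * exp (t * \<theta>) * prod_list (map u ns) * (1 * r ^ L)" for ns L
      unfolding g_def fst_conv snd_conv exp_r by (simp add: mult.assoc)
    show "0 \<le> g j" for j using pnn D by (simp add: g_def)
  qed (use D r in auto)
  then have "sums_bounded g J (D * exp (t * \<theta>) * exp (K / (1 - r)) * (1 / (1 - r)))"
    by (rule sums_bounded_mono) (auto simp: J_def)
  then have "sums_bounded (\<lambda>i. d i powr \<theta>) I (D * exp (t * \<theta>) * exp (K / (1 - r)) * (1 / (1 - r)))"
    unfolding I_def by (intro sums_bounded_SUN[OF fibre]) auto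
  then show ?thesis
  proof (rule hausdorff_measure_limsup_cover[where I = I and G = G, rotated 4])
    show "bounded (G i) \<and> diameter (G i) \<le> d i" if "i \<in> I" for i
      using cylinder_cover[OF posI(1)[OF that], of "h (snd (fst i))"] h posI(2)[OF that]
      by (simp add: G_def d_def)
    show "0 \<le> d i" for i using h by (simp add: d_def)
    fix x assume "x \<in> {x \<in> unit_irrationals.
      liminf (log_rate x) = ereal \<tau>}"
    then have x: "x \<in> unit_irrationals"
      and lim: "liminf (log_rate x) = ereal \<tau>" by auto
    have "ereal t < liminf (log_rate x)" using lim t by simp
    then have "\<forall>\<^sub>F n in sequentially. t < ln (real (max_quotient n x)) / real n"
      by (auto dest: less_LiminfD)
    then have "\<forall>\<^sub>F n in sequentially. exp (t * real n) < real (max_quotient n x)"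
      using eventually_ge_at_top[of 1] by eventually_elim (use ln_max_quotient_iff[OF x] in blast)
    from record_sequence[OF x pos(2) this] obtain f where f: "strict_mono f" "1 \<le> f 0"
      "\<And>k. b (f (Suc k)) \<le> real (partial_quotient x (f k))" unfolding b_def by blast
    define S where "S = {k. c * real (f k) \<le> c0 * (\<Sum>i=1..k. real (f i)) + \<theta> * real (f (Suc k))}"
    have "\<exists>\<^sub>F k in sequentially. k \<in> S"
      unfolding S_def c0_def mem_Collect_eq
      using c c' by (intro frequently_linear_recursion[OF f(1) \<theta>]) (auto simp: c1_def c0_def)
    then have inf: "infinite S"
      by (simp add: frequently_cofinite flip: cofinite_eq_sequentially)
    define ns where "ns k = map f [0..<Suc k]" for k
    define w where "w k = ((ns k, f (Suc k)), map (partial_quotient x) [1..<f k])" for k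
    have "inj w"
    proof (rule injI)
      fix k k' assume "w k = w k'"
      then have "length (ns k) = length (ns k')" by (simp add: w_def)
      then show "k = k'" by (simp add: ns_def)
    qed
    then have "infinite (w ` S)" using inf by (simp add: finite_image_iff inj_on_def inj_def)
    moreover have "w ` S \<subseteq> {i \<in> I. x \<in> G i}"
    proof (rule image_subsetI)
      fix k assume k: "k \<in> S"
      have "ns k = f 0 # map f [1..<Suc k]" unfolding ns_def by (subst upt_conv_Cons) auto
      moreover have "ns k = map f [0..<k] @ [f k]" by (simp add: ns_def)
      ultimately have ns: "ns k \<noteq> []" "hd (ns k) = f 0" "last (ns k) = f k"
        by (metis list.distinct(1), metis list.sel(1), metis last_snoc)
      have "sorted_wrt (<) (ns k)" unfolding ns_def sorted_wrt_map
        using f(1) by (intro sorted_wrt_mono_rel[OF _ sorted_wrt_upt]) (auto simp: strict_mono_def)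
      moreover have "(\<Sum>n\<leftarrow>tl (ns k). real n) = (\<Sum>i=1..k. real (f i))"
      proof -
        have "tl (ns k) = map f [1..<Suc k]" by (simp add: ns_def upt_conv_Cons del: upt_Suc)
        then show ?thesis by (simp add: o_def interv_sum_list_conv_sum_set_nat atLeastLessThanSuc_atLeastAtMost del: upt_Suc)
      qed
      ultimately have J: "(ns k, f (Suc k)) \<in> J"
        using k f ns by (auto simp: J_def S_def strict_mono_def)
      have "map (partial_quotient x) [Suc 0..<f (0 + k)] \<in> record_words b 0 (map f [0..<Suc (0 + k)])"
        using f by (intro record_words_mem[OF x]) auto
      then have "w k \<in> I" using J by (auto simp: I_def w_def ns_def)
      have "f 0 \<le> f k" using f(1) by (simp add: strict_mono_less_eq)
      then have "x \<in> cf_tail (map (partial_quotient x) [1..<f k]) ` {0..exp (- (t * (real (f (Suc k)) - 1)))}"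
        using f(2) f(3)[of k] unfolding b_def by (intro mem_cylinder x) auto
      then have "x \<in> G (w k)" by (simp add: G_def h_def w_def)
      then show "w k \<in> {i \<in> I. x \<in> G i}" using \<open>w k \<in> I\<close> by blast
    qed
    ultimately show "infinite {i \<in> I. x \<in> G i}" using finite_subset by blast
  qed (use \<theta> in auto)
qed

section \<open>Mass distribution on a tree\<close>

text \<open>Koenig's argument: otherwise some infinite path has all its cylinders outside every \<open>V i\<close>.\<close>

lemma tree_level_subordinate:
  fixes W :: "nat \<Rightarrow> 'b set" and \<pi> :: "(nat \<Rightarrow> 'b) \<Rightarrow> 'a::metric_space" and V :: "nat \<Rightarrow> 'a set"
  assumes fin: "\<And>t. finite (W t)"
    and shrink: "\<And>e. 0 < e \<Longrightarrow> \<exists>t. \<forall>b\<in>Pi UNIV W. \<forall>b'\<in>Pi UNIV W. (\<forall>s<t. b s = b' s) \<longrightarrow> dist (\<pi> b) (\<pi> b') < e"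
    and V: "\<And>i. open (V i)" "\<And>b. b \<in> Pi UNIV W \<Longrightarrow> \<pi> b \<in> (\<Union>i. V i)"
  shows "\<exists>n. \<forall>b\<in>Pi UNIV W. \<exists>i. \<forall>b'\<in>Pi UNIV W. (\<forall>s<n. b s = b' s) \<longrightarrow> \<pi> b' \<in> V i"
proof (rule ccontr)
  define good where "good n b \<longleftrightarrow> (\<exists>i. \<forall>b'\<in>Pi UNIV W. (\<forall>s<n. b s = b' s) \<longrightarrow> \<pi> b' \<in> V i)" for n b
  define bad where "bad n b \<longleftrightarrow> b \<in> Pi UNIV W \<and>
    (\<forall>m. \<exists>b'\<in>Pi UNIV W. (\<forall>s<n. b s = b' s) \<and> \<not> good m b')" for n b
  have good_mono: "good m b" if "good n b" "n \<le> m" for n m b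
    using that unfolding good_def by (meson less_le_trans)
  have good_cong: "good n b' \<longleftrightarrow> good n b" if "\<forall>s<n. b s = b' s" for n b b'
    using that unfolding good_def by simp
  assume "\<not> ?thesis"
  then have all_bad: "\<exists>b\<in>Pi UNIV W. \<not> good n b" for n unfolding good_def by blast
  have "\<exists>f. \<forall>n. bad n (f n) \<and> (\<forall>s<n. f n s = f (Suc n) s)"
  proof (rule dependent_nat_choice)
    show "\<exists>b. bad 0 b" using all_bad unfolding bad_def by auto
  next
    fix b n assume bad: "bad n b"
    show "\<exists>b'. bad (Suc n) b' \<and> (\<forall>s<n. b s = b' s)"
    proof (rule ccontr)
      assume contra: "\<not> ?thesis"
      have "\<exists>m. \<forall>b'\<in>Pi UNIV W. (\<forall>s<n. b s = b' s) \<and> b' n = c \<longrightarrow> good m b'" if c: "c \<in> W n" for c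
      proof -
        define b1 where "b1 = b(n := c)"
        have b1: "b1 \<in> Pi UNIV W" using bad c by (auto simp: bad_def b1_def)
        have "\<forall>s<n. b s = b1 s" by (simp add: b1_def)
        then have "\<not> bad (Suc n) b1" using contra by blast
        then obtain m where m: "\<And>b'. b' \<in> Pi UNIV W \<Longrightarrow> \<forall>s<Suc n. b1 s = b' s \<Longrightarrow> good m b'"
          using b1 unfolding bad_def by blast
        show ?thesis
        proof (intro exI[of _ m] ballI impI)
          fix b' assume *: "b' \<in> Pi UNIV W" "(\<forall>s<n. b s = b' s) \<and> b' n = c"
          have "\<forall>s<Suc n. b1 s = b' s" using *(2) by (auto simp: b1_def less_Suc_eq)
          then show "good m b'" by (rule m[OF *(1)])
        qed
      qed
      then obtain m where m: "\<And>c b'. c \<in> W n \<Longrightarrow> b' \<in> Pi UNIV W \<Longrightarrow> \<forall>s<n. b s = b' s \<Longrightarrow> b' n = c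
        \<Longrightarrow> good (m c) b'" by metis
      obtain b' where b': "b' \<in> Pi UNIV W" "\<forall>s<n. b s = b' s" "\<not> good (Max (m ` W n)) b'"
        using bad unfolding bad_def by blast
      have "b' n \<in> W n" using b'(1) by auto
      moreover from this have "m (b' n) \<le> Max (m ` W n)" using fin by (intro Max_ge) auto
      ultimately show False using m[of "b' n" b'] good_mono b' by blast
    qed
  qed
  then obtain f where f: "\<And>n. bad n (f n)" "\<And>n s. s < n \<Longrightarrow> f n s = f (Suc n) s" by blast
  define b where "b n = f (Suc n) n" for n
  have ag: "f n s = f (Suc s) s" if "Suc s \<le> n" for n s
    using that
  proof (induction n rule: dec_induct)
    case (step n)
    then show ?case using f(2)[of s n] by (metis Suc_le_eq)
  qed simp
  have agree: "\<forall>s<n. f n s = b s" for n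
    unfolding b_def by (intro allI impI ag) simp
  have b: "b \<in> Pi UNIV W"
    using f(1) unfolding b_def bad_def Pi_iff by blast
  then obtain i where "\<pi> b \<in> V i" using V(2) by blast
  then obtain e where e: "0 < e" "ball (\<pi> b) e \<subseteq> V i" using V(1) by (meson openE)
  obtain t where "\<forall>b\<in>Pi UNIV W. \<forall>b'\<in>Pi UNIV W. (\<forall>s<t. b s = b' s) \<longrightarrow> dist (\<pi> b) (\<pi> b') < e"
    using shrink[OF e(1)] by blast
  then have "good t b" unfolding good_def using e b by (intro exI[of _ i]) (auto simp: subset_iff)
  moreover obtain b' where "\<forall>s<t. f t s = b' s" "\<not> good t b'" using f(1)[of t] unfolding bad_def by blast
  ultimately show False using agree[of t] good_cong[of t b b'] by simp
qed

text \<open>If the measure were zero, an open cover of tiny cost would exist, and at some level n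
  each cylinder would lie in one of its sets. Those assigned to the same set share a path up to
  their first branching t and then use branches from some H; \<open>ball\<close> bounds their mass
  by the cost of that set. Summation over the sets makes the total mass 1 less than 1.\<close>

theorem mass_distribution:
  fixes W :: "nat \<Rightarrow> 'b set" and p :: "nat \<Rightarrow> 'b \<Rightarrow> real" and \<pi> :: "(nat \<Rightarrow> 'b) \<Rightarrow> 'a::metric_space"
  assumes fin: "\<And>t. finite (W t)" and two: "\<And>t. \<exists>c\<in>W t. \<exists>c'\<in>W t. c \<noteq> c'"
    and p: "\<And>t c. c \<in> W t \<Longrightarrow> 0 \<le> p t c" "\<And>t. (\<Sum>c\<in>W t. p t c) = 1"
    and shrink: "\<And>e. 0 < e \<Longrightarrow> \<exists>t. \<forall>b\<in>Pi UNIV W. \<forall>b'\<in>Pi UNIV W. (\<forall>s<t. b s = b' s) \<longrightarrow> dist (\<pi> b) (\<pi> b') < e"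
    and E: "\<And>b. b \<in> Pi UNIV W \<Longrightarrow> \<pi> b \<in> E" and s: "0 < s"
    and ball: "\<And>b t H U. b \<in> Pi UNIV W \<Longrightarrow> H \<subseteq> W t \<Longrightarrow> \<exists>c\<in>H. \<exists>c'\<in>H. c \<noteq> c' \<Longrightarrow> bounded U \<Longrightarrow>
      (\<And>c. c \<in> H \<Longrightarrow> \<exists>b'\<in>Pi UNIV W. (\<forall>s<t. b s = b' s) \<and> b' t = c \<and> \<pi> b' \<in> U) \<Longrightarrow>
      (\<Prod>s<t. p s (b s)) * (\<Sum>c\<in>H. p t c) \<le> C * diameter U powr s"
  shows "hausdorff_measure s E \<noteq> 0"
proof
  assume "hausdorff_measure s E = 0"
  then have null: "hausdorff_premeasure s 1 E = 0" by (simp add: hausdorff_measure_eq_0_iff)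
  define C' where "C' = max 1 C"
  have C': "1 \<le> C'" "C \<le> C'" by (auto simp: C'_def)
  \<comment> \<open>The enlarged cover costs at most 2 \<epsilon>, so the total mass will be bounded
    by 1/2.\<close>
  define \<epsilon> where "\<epsilon> = 1 / (4 * C')"
  have \<epsilon>: "0 < \<epsilon>" using C' by (simp add: \<epsilon>_def)
  have "hausdorff_premeasure s 1 E < ennreal \<epsilon>" using null \<epsilon> by simp
  then obtain U :: "nat \<Rightarrow> 'a set" where U: "E \<subseteq> (\<Union>i. U i)" "\<And>i. bounded (U i)"
    "(\<Sum>i. ennreal (diameter (U i) powr s)) < ennreal \<epsilon>"
    unfolding hausdorff_premeasure_def INF_less_iff by blast
  have "\<exists>V. open V \<and> U i \<subseteq> V \<and> bounded V \<and> diameter V powr s \<le> diameter (U i) powr s + \<epsilon> * (1 / 2) ^ Suc i" for i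
    using enlarge_open[OF U(2) s, of "\<epsilon> * (1 / 2) ^ Suc i" i] \<epsilon> by (metis mult_pos_pos zero_less_power half_gt_zero zero_less_one)
  then obtain V where V: "\<And>i. open (V i)" "\<And>i. U i \<subseteq> V i" "\<And>i. bounded (V i)"
    "\<And>i. diameter (V i) powr s \<le> diameter (U i) powr s + \<epsilon> * (1 / 2) ^ Suc i" by metis
  have sumV: "(\<Sum>i\<in>I. diameter (V i) powr s) \<le> 2 * \<epsilon>" if "finite I" for I
  proof -
    have "ennreal (\<Sum>i\<in>I. diameter (U i) powr s) = (\<Sum>i\<in>I. ennreal (diameter (U i) powr s))" by simp
    also have "\<dots> \<le> (\<Sum>i. ennreal (diameter (U i) powr s))" using that by (intro sum_le_suminf) auto
    also have "\<dots> \<le> ennreal \<epsilon>" using U(3) by simp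
    finally have 1: "(\<Sum>i\<in>I. diameter (U i) powr s) \<le> \<epsilon>" using \<epsilon> by simp
    have "(\<Sum>i\<in>I. \<epsilon> * (1 / 2) ^ Suc i) = \<epsilon> * (\<Sum>i\<in>I. (1 / 2) ^ Suc i)" by (simp add: sum_distrib_left)
    also have "\<dots> \<le> \<epsilon> * (\<Sum>i. (1 / 2) ^ Suc i)"
      using \<epsilon> that power_half_series by (intro mult_left_mono sum_le_suminf) (auto simp: sums_iff)
    also have "\<dots> = \<epsilon>" using power_half_series by (simp add: sums_iff)
    finally have 2: "(\<Sum>i\<in>I. \<epsilon> * (1 / 2) ^ Suc i) \<le> \<epsilon>" .
    have "(\<Sum>i\<in>I. diameter (V i) powr s) \<le> (\<Sum>i\<in>I. diameter (U i) powr s + \<epsilon> * (1 / 2) ^ Suc i)"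
      using V(4) by (rule sum_mono)
    then show ?thesis using 1 2 unfolding sum.distrib by linarith
  qed
  have cover: "\<pi> b \<in> (\<Union>i. V i)" if "b \<in> Pi UNIV W" for b
    using E[OF that] U(1) V(2) by blast
  obtain n where n: "\<And>b. b \<in> Pi UNIV W \<Longrightarrow> \<exists>i. \<forall>b'\<in>Pi UNIV W. (\<forall>s<n. b s = b' s) \<longrightarrow> \<pi> b' \<in> V i"
    using tree_level_subordinate[OF fin shrink V(1) cover] by blast
  obtain b0 where b0: "\<And>t. b0 t \<in> W t" using two by metis
  define ext where "ext f t = (if t < n then f t else b0 t)" for f and t :: nat
  let ?P = "PiE {..<n} W"
  have ext: "ext f \<in> Pi UNIV W" if "f \<in> ?P" for f
    using that b0 by (auto simp: ext_def PiE_def)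
  have "\<forall>f\<in>?P. \<exists>i. \<forall>b'\<in>Pi UNIV W. (\<forall>s<n. ext f s = b' s) \<longrightarrow> \<pi> b' \<in> V i"
    by (intro ballI n ext)
  from bchoice[OF this] obtain idx where
    "\<forall>f\<in>?P. \<forall>b'\<in>Pi UNIV W. (\<forall>s<n. ext f s = b' s) \<longrightarrow> \<pi> b' \<in> V (idx f)" by blast
  then have idx: "\<pi> b' \<in> V (idx f)" if "f \<in> ?P" "b' \<in> Pi UNIV W" "\<forall>s<n. ext f s = b' s" for f b'
    using that by blast
  define w where "w f = (\<Prod>t<n. p t (f t))" for f
  have finP: "finite ?P" using fin by (intro finite_PiE) auto
  have total: "(\<Sum>f\<in>?P. w f) = 1"
    unfolding w_def using fin p(2) by (subst prod_sum_PiE[symmetric]) auto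
  have part: "(\<Sum>f | f \<in> ?P \<and> idx f = i. w f) \<le> C * diameter (V i) powr s" if i: "i \<in> idx ` ?P" for i
  proof -
    define F where "F = {f \<in> ?P. idx f = i}"
    obtain f0 where f0: "f0 \<in> ?P" "idx f0 = i" using i by blast
    define Q where "Q = {b \<in> Pi UNIV W. \<pi> b \<in> V i}"
    have change: "(ext f)(n := c) \<in> Q" if "f \<in> F" "c \<in> W n" for f c
    proof -
      have "(ext f)(n := c) \<in> Pi UNIV W" using ext[of f] that by (auto simp: F_def)
      then show ?thesis using that idx[of f "(ext f)(n := c)"] by (auto simp: Q_def F_def)
    qed
    have extQ: "ext f \<in> Q" if "f \<in> F" for f using idx[of f "ext f"] ext[of f] that by (auto simp: Q_def F_def)
    define differ where "differ t \<longleftrightarrow> (\<exists>b\<in>Q. \<exists>b'\<in>Q. b t \<noteq> b' t)" for t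
    \<comment> \<open>A whole cylinder of level n maps into \<open>V i\<close>, so coordinate n
      varies within \<open>Q\<close>. Hence the first varying coordinate exists and is at most
      n.\<close>
    have "differ n"
    proof -
      obtain c c' where "c \<in> W n" "c' \<in> W n" "c \<noteq> c'" using two by blast
      moreover have "f0 \<in> F" using f0 by (simp add: F_def)
      ultimately have "(ext f0)(n := c) \<in> Q" "(ext f0)(n := c') \<in> Q" "((ext f0)(n := c)) n \<noteq> ((ext f0)(n := c')) n"
        using change by auto
      then show ?thesis unfolding differ_def by blast
    qed
    define t where "t = (LEAST t. differ t)"
    have t: "differ t" "t \<le> n" using \<open>differ n\<close> by (auto simp: t_def intro: LeastI Least_le)
    have same: "b r = b' r" if "b \<in> Q" "b' \<in> Q" "r < t" for b b' r
      using not_less_Least[of r differ] that by (auto simp: t_def differ_def)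
    define b where "b = ext f0"
    have b: "b \<in> Q" using extQ f0 by (simp add: b_def F_def)
    define H where "H = (\<lambda>b. b t) ` Q"
    have HW: "H \<subseteq> W t" by (auto simp: H_def Q_def)
    have bound: "(\<Prod>r<t. p r (b r)) * (\<Sum>c\<in>H. p t c) \<le> C * diameter (V i) powr s"
    proof (rule ball)
      show "\<exists>c\<in>H. \<exists>c'\<in>H. c \<noteq> c'" using t(1) by (auto simp: differ_def H_def)
      show "\<exists>b'\<in>Pi UNIV W. (\<forall>s<t. b s = b' s) \<and> b' t = c \<and> \<pi> b' \<in> V i" if c: "c \<in> H" for c
      proof -
        obtain b' where "b' \<in> Q" "c = b' t" using c by (auto simp: H_def)
        then show ?thesis using same[OF b \<open>b' \<in> Q\<close>] by (intro bexI[of _ b']) (auto simp: Q_def)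
      qed
    qed (use b HW V in \<open>auto simp: Q_def\<close>)
    \<comment> \<open>The box below the common node: fixed up to t, restricted to H at t, free
      afterwards. Its free factors have mass 1.\<close>
    define W' where "W' r = (if r < t then {b r} else if r = t then H else W r)" for r
    have W'W: "W' r \<subseteq> W r" for r using HW b by (auto simp: W'_def Q_def)
    have FW: "F \<subseteq> PiE {..<n} W'"
    proof
      fix f assume f: "f \<in> F"
      have "f r \<in> W' r" if "r < n" for r
      proof -
        have "f r = ext f r" using that by (simp add: ext_def)
        moreover have "ext f r \<in> W r" using extQ[OF f] unfolding Q_def by blast
        moreover have "ext f r \<in> (\<lambda>b. b r) ` Q" using extQ[OF f] by blast
        ultimately show ?thesis using same[OF extQ[OF f] b, of r] by (auto simp: W'_def H_def)
      qed
      then show "f \<in> PiE {..<n} W'" using f by (auto simp: F_def PiE_def)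
    qed
    have finW': "finite (W' r)" for r using finite_subset[OF W'W fin] .
    have "(\<Sum>f\<in>F. w f) \<le> (\<Sum>f\<in>PiE {..<n} W'. w f)"
    proof (rule sum_mono2)
      show "finite (PiE {..<n} W')" using finW' by (intro finite_PiE) auto
      show "0 \<le> w f" if "f \<in> PiE {..<n} W' - F" for f
        unfolding w_def using that W'W p(1) by (intro prod_nonneg) (auto simp: PiE_def Pi_def subset_iff)
    qed (rule FW)
    also have "\<dots> = (\<Prod>r<n. \<Sum>c\<in>W' r. p r c)"
      unfolding w_def using finW' by (subst prod_sum_PiE) auto
    also have "\<dots> = (\<Prod>r<t. p r (b r)) * (\<Sum>c\<in>H. p t c)"
    proof (cases "t = n")
      case True
      \<comment> \<open>If the first variation is at level n, the box has no restricted factor; then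
        H must be all of \<open>W n\<close> for the factor in \<open>bound\<close> to be 1.\<close>
      have "W n \<subseteq> H"
      proof
        fix c assume "c \<in> W n"
        then have "(ext f0)(n := c) \<in> Q" using change f0 by (auto simp: F_def)
        then show "c \<in> H" unfolding H_def True by (metis fun_upd_same image_eqI)
      qed
      then have "H = W n" using HW True by auto
      then show ?thesis using True p(2) by (simp add: W'_def)
    next
      case False
      then have tn: "t < n" using t by simp
      have split: "{..<n} = {..<t} \<union> ({t} \<union> {Suc t..<n})" using tn by auto
      have "(\<Prod>r\<in>{Suc t..<n}. \<Sum>c\<in>W' r. p r c) = 1"
        using p(2) by (intro prod.neutral) (auto simp: W'_def)
      moreover have "(\<Prod>r\<in>{..<t}. \<Sum>c\<in>W' r. p r c) = (\<Prod>r<t. p r (b r))"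
        by (intro prod.cong) (auto simp: W'_def)
      moreover have "(\<Prod>r<n. \<Sum>c\<in>W' r. p r c) = (\<Prod>r\<in>{..<t}. \<Sum>c\<in>W' r. p r c) *
          ((\<Sum>c\<in>W' t. p t c) * (\<Prod>r\<in>{Suc t..<n}. \<Sum>c\<in>W' r. p r c))"
        unfolding split by (subst prod.union_disjoint, auto)+
      ultimately show ?thesis by (simp add: W'_def)
    qed
    also note bound
    finally show ?thesis unfolding F_def .
  qed
  have "1 = (\<Sum>f\<in>?P. w f)" using total by simp
  also have "\<dots> = (\<Sum>i\<in>idx ` ?P. \<Sum>f | f \<in> ?P \<and> idx f = i. w f)" using finP by (rule sum.image_gen)
  also have "\<dots> \<le> (\<Sum>i\<in>idx ` ?P. C * diameter (V i) powr s)" using part by (rule sum_mono)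
  also have "\<dots> \<le> (\<Sum>i\<in>idx ` ?P. C' * diameter (V i) powr s)" using C' by (intro sum_mono mult_right_mono) auto
  also have "\<dots> = C' * (\<Sum>i\<in>idx ` ?P. diameter (V i) powr s)" by (simp add: sum_distrib_left)
  also have "\<dots> \<le> C' * (2 * \<epsilon>)" using C' finP by (intro mult_left_mono sumV) auto
  also have "\<dots> < 1" using C' by (simp add: \<epsilon>_def)
  finally show False by simp
qed

section \<open>Continued fractions with prescribed digits\<close>

text \<open>Digits are indexed from 0 here, so \<open>d n\<close> becomes the partial quotient with
  index \<open>Suc n\<close>.\<close>

definition cf_lim :: "(nat \<Rightarrow> nat) \<Rightarrow> real" where
  "cf_lim d = lim (\<lambda>n. cf_tail (map d [0..<n]) 0)"

lemma cf_lim_tendsto: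
  assumes d: "\<And>i. 1 \<le> d i"
  shows "(\<lambda>n. cf_tail (map d [0..<n]) 0) \<longlonglongrightarrow> cf_lim d"
proof -
  have bound: "\<bar>cf_tail (map d [0..<n + j]) 0 - cf_tail (map d [0..<n]) 0\<bar> \<le> (1 / 4) ^ (n div 2)" for n j
  proof -
    have "map d [0..<n + j] = map d [0..<n] @ map d [n..<n + j]"
      by (metis le0 map_append upt_add_eq_append)
    moreover have "\<bar>cf_tail (map d [0..<n]) (cf_tail (map d [n..<n + j]) 0) - cf_tail (map d [0..<n]) 0\<bar>
        \<le> (1 / 4) ^ (length (map d [0..<n]) div 2)"
      using d cf_tail_range[of "map d [n..<n + j]" 0] by (intro cf_tail_diff) auto
    ultimately show ?thesis by (simp add: cf_tail_append)
  qed
  have "Cauchy (\<lambda>n. cf_tail (map d [0..<n]) 0)"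
  proof (rule metric_CauchyI)
    fix e :: real assume "0 < e"
    then obtain k where k: "(1 / 4 :: real) ^ k < e / 2"
      using real_arch_pow_inv[of "e / 2" "1 / 4"] by auto
    have near: "\<bar>cf_tail (map d [0..<n]) 0 - cf_tail (map d [0..<2 * k]) 0\<bar> < e / 2" if "2 * k \<le> n" for n
      using bound[of "2 * k" "n - 2 * k"] that k by simp
    show "\<exists>M. \<forall>m\<ge>M. \<forall>n\<ge>M. dist (cf_tail (map d [0..<m]) 0) (cf_tail (map d [0..<n]) 0) < e"
    proof (intro exI[of _ "2 * k"] allI impI)
      fix m n assume "2 * k \<le> m" "2 * k \<le> n"
      from near[OF this(1)] near[OF this(2)]
      show "dist (cf_tail (map d [0..<m]) 0) (cf_tail (map d [0..<n]) 0) < e"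
        unfolding dist_real_def by linarith
    qed
  qed
  then show ?thesis unfolding cf_lim_def
    using Cauchy_convergent_iff convergent_LIMSEQ_iff by blast
qed

lemma cf_lim_step:
  assumes d: "\<And>i. 1 \<le> d i"
  shows "0 < cf_lim d" "cf_lim d < 1" "cf_lim d = 1 / (real (d 0) + cf_lim (\<lambda>i. d (Suc i)))"
proof -
  have range: "0 \<le> cf_lim d" if d: "\<And>i. 1 \<le> d i" for d
    using d cf_tail_range[of "map d [0..<n]" 0 for n]
    by (intro LIMSEQ_le_const[OF cf_lim_tendsto[of d, OF d]]) auto
  have step: "cf_lim d = 1 / (real (d 0) + cf_lim (\<lambda>i. d (Suc i)))" if d: "\<And>i. 1 \<le> d i" for d
  proof (rule LIMSEQ_unique)
    show "(\<lambda>n. cf_tail (map d [0..<Suc n]) 0) \<longlonglongrightarrow> cf_lim d"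
      using cf_lim_tendsto[of d, OF d] by (rule LIMSEQ_Suc)
    have "map d [0..<Suc n] = d 0 # map (\<lambda>i. d (Suc i)) [0..<n]" for n
      by (simp add: upt_conv_Cons map_Suc_upt[symmetric] o_def del: upt_Suc)
    then have eq: "cf_tail (map d [0..<Suc n]) 0 = 1 / (real (d 0) + cf_tail (map (\<lambda>i. d (Suc i)) [0..<n]) 0)" for n
      by simp
    have "0 \<le> cf_lim (\<lambda>i. d (Suc i))" using d by (intro range)
    moreover have "1 \<le> real (d 0)" using d[of 0] by simp
    ultimately have "real (d 0) + cf_lim (\<lambda>i. d (Suc i)) \<noteq> 0" by linarith
    then show "(\<lambda>n. cf_tail (map d [0..<Suc n]) 0) \<longlonglongrightarrow> 1 / (real (d 0) + cf_lim (\<lambda>i. d (Suc i)))"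
      unfolding eq using cf_lim_tendsto[of "\<lambda>i. d (Suc i)"] d by (intro tendsto_intros) auto
  qed
  have pos: "0 < cf_lim d" if d: "\<And>i. 1 \<le> d i" for d
  proof -
    have "0 \<le> cf_lim (\<lambda>i. d (Suc i))" using d by (intro range)
    moreover have "1 \<le> real (d 0)" using d[of 0] by simp
    ultimately have "0 < real (d 0) + cf_lim (\<lambda>i. d (Suc i))" by linarith
    then show ?thesis using step[of d, OF d] by simp
  qed
  show "cf_lim d = 1 / (real (d 0) + cf_lim (\<lambda>i. d (Suc i)))" using d by (rule step)
  show "0 < cf_lim d" using d by (rule pos)
  have "0 < cf_lim (\<lambda>i. d (Suc i))" using d by (intro pos)
  moreover have "1 \<le> real (d 0)" using d[of 0] by simp
  ultimately have "1 < real (d 0) + cf_lim (\<lambda>i. d (Suc i))" by linarith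
  then show "cf_lim d < 1" using step[of d, OF d] by simp
qed

text \<open>Infinite descent as in Euclid's algorithm: a value m / n has m < n, and dropping the
  first digit leaves a fraction with denominator m.\<close>

lemma cf_lim_irrational:
  assumes d: "\<And>i. 1 \<le> d i"
  shows "cf_lim d \<in> unit_irrationals"
proof -
  have neq: "cf_lim d \<noteq> real m / real n" if "\<And>i. 1 \<le> d i" for m n d
    using that
  proof (induction n arbitrary: m d rule: less_induct)
    case (less n)
    note * = cf_lim_step[of d, OF less.prems]
    let ?y = "cf_lim (\<lambda>i. d (Suc i))"
    show ?case
    proof
      assume eq: "cf_lim d = real m / real n"
      have n: "0 < n" using *(1) eq by (cases n) auto
      then have "real m = cf_lim d * real n" using eq by simp
      moreover have "0 < cf_lim d * real n" "cf_lim d * real n < 1 * real n"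
        using n *(1,2) by (auto intro!: mult_strict_right_mono)
      ultimately have mn: "0 < m" "m < n" by simp_all
      have y: "0 < ?y" using cf_lim_step(1)[of "\<lambda>i. d (Suc i)"] less.prems by simp
      have "real (d 0) + ?y = real n / real m"
        using *(3) mn y unfolding eq by (simp add: divide_simps mult.commute split: if_splits)
      then have "?y * real m = real n - real (d 0 * m)" using mn by (simp add: field_simps)
      moreover have "0 \<le> ?y * real m" using y by simp
      ultimately have "real (d 0 * m) \<le> real n" and eq': "?y * real m = real n - real (d 0 * m)" by linarith+
      then have "d 0 * m \<le> n" by (simp only: of_nat_le_iff)
      then have "?y * real m = real (n - d 0 * m)" using eq' by (simp only: of_nat_diff)
      then have "?y = real (n - d 0 * m) / real m" using mn by (simp add: eq_divide_eq)
      moreover have "?y \<noteq> real (n - d 0 * m) / real m" using less.prems by (intro less.IH mn(2))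
      ultimately show False by contradiction
    qed
  qed
  have "cf_lim d \<notin> \<rat>"
  proof
    assume "cf_lim d \<in> \<rat>"
    then obtain m n :: nat where "\<bar>cf_lim d\<bar> = real m / real n" by (rule Rats_abs_nat_div_natE)
    then show False using neq[of d m n, OF d] cf_lim_step(1)[of d, OF d] by simp
  qed
  then show ?thesis using cf_lim_step(1,2)[of d, OF d] by (simp add: unit_irrationals_def)
qed

lemma cf_lim_floor:
  assumes d: "\<And>i. 1 \<le> d i"
  shows "gauss_map (cf_lim d) = cf_lim (\<lambda>i. d (Suc i))" "nat \<lfloor>1 / cf_lim d\<rfloor> = d 0"
proof -
  let ?y = "cf_lim (\<lambda>i. d (Suc i))"
  have y: "0 < ?y" "?y < 1" using cf_lim_step(1,2)[of "\<lambda>i. d (Suc i)"] d by auto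
  have "1 / cf_lim d = real (d 0) + ?y" using cf_lim_step(3)[of d] d by simp
  then have fl: "\<lfloor>1 / cf_lim d\<rfloor> = int (d 0)" and eq: "1 / cf_lim d = real (d 0) + ?y"
    using y by (auto simp: floor_eq_iff)
  show "nat \<lfloor>1 / cf_lim d\<rfloor> = d 0" using fl by simp
  show "gauss_map (cf_lim d) = ?y" unfolding gauss_map_def frac_def fl using eq by simp
qed

lemma partial_quotient_cf_lim:
  assumes d: "\<And>i. 1 \<le> d i"
  shows "partial_quotient (cf_lim d) (Suc n) = d n"
proof -
  have "(gauss_map ^^ n) (cf_lim d) = cf_lim (\<lambda>i. d (i + n))"
  proof (induction n)
    case (Suc n)
    then show ?case using cf_lim_floor(1)[of "\<lambda>i. d (i + n)"] d by simp
  qed simp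
  then show ?thesis unfolding partial_quotient_def using cf_lim_floor(2)[of "\<lambda>i. d (i + n)"] d by simp
qed

lemma cf_lim_split:
  assumes d: "\<And>i. 1 \<le> d i"
  shows "cf_lim d = cf_tail (map d [0..<n]) (cf_lim (\<lambda>i. d (i + n)))"
proof (induction n)
  case (Suc n)
  have "cf_lim (\<lambda>i. d (i + n)) = cf_tail [d n] (cf_lim (\<lambda>i. d (i + Suc n)))"
    using cf_lim_step(3)[of "\<lambda>i. d (i + n)"] d by simp
  then show ?case using Suc by (simp add: cf_tail_append)
qed simp

section \<open>Upper and lower limits along blocks\<close>

lemma block_interval:
  fixes N :: "nat \<Rightarrow> nat"
  assumes "strict_mono N" "N K \<le> n"
  obtains k where "K \<le> k" "N k \<le> n" "n < N (Suc k)"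
proof -
  define j where "j = (LEAST j. n < N j)"
  have "n < N (Suc n)" using strict_mono_imp_increasing[OF assms(1), of "Suc n"] by simp
  then have j: "n < N j" unfolding j_def by (rule LeastI)
  then have "N K < N j" using assms(2) by simp
  then have Kj: "K < j" using strict_mono_less[OF assms(1)] by simp
  then have "\<not> n < N (j - 1)" using not_less_Least[of "j - 1" "\<lambda>j. n < N j"] by (simp add: j_def)
  then show ?thesis using Kj j by (intro that[of "j - 1"]) auto
qed

text \<open>On the block from N k to N (k + 1) - 1 the function is y k / n up to C / n. So the upper
  limit is read off at the left ends and the lower limit at the right ends, where subtracting 1 from
  N (k + 1) is harmless.\<close>

lemma limsup_liminf_blocks:
  fixes N :: "nat \<Rightarrow> nat" and f y :: "nat \<Rightarrow> real"
  assumes N: "strict_mono N" "1 \<le> N 0" and y: "\<And>k. 0 \<le> y k" and C: "0 \<le> C"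
    and f: "\<And>k n. N k \<le> n \<Longrightarrow> n < N (Suc k) \<Longrightarrow> y k / real n \<le> f n \<and> f n \<le> (C + y k) / real n"
    and lim: "(\<lambda>k. y k / real (N k)) \<longlonglongrightarrow> \<alpha>" "(\<lambda>k. y k / real (N (Suc k))) \<longlonglongrightarrow> \<beta>"
  shows "limsup (\<lambda>n. ereal (f n)) = ereal \<alpha>" "liminf (\<lambda>n. ereal (f n)) = ereal \<beta>"
proof -
  have Npos: "1 \<le> N k" for k using strict_mono_less_eq[OF N(1), of 0 k] N(2) by simp
  have Ninf: "filterlim (\<lambda>k. real (N k)) at_top sequentially"
    using filterlim_compose[OF filterlim_real_sequentially filterlim_subseq[OF N(1)]] .
  have C0: "(\<lambda>k. C / real (N k)) \<longlonglongrightarrow> 0" using Ninf by (intro real_tendsto_divide_at_top) auto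
  have up: "(\<lambda>k. (C + y k) / real (N k)) \<longlonglongrightarrow> \<alpha>"
    using tendsto_add[OF C0 lim(1)] by (simp add: add_divide_distrib)
  have low: "(\<lambda>k. (C + y k) / (real (N (Suc k)) - 1)) \<longlonglongrightarrow> \<beta>"
  proof -
    have 1: "(\<lambda>k. (C + y k) / real (N (Suc k))) \<longlonglongrightarrow> \<beta>"
      using tendsto_add[OF LIMSEQ_Suc[OF C0] lim(2)] by (simp add: add_divide_distrib)
    have "(\<lambda>k. 1 / real (N (Suc k))) \<longlonglongrightarrow> 0"
      using filterlim_compose[OF Ninf filterlim_Suc] by (intro real_tendsto_divide_at_top) auto
    then have "(\<lambda>k. (C + y k) / real (N (Suc k)) / (1 - 1 / real (N (Suc k)))) \<longlonglongrightarrow> \<beta> / (1 - 0)"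
      by (intro tendsto_intros 1) auto
    moreover have "(C + y k) / real (N (Suc k)) / (1 - 1 / real (N (Suc k))) = (C + y k) / (real (N (Suc k)) - 1)" for k
    proof -
      have "1 - 1 / real (N (Suc k)) = (real (N (Suc k)) - 1) / real (N (Suc k))"
        using Npos[of "Suc k"] by (simp add: diff_divide_distrib)
      then show ?thesis using Npos[of "Suc k"] by simp
    qed
    ultimately show ?thesis by (simp only: diff_0_right div_by_1)
  qed
  show "limsup (\<lambda>n. ereal (f n)) = ereal \<alpha>"
  proof (rule antisym)
    show "limsup (\<lambda>n. ereal (f n)) \<le> ereal \<alpha>"
    proof (rule ereal_le_epsilon2)
      fix e :: real assume "0 < e"
      then have "\<forall>\<^sub>F k in sequentially. (C + y k) / real (N k) < \<alpha> + e" using up by (intro order_tendstoD) auto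
      then obtain K where K: "\<And>k. K \<le> k \<Longrightarrow> (C + y k) / real (N k) < \<alpha> + e"
        by (auto simp: eventually_sequentially)
      have "f n \<le> \<alpha> + e" if n: "N K \<le> n" for n
      proof -
        obtain k where k: "K \<le> k" "N k \<le> n" "n < N (Suc k)" using block_interval[OF N(1) n] .
        have "f n \<le> (C + y k) / real n" using f k by blast
        also have "\<dots> \<le> (C + y k) / real (N k)" using k y[of k] C Npos[of k] by (intro divide_left_mono) auto
        finally show ?thesis using K[OF k(1)] by simp
      qed
      then show "limsup (\<lambda>n. ereal (f n)) \<le> ereal \<alpha> + ereal e"
        by (intro Limsup_bounded) (auto simp: eventually_sequentially)
    qed
    have "ereal \<alpha> = limsup (\<lambda>k. ereal (y k / real (N k)))"
      using lim(1) by (intro lim_imp_Limsup[symmetric]) auto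
    also have "\<dots> \<le> limsup ((\<lambda>n. ereal (f n)) \<circ> N)"
      using f[of _ "N _"] strict_monoD[OF N(1) lessI] by (intro Limsup_mono) auto
    also have "\<dots> \<le> limsup (\<lambda>n. ereal (f n))" using N(1) by (rule limsup_subseq_mono)
    finally show "ereal \<alpha> \<le> limsup (\<lambda>n. ereal (f n))" .
  qed
  show "liminf (\<lambda>n. ereal (f n)) = ereal \<beta>"
  proof (rule antisym)
    define r where "r k = N (Suc k) - 1" for k
    have r: "N k \<le> r k" "r k < N (Suc k)" "real (r k) = real (N (Suc k)) - 1" for k
      using strict_monoD[OF N(1), of k "Suc k"] Npos[of "Suc k"] by (auto simp: r_def of_nat_diff)
    have mono: "strict_mono r" unfolding strict_mono_Suc_iff
    proof
      fix k show "r k < r (Suc k)" using r(2)[of k] r(1)[of "Suc k"] by simp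
    qed
    have "liminf (\<lambda>n. ereal (f n)) \<le> liminf ((\<lambda>n. ereal (f n)) \<circ> r)" using mono by (rule liminf_subseq_mono)
    also have "\<dots> \<le> liminf (\<lambda>k. ereal ((C + y k) / (real (N (Suc k)) - 1)))"
      using f[OF r(1,2)] unfolding r(3) by (intro Liminf_mono) auto
    also have "\<dots> = ereal \<beta>" using low by (intro lim_imp_Liminf) auto
    finally show "liminf (\<lambda>n. ereal (f n)) \<le> ereal \<beta>" .
    show "ereal \<beta> \<le> liminf (\<lambda>n. ereal (f n))"
    proof (rule ereal_le_epsilon2)
      fix e :: real assume "0 < e"
      then have "\<forall>\<^sub>F k in sequentially. \<beta> - e < y k / real (N (Suc k))" using lim(2) by (intro order_tendstoD) auto
      then obtain K where K: "\<And>k. K \<le> k \<Longrightarrow> \<beta> - e < y k / real (N (Suc k))"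
        by (auto simp: eventually_sequentially)
      have "\<beta> - e \<le> f n" if n: "N K \<le> n" for n
      proof -
        obtain k where k: "K \<le> k" "N k \<le> n" "n < N (Suc k)" using block_interval[OF N(1) n] .
        have "y k / real (N (Suc k)) \<le> y k / real n" using k y[of k] Npos[of k] by (intro divide_left_mono) auto
        also have "\<dots> \<le> f n" using f k by blast
        finally show ?thesis using K[OF k(1)] by simp
      qed
      then have "ereal (\<beta> - e) \<le> liminf (\<lambda>n. ereal (f n))"
        by (intro Liminf_bounded) (auto simp: eventually_sequentially)
      then have "ereal (\<beta> - e) + ereal e \<le> liminf (\<lambda>n. ereal (f n)) + ereal e" by (rule add_right_mono)
      then show "ereal \<beta> \<le> liminf (\<lambda>n. ereal (f n)) + ereal e" by simp
    qed
  qed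
qed

section \<open>A Cantor set with sparse large digits\<close>

abbreviation concat_upto :: "(nat \<Rightarrow> 'a list) \<Rightarrow> nat \<Rightarrow> 'a list" where
  "concat_upto b t \<equiv> concat (map b [0..<t])"

text \<open>For nonempty blocks the first i + 1 of them already reach index i.\<close>

definition digits_of :: "(nat \<Rightarrow> 'a list) \<Rightarrow> nat \<Rightarrow> 'a" where
  "digits_of b i = concat_upto b (Suc i) ! i"

lemma digits_of_nth:
  assumes b: "\<And>t. b t \<noteq> []" and i: "i < length (concat_upto b t)"
  shows "digits_of b i = concat_upto b t ! i"
proof -
  have prefix: "\<exists>ys. concat_upto b t' = concat_upto b s @ ys" if "s \<le> t'" for s t'
    using that
  proof (induction t' rule: dec_induct)
    case (step t')
    then show ?case by auto
  qed simp
  have "s \<le> length (concat_upto b s)" for s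
  proof (induction s)
    case (Suc s)
    moreover have "0 < length (b s)" using b by simp
    ultimately show ?case unfolding upt_Suc by (simp del: length_greater_0_conv)
  qed simp
  from this[of "Suc i"] have i': "i < length (concat_upto b (Suc i))" by simp
  show ?thesis
  proof (cases "Suc i \<le> t")
    case True
    from prefix[OF this] show ?thesis using i' unfolding digits_of_def by (metis nth_append)
  next
    case False
    then have "t \<le> Suc i" by simp
    from prefix[OF this] show ?thesis using i unfolding digits_of_def by (metis nth_append)
  qed
qed

text \<open>Nonzero values of A are thus at least 2, which gives every large-digit step two choices
  and keeps its tails at most 1/2.\<close>

locale sparse_digits =
  fixes B l :: nat and A :: "nat \<Rightarrow> nat"
  assumes B: "2 \<le> B" and l: "1 \<le> l" and A1: "\<And>t. A t \<noteq> 1" and A_sparse: "\<And>t. A t \<noteq> 0 \<Longrightarrow> A (Suc t) = 0"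
begin

text \<open>Step \<open>t\<close> appends a single digit of size about \<open>A t\<close> if \<open>A t > 0\<close>, and a block
  of \<open>l\<close> digits bounded by \<open>B\<close> if \<open>A t = 0\<close>.\<close>

definition blocks :: "nat list set" where
  "blocks = {c. set c \<subseteq> {1..B} \<and> length c = l}"

definition choices :: "nat \<Rightarrow> nat list set" where
  "choices t = (if A t = 0 then blocks else (\<lambda>a. [a]) ` {A t..<2 * A t})"

abbreviation paths :: "(nat \<Rightarrow> nat list) set" where
  "paths \<equiv> Pi UNIV choices"

definition offset :: "nat \<Rightarrow> nat" where
  "offset t = (\<Sum>s<t. if A s = 0 then l else 1)"

definition tail_point :: "(nat \<Rightarrow> nat list) \<Rightarrow> nat \<Rightarrow> real" where
  "tail_point b t = cf_lim (\<lambda>i. digits_of b (i + offset t))"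

abbreviation point :: "(nat \<Rightarrow> nat list) \<Rightarrow> real" where
  "point b \<equiv> cf_lim (digits_of b)"

lemma A2: "A t \<noteq> 0 \<Longrightarrow> 2 \<le> A t"
  using A1[of t] by linarith

lemma finite_choices: "finite (choices t)"
  unfolding choices_def blocks_def by (auto intro: finite_lists_length_eq)

lemma two_choices: "\<exists>c\<in>choices t. \<exists>c'\<in>choices t. c \<noteq> c'"
proof (cases "A t = 0")
  case True
  have "replicate l 1 \<in> choices t" "replicate l 2 \<in> choices t" "replicate l 1 \<noteq> replicate l (2::nat)"
    using B l True by (auto simp: choices_def blocks_def replicate_eq_replicate)
  then show ?thesis by blast
next
  case False
  then have "[A t] \<in> choices t" "[Suc (A t)] \<in> choices t" using A2[OF False] by (auto simp: choices_def)
  then show ?thesis by (metis list.inject n_not_Suc_n)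
qed

lemma choices_pos: "c \<in> choices t \<Longrightarrow> pos_word c" "c \<in> choices t \<Longrightarrow> c \<noteq> []"
  "c \<in> choices t \<Longrightarrow> length c = (if A t = 0 then l else 1)"
  using l A2[of t] by (auto simp: choices_def blocks_def split: if_splits)

context
  fixes b :: "nat \<Rightarrow> nat list"
  assumes b: "b \<in> paths"
begin

lemma bt: "b t \<in> choices t"
  using b by blast

lemma length_concat_upto: "length (concat_upto b t) = offset t"
  by (induction t) (auto simp: offset_def choices_pos(3)[OF bt])

lemma pos_concat_upto: "pos_word (concat_upto b t)"
  using choices_pos(1)[OF bt] by auto

lemma digits_eq: "i < offset t \<Longrightarrow> digits_of b i = concat_upto b t ! i"
  using digits_of_nth[of b i t] choices_pos(2)[OF bt] by (simp add: length_concat_upto)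

lemma offset_ge: "t \<le> offset t"
proof (induction t)
  case (Suc t)
  then show ?case using l by (auto simp: offset_def)
qed simp

lemma digits_pos: "1 \<le> digits_of b i"
proof -
  have i: "i < offset (Suc i)" using offset_ge[of "Suc i"] by simp
  have "concat_upto b (Suc i) ! i \<in> set (concat_upto b (Suc i))"
    using i by (intro nth_mem) (simp only: length_concat_upto)
  then show ?thesis using pos_concat_upto[of "Suc i"] unfolding digits_eq[OF i] by blast
qed

lemma digits_step: "i < length (b t) \<Longrightarrow> digits_of b (i + offset t) = b t ! i"
  using digits_eq[of "i + offset t" "Suc t"] choices_pos(3)[OF bt, of t]
  by (simp add: offset_def nth_append length_concat_upto[unfolded offset_def])

lemma point_split: "point b = cf_tail (concat_upto b t) (tail_point b t)"
proof -
  have "map (digits_of b) [0..<offset t] = concat_upto b t"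
    by (rule nth_equalityI) (simp_all add: length_concat_upto digits_eq)
  then show ?thesis unfolding tail_point_def
    using cf_lim_split[of "digits_of b" "offset t"] digits_pos by simp
qed

lemma tail_point_split: "tail_point b t = cf_tail (b t) (tail_point b (Suc t))"
proof -
  have "map (\<lambda>i. digits_of b (i + offset t)) [0..<length (b t)] = b t"
    by (rule nth_equalityI) (simp_all add: digits_step)
  moreover have "i + length (b t) + offset t = i + offset (Suc t)" for i
    using choices_pos(3)[OF bt, of t] by (simp add: offset_def)
  moreover have "cf_lim (\<lambda>i. digits_of b (i + offset t))
      = cf_tail (map (\<lambda>i. digits_of b (i + offset t)) [0..<length (b t)])
        (cf_lim (\<lambda>i. digits_of b (i + length (b t) + offset t)))"
    by (rule cf_lim_split) (rule digits_pos)
  ultimately show ?thesis unfolding tail_point_def by (simp only:)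
qed

lemma tail_point_01: "0 < tail_point b t" "tail_point b t < 1"
  unfolding tail_point_def using cf_lim_step(1,2)[of "\<lambda>i. digits_of b (i + offset t)"] digits_pos by auto

lemma tail_point_range:
  "A t = 0 \<Longrightarrow> 1 / (real B + 1) \<le> tail_point b t" "A t \<noteq> 0 \<Longrightarrow> tail_point b t \<le> 1 / 2"
proof -
  define a where "a = digits_of b (offset t)"
  define y where "y = cf_lim (\<lambda>i. digits_of b (Suc i + offset t))"
  have eq: "tail_point b t = 1 / (real a + y)"
    unfolding tail_point_def a_def y_def
    using cf_lim_step(3)[of "\<lambda>i. digits_of b (i + offset t)"] digits_pos by simp
  have y: "0 < y" "y < 1"
    unfolding y_def using cf_lim_step(1,2)[of "\<lambda>i. digits_of b (Suc i + offset t)"] digits_pos by auto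
  have a: "a = b t ! 0" using digits_step[of 0 t] choices_pos(2)[OF bt, of t] by (simp add: a_def)
  have a1: "1 \<le> a" using digits_pos by (simp add: a_def)
  show "1 / (real B + 1) \<le> tail_point b t" if "A t = 0"
  proof -
    have "a \<in> set (b t)" unfolding a using choices_pos(2)[OF bt, of t] by (intro nth_mem) simp
    then have "a \<le> B" using bt[of t] that by (auto simp: choices_def blocks_def)
    then show ?thesis unfolding eq using y a1 by (intro divide_left_mono mult_pos_pos) auto
  qed
  show "tail_point b t \<le> 1 / 2" if "A t \<noteq> 0"
  proof -
    have "A t \<le> a" using bt[of t] that unfolding a by (auto simp: choices_def)
    then have "2 \<le> a" using A2[OF that] by simp
    then show ?thesis unfolding eq using y by (intro divide_left_mono mult_pos_pos) auto
  qed
qed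

end

section \<open>Separation of points on different branches\<close>

definition \<delta> :: real where "\<delta> = 1 / (real B + 1)"

lemma \<delta>: "0 < \<delta>" "\<delta> \<le> 1 / 3"
  using B by (auto simp: \<delta>_def field_simps)

text \<open>Tails of one step share an interval shorter than 1: a first digit at most B keeps them
  above \<delta>, a large first digit keeps them at most 1/2. Without this gap, adjacent digits
  could give arbitrarily close points.\<close>

lemma tail_gap:
  assumes "b \<in> paths" "b' \<in> paths"
  shows "\<bar>tail_point b t - tail_point b' t\<bar> \<le> 1 - \<delta>"
proof (cases "A t = 0")
  case True
  then show ?thesis
    using tail_point_range(1)[OF assms(1) True] tail_point_range(1)[OF assms(2) True]
      tail_point_01[OF assms(1), of t] tail_point_01[OF assms(2), of t]
    by (auto simp: \<delta>_def abs_le_iff)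
next
  case False
  then show ?thesis
    using tail_point_range(2)[OF assms(1) False] tail_point_range(2)[OF assms(2) False]
      tail_point_01[OF assms(1), of t] tail_point_01[OF assms(2), of t] \<delta>
    by (simp add: abs_le_iff)
qed

text \<open>At the first differing digit the digits are 1 apart and the tails at most 1 - \<delta>,
  which leaves \<delta>. Passing each digit, including that one, multiplies differences by at least
  \<delta>^2.\<close>

lemma block_separation:
  assumes "set c \<subseteq> {1..B}" "set c' \<subseteq> {1..B}" "length c = length c'" "c \<noteq> c'"
    and y: "0 \<le> y" "y \<le> 1" "0 \<le> y'" "y' \<le> 1" "\<bar>y - y'\<bar> \<le> 1 - \<delta>"
  shows "\<delta> ^ (2 * length c + 1) \<le> \<bar>cf_tail c y - cf_tail c' y'\<bar>"
  using assms(3,1,2,4)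
proof (induction c c' rule: list_induct2)
  case (Cons a c a' c')
  define v v' where "v = cf_tail c y" and "v' = cf_tail c' y'"
  have B1: "0 < real B + 1" by simp
  have digit: "1 \<le> real a" "real a \<le> real B" "1 \<le> real a'" "real a' \<le> real B"
    using Cons.prems by auto
  have pos: "pos_word c" "pos_word c'" using Cons.prems by auto
  have v: "0 \<le> v" "v \<le> 1" "0 \<le> v'" "v' \<le> 1"
    using cf_tail_range[OF pos(1), of y] cf_tail_range[OF pos(2), of y'] y by (auto simp: v_def v'_def)
  have prod: "(real a + v) * (real a' + v') \<le> (real B + 1) * (real B + 1)"
    using digit v by (intro mult_mono) auto
  have prod_pos: "0 < (real a + v) * (real a' + v')" using digit v by (intro mult_pos_pos) auto
  have diff: "\<bar>cf_tail (a # c) y - cf_tail (a' # c') y'\<bar>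
      = \<bar>(real a' - real a) + (v' - v)\<bar> / ((real a + v) * (real a' + v'))"
    using digit v by (simp add: v_def v'_def diff_frac_eq abs_mult algebra_simps)
  have scale: "\<delta>\<^sup>2 * \<bar>(real a' - real a) + (v' - v)\<bar> \<le> \<bar>cf_tail (a # c) y - cf_tail (a' # c') y'\<bar>"
  proof -
    have "\<bar>(real a' - real a) + (v' - v)\<bar> / ((real B + 1) * (real B + 1))
        \<le> \<bar>(real a' - real a) + (v' - v)\<bar> / ((real a + v) * (real a' + v'))"
      using prod prod_pos by (intro frac_le) auto
    then show ?thesis unfolding diff by (simp add: \<delta>_def power2_eq_square)
  qed
  show ?case
  proof (cases "a = a'")
    case True
    then have "\<delta> ^ (2 * length c + 1) \<le> \<bar>v - v'\<bar>" unfolding v_def v'_def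
      using Cons.prems by (intro Cons.IH) auto
    then have "\<delta>\<^sup>2 * \<delta> ^ (2 * length c + 1) \<le> \<delta>\<^sup>2 * \<bar>v - v'\<bar>" by (intro mult_left_mono) auto
    then show ?thesis using scale True by (simp add: abs_minus_commute power_add power2_eq_square mult_ac)
  next
    case False
    have "\<bar>v - v'\<bar> \<le> 1 - \<delta>"
    proof (cases c)
      case Nil
      then show ?thesis using y Cons.hyps by (simp add: v_def v'_def)
    next
      case (Cons e ds)
      have in_range: "1 / (real B + 1) \<le> cf_tail (e # ds) y" if "set (e # ds) \<subseteq> {1..B}" "0 \<le> y" "y \<le> 1" for e ds y
      proof -
        have "pos_word ds" "1 \<le> real e" "real e \<le> real B" using that by auto
        then show ?thesis using cf_tail_range[of ds y] that by (auto intro!: frac_le)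
      qed
      obtain e' ds' where "c' = e' # ds'" using Cons Cons.hyps by (cases c') auto
      then have "\<delta> \<le> v" "\<delta> \<le> v'"
        using in_range[of e ds y] in_range[of e' ds' y'] y Cons.prems Cons by (auto simp: v_def v'_def \<delta>_def)
      then show ?thesis using v by (simp add: abs_le_iff)
    qed
    moreover have "1 \<le> \<bar>real a' - real a\<bar>" using False by linarith
    ultimately have "\<delta> \<le> \<bar>(real a' - real a) + (v' - v)\<bar>" by linarith
    then have "\<delta>\<^sup>2 * \<delta> \<le> \<delta>\<^sup>2 * \<bar>(real a' - real a) + (v' - v)\<bar>" by (intro mult_left_mono) auto
    moreover have "\<delta> ^ (2 * length (a # c) + 1) \<le> \<delta> ^ 3" using \<delta> by (intro power_decreasing) auto
    ultimately show ?thesis using scale by (simp add: power2_eq_square power3_eq_cube)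
  qed
qed simp

text \<open>For h = a' - a \<ge> 1 one has h - (1 - \<delta>) \<ge> \<delta> h, so the gap between
  tails costs only a constant factor; both denominators are at most 2 m.\<close>

lemma digit_separation:
  assumes "m \<le> a" "a < 2 * m" "m \<le> a'" "a' < 2 * m" "a < a'"
    and y: "0 \<le> y" "y \<le> 1" "0 \<le> y'" "y' \<le> 1" "\<bar>y - y'\<bar> \<le> 1 - \<delta>"
  shows "\<delta> * (real a' - real a) / (4 * (real m)\<^sup>2) \<le> \<bar>cf_tail [a] y - cf_tail [a'] y'\<bar>"
proof -
  have pos: "0 < real a" "0 < real a'" using assms by auto
  have ub: "real a + y \<le> 2 * real m" "real a' + y' \<le> 2 * real m" using assms by linarith+
  have h: "1 \<le> real a' - real a" using assms(5) by linarith
  have "\<delta> * (real a' - real a) \<le> (real a' - real a) - (1 - \<delta>)"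
    using mult_right_mono[OF h, of "1 - \<delta>"] \<delta> by (simp add: algebra_simps)
  also have "\<dots> \<le> \<bar>(real a' - real a) + (y' - y)\<bar>" using y(5) h by linarith
  finally have 1: "\<delta> * (real a' - real a) \<le> \<bar>(real a' - real a) + (y' - y)\<bar>" .
  have "(real a + y) * (real a' + y') \<le> (2 * real m) * (2 * real m)"
    using ub pos y by (intro mult_mono) auto
  then have 2: "(real a + y) * (real a' + y') \<le> 4 * (real m)\<^sup>2" by (simp add: power2_eq_square)
  have 3: "0 < (real a + y) * (real a' + y')" using pos y by (intro mult_pos_pos) auto
  have "\<delta> * (real a' - real a) / (4 * (real m)\<^sup>2)
      \<le> \<bar>(real a' - real a) + (y' - y)\<bar> / ((real a + y) * (real a' + y'))"
    using 1 2 3 by (intro frac_le) auto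
  also have "\<dots> = \<bar>cf_tail [a] y - cf_tail [a'] y'\<bar>"
    using pos y by (simp add: diff_frac_eq abs_mult algebra_simps)
  finally show ?thesis .
qed

lemma point_separation:
  assumes "b \<in> paths" "b1 \<in> paths" "b2 \<in> paths" "\<forall>s<t. b s = b1 s" "\<forall>s<t. b s = b2 s"
  shows "\<bar>cf_tail (b1 t) (tail_point b1 (Suc t)) - cf_tail (b2 t) (tail_point b2 (Suc t))\<bar>
    / (4 * (cf_den (concat_upto b t) 0)\<^sup>2) \<le> dist (point b1) (point b2)"
proof -
  have "concat_upto b1 t = concat_upto b t" "concat_upto b2 t = concat_upto b t"
    using assms(4,5) by (auto intro!: arg_cong[of _ _ concat])
  then have "point b1 = cf_tail (concat_upto b t) (tail_point b1 t)"
    "point b2 = cf_tail (concat_upto b t) (tail_point b2 t)"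
    using point_split[OF assms(2), of t] point_split[OF assms(3), of t] by (simp_all only:)
  then show ?thesis
    using cf_tail_dist_ge[OF pos_concat_upto[OF assms(1)], of "tail_point b1 t" "tail_point b2 t" t]
      tail_point_01[OF assms(2), of t] tail_point_01[OF assms(3), of t]
    by (simp add: dist_real_def flip: tail_point_split[OF assms(2)] tail_point_split[OF assms(3)])
qed

lemma point_shrink:
  assumes "0 < e"
  shows "\<exists>t. \<forall>b\<in>paths. \<forall>b'\<in>paths. (\<forall>s<t. b s = b' s) \<longrightarrow> dist (point b) (point b') < e"
proof -
  obtain k where k: "(1 / 4 :: real) ^ k < e" using real_arch_pow_inv[OF assms, of "1 / 4"] by auto
  have "dist (point b) (point b') < e" if b: "b \<in> paths" "b' \<in> paths" and eq: "\<forall>s<2 * k. b s = b' s" for b b'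
  proof -
    have "concat_upto b' (2 * k) = concat_upto b (2 * k)"
      using eq by (auto intro!: arg_cong[of _ _ concat])
    then have "dist (point b) (point b')
        = \<bar>cf_tail (concat_upto b (2 * k)) (tail_point b (2 * k)) - cf_tail (concat_upto b (2 * k)) (tail_point b' (2 * k))\<bar>"
      using point_split[OF b(1), of "2 * k"] point_split[OF b(2), of "2 * k"] by (simp only: dist_real_def)
    also have "\<dots> \<le> (1 / 4) ^ (length (concat_upto b (2 * k)) div 2)"
      using tail_point_01[OF b(1), of "2 * k"] tail_point_01[OF b(2), of "2 * k"]
      by (intro cf_tail_diff pos_concat_upto[OF b(1)]) auto
    also have "\<dots> \<le> (1 / 4) ^ k"
      using offset_ge[OF b(1), of "2 * k"] unfolding length_concat_upto[OF b(1)] by (intro power_decreasing) auto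
    finally show ?thesis using k by simp
  qed
  then show ?thesis by blast
qed

section \<open>Mass of branches against diameter\<close>

context
  fixes \<theta> :: real
  assumes \<theta>: "1 / 2 < \<theta>" "\<theta> < 1"
begin

definition U :: real where "U = (\<Sum>c\<in>blocks. wt \<theta> c)"

text \<open>Blocks are chosen in proportion to q^(-2 \<theta>), large digits uniformly, since all
  digits between A and 2 A have comparable weights.\<close>

definition mass :: "nat \<Rightarrow> nat list \<Rightarrow> real" where
  "mass t c = (if A t = 0 then wt \<theta> c / U else 1 / real (A t))"

text \<open>A bound for the gain of mass relative to weight in one step, including the concatenation
  factor \<open>4 powr \<theta>\<close>. A large digit gives at most 4^\<theta> (2 A)^(2 \<theta>) /
  A, and 16 bounds 4^\<theta> 4^\<theta> because \<theta> < 1.\<close>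

definition growth :: "nat \<Rightarrow> real" where
  "growth t = (if A t = 0 then 4 powr \<theta> / U else 16 * real (A t) powr (2 * \<theta> - 1))"

lemma U_pos: "0 < U"
proof -
  have "finite blocks" unfolding blocks_def by (auto intro: finite_lists_length_eq)
  moreover have "replicate l 1 \<in> blocks" using B by (auto simp: blocks_def)
  moreover from this have "0 < wt \<theta> (replicate l 1)" by (intro wt_pos) auto
  ultimately show ?thesis unfolding U_def by (intro sum_pos2) auto
qed

lemma mass_sum: "(\<Sum>c\<in>choices t. mass t c) = 1"
proof (cases "A t = 0")
  case True
  then show ?thesis using U_pos by (simp add: choices_def mass_def U_def flip: sum_divide_distrib)
next
  case False
  then show ?thesis by (simp add: choices_def mass_def card_image inj_on_def)
qed

lemma mass_nonneg: "0 \<le> mass t c"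
  using U_pos by (simp add: mass_def)

lemma mass_le:
  assumes "b \<in> paths"
  shows "(\<Prod>s<t. mass s (b s)) \<le> wt \<theta> (concat_upto b t) * (\<Prod>s<t. growth s)"
proof (induction t)
  case (Suc t)
  have growth_nonneg: "0 \<le> growth s" for s using U_pos by (simp add: growth_def)
  have step: "mass t (b t) \<le> wt \<theta> (b t) * growth t / 4 powr \<theta>"
  proof (cases "A t = 0")
    case True
    then show ?thesis by (simp add: mass_def growth_def)
  next
    case False
    then obtain a where a: "b t = [a]" "A t \<le> a" "a < 2 * A t" using bt[OF assms, of t] by (auto simp: choices_def)
    have A: "0 < real (A t)" "real (A t) \<le> real a" "real a \<le> 2 * real (A t)" using a False by auto
    have pw: "(2 * real (A t)) powr (2 * \<theta>) = 4 powr \<theta> * real (A t) powr (2 * \<theta>)"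
    proof -
      have "(2::real) powr (2 * \<theta>) = (2 powr 2) powr \<theta>" by (simp only: powr_powr)
      then show ?thesis by (simp add: powr_mult)
    qed
    have "4 powr \<theta> \<le> (4::real) powr 1" using \<theta> by (intro powr_mono) auto
    then have 4: "4 powr \<theta> * 4 powr \<theta> \<le> (16::real)" using mult_mono[of "4 powr \<theta>" 4 "4 powr \<theta>" "4::real"] by simp
    have "4 powr \<theta> * 1 = 4 powr \<theta> * (wt \<theta> [a] * real a powr (2 * \<theta>))"
      using A by (simp add: wt_single flip: powr_add)
    also have "\<dots> \<le> 4 powr \<theta> * (wt \<theta> [a] * (2 * real (A t)) powr (2 * \<theta>))"
      using A \<theta> by (intro mult_left_mono powr_mono2) auto
    also have "\<dots> = (4 powr \<theta> * 4 powr \<theta>) * (wt \<theta> [a] * real (A t) powr (2 * \<theta>))" unfolding pw by simp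
    also have "\<dots> \<le> 16 * (wt \<theta> [a] * real (A t) powr (2 * \<theta>))"
      using 4 by (intro mult_right_mono) auto
    also have "\<dots> = wt \<theta> [a] * growth t * real (A t)"
      using False A by (simp add: growth_def powr_diff)
    finally show ?thesis using False A by (simp add: mass_def a(1) field_simps)
  qed
  have "(\<Prod>s<Suc t. mass s (b s)) \<le> (wt \<theta> (concat_upto b t) * (\<Prod>s<t. growth s)) * (wt \<theta> (b t) * growth t / 4 powr \<theta>)"
    unfolding prod.lessThan_Suc
    using growth_nonneg mass_nonneg by (intro mult_mono Suc step mult_nonneg_nonneg prod_nonneg) auto
  also have "\<dots> = (wt \<theta> (concat_upto b t) * wt \<theta> (b t)) * ((\<Prod>s<Suc t. growth s) / 4 powr \<theta>)" by simp
  also have "\<dots> \<le> (4 powr \<theta> * wt \<theta> (concat_upto b t @ b t)) * ((\<Prod>s<Suc t. growth s) / 4 powr \<theta>)"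
    using \<theta> growth_nonneg choices_pos(1)[OF bt[OF assms]] pos_concat_upto[OF assms, of t]
    by (intro mult_right_mono wt_append_ge) (auto intro!: divide_nonneg_nonneg prod_nonneg mult_nonneg_nonneg)
  finally show ?case by simp
qed (simp add: wt_def)

text \<open>The extra factor A^\<theta> pays for sets meeting only some branches of a large digit.
  If the extreme digits are h apart, the diameter is at least a constant times h / (A q)^2, while
  the branch mass is only bounded by 2 h / A.\<close>

theorem sparse_digits_positive_measure:
  assumes C0: "\<And>t. (\<Prod>s<t. growth s) * (if A t = 0 then 1 else real (A t) powr \<theta>) \<le> C0"
    and E: "\<And>b. b \<in> paths \<Longrightarrow> point b \<in> E"
  shows "hausdorff_measure \<theta> E \<noteq> 0"
proof (rule mass_distribution[where W = choices and \<pi> = point and p = mass])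
  \<comment> \<open>A common separation constant: 1/4 is the distortion in
    \<open>cf_tail_dist_ge\<close>, and large digits bring another 1/4 from
    \<open>digit_separation\<close>.\<close>
  define \<kappa> where "\<kappa> = \<delta> ^ (2 * l + 1) / 16"
  have \<kappa>: "0 < \<kappa>" "\<kappa> \<le> \<delta> ^ (2 * l + 1) / 4" "\<kappa> \<le> \<delta> / 16"
    using \<delta> power_decreasing[of 1 "2 * l + 1" \<delta>] by (auto simp: \<kappa>_def)
  fix b t H V
  assume b: "b \<in> paths" and H: "H \<subseteq> choices t" "\<exists>c\<in>H. \<exists>c'\<in>H. c \<noteq> c'" and V: "bounded V"
    and hit: "\<And>c. c \<in> H \<Longrightarrow> \<exists>b'\<in>paths. (\<forall>s<t. b s = b' s) \<and> b' t = c \<and> point b' \<in> V"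
  define q where "q = cf_den (concat_upto b t) 0"
  have q: "1 \<le> q" unfolding q_def by (rule cf_den_bounds(1)[OF pos_concat_upto[OF b]])
  define w where "w = wt \<theta> (concat_upto b t)"
  have w: "0 \<le> w" "w = (1 / q\<^sup>2) powr \<theta>"
    using q by (simp_all add: w_def wt_def q_def powr_divide powr_minus powr_powr inverse_eq_divide flip: powr_numeral)
  define G where "G = (\<Prod>s<t. growth s)"
  have G: "0 \<le> G" using U_pos by (auto simp: G_def growth_def intro!: prod_nonneg)
  have C0nn: "0 \<le> C0" using C0[of 0] by (auto simp: split: if_splits intro: order_trans[OF powr_ge_zero])
  have sep: "\<exists>y y'. 0 \<le> y \<and> y \<le> 1 \<and> 0 \<le> y' \<and> y' \<le> 1 \<and> \<bar>y - y'\<bar> \<le> 1 - \<delta> \<and>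
      \<bar>cf_tail c y - cf_tail c' y'\<bar> / (4 * q\<^sup>2) \<le> diameter V" if c: "c \<in> H" "c' \<in> H" for c c'
  proof -
    obtain b1 b2 where b1: "b1 \<in> paths" "\<forall>s<t. b s = b1 s" "b1 t = c" "point b1 \<in> V"
      and b2: "b2 \<in> paths" "\<forall>s<t. b s = b2 s" "b2 t = c'" "point b2 \<in> V" using hit[OF c(1)] hit[OF c(2)] by blast
    have "dist (point b1) (point b2) \<le> diameter V" using V b1 b2 by (intro diameter_bounded_bound) auto
    then have "\<bar>cf_tail c (tail_point b1 (Suc t)) - cf_tail c' (tail_point b2 (Suc t))\<bar> / (4 * q\<^sup>2) \<le> diameter V"
      using point_separation[OF b b1(1) b2(1) b1(2) b2(2)] b1(3) b2(3) unfolding q_def by simp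
    then show ?thesis
      using tail_gap[OF b1(1) b2(1), of "Suc t"] tail_point_01[OF b1(1), of "Suc t"] tail_point_01[OF b2(1), of "Suc t"]
      by (intro exI[of _ "tail_point b1 (Suc t)"] exI[of _ "tail_point b2 (Suc t)"]) auto
  qed
  have total: "(\<Prod>s<t. mass s (b s)) \<le> w * G" unfolding w_def G_def by (rule mass_le[OF b])
  have total0: "0 \<le> (\<Prod>s<t. mass s (b s))" using mass_nonneg by (intro prod_nonneg) auto
  have Hsum: "0 \<le> (\<Sum>c\<in>H. mass t c)" using mass_nonneg by (intro sum_nonneg) auto
  show "(\<Prod>s<t. mass s (b s)) * (\<Sum>c\<in>H. mass t c) \<le> 2 * C0 * \<kappa> powr (- \<theta>) * diameter V powr \<theta>"
  proof (cases "A t = 0")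
    case True
    obtain c c' where c: "c \<in> H" "c' \<in> H" "c \<noteq> c'" using H(2) by blast
    then have cb: "set c \<subseteq> {1..B}" "set c' \<subseteq> {1..B}" "length c = l" "length c' = l"
      using H(1) True by (auto simp: choices_def blocks_def)
    obtain y y' where y: "0 \<le> y" "y \<le> 1" "0 \<le> y'" "y' \<le> 1" "\<bar>y - y'\<bar> \<le> 1 - \<delta>"
      "\<bar>cf_tail c y - cf_tail c' y'\<bar> / (4 * q\<^sup>2) \<le> diameter V" using sep[OF c(1,2)] by blast
    have "\<kappa> * (1 / q\<^sup>2) \<le> \<delta> ^ (2 * l + 1) / 4 * (1 / q\<^sup>2)" using \<kappa>(2) by (intro mult_right_mono) auto
    also have "\<dots> = \<delta> ^ (2 * length c + 1) / (4 * q\<^sup>2)" using cb by simp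
    also have "\<dots> \<le> \<bar>cf_tail c y - cf_tail c' y'\<bar> / (4 * q\<^sup>2)"
      using block_separation[of c c' y y'] cb c y by (intro divide_right_mono) auto
    also have "\<dots> \<le> diameter V" by (rule y)
    finally have "(\<kappa> * (1 / q\<^sup>2)) powr \<theta> \<le> diameter V powr \<theta>"
      using \<theta> \<kappa> by (intro powr_mono2) auto
    then have "\<kappa> powr \<theta> * w \<le> diameter V powr \<theta>" unfolding w(2) powr_mult .
    then have w': "w \<le> \<kappa> powr (- \<theta>) * diameter V powr \<theta>" using \<kappa> by (simp add: powr_minus field_simps)
    have GC: "G \<le> C0" using C0[of t] True by (simp add: G_def)
    have "(\<Sum>c\<in>H. mass t c) \<le> 1"
      unfolding mass_sum[of t, symmetric] using H finite_choices mass_nonneg by (intro sum_mono2) auto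
    then have "(\<Prod>s<t. mass s (b s)) * (\<Sum>c\<in>H. mass t c) \<le> (w * G) * 1"
      using total total0 Hsum w G by (intro mult_mono) auto
    also have "\<dots> \<le> (\<kappa> powr (- \<theta>) * diameter V powr \<theta>) * C0" unfolding mult_1_right
      using w' GC w G by (intro mult_mono) auto
    also have "\<dots> \<le> 2 * C0 * \<kappa> powr (- \<theta>) * diameter V powr \<theta>"
      using C0nn by (simp add: mult_ac)
    finally show ?thesis .
  next
    case False
    define S where "S = hd ` H"
    have HS: "H = (\<lambda>a. [a]) ` S" "S \<subseteq> {A t..<2 * A t}"
      using H(1) False by (force simp: S_def choices_def image_iff)+
    have S: "finite S" "S \<noteq> {}" using finite_subset[OF HS(2)] H(2) by (auto simp: S_def)
    \<comment> \<open>The two extreme digits bound the diameter from below and the number of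
      branches from above, by h + 1 \<le> 2 h.\<close>
    define a a' where "a = Min S" and "a' = Max S"
    have aS: "a \<in> S" "a' \<in> S" using S by (auto simp: a_def a'_def)
    have range: "S \<subseteq> {a..a'}" using S by (auto simp: a_def a'_def)
    have lt: "a < a'"
    proof (rule ccontr)
      assume "\<not> a < a'"
      then have "S \<subseteq> {a}" using range by auto
      then show False using H(2) unfolding HS(1) by auto
    qed
    define h where "h = real a' - real a"
    have h: "1 \<le> h" using lt by (simp add: h_def)
    have A: "0 < real (A t)" using False by simp
    have "A t \<le> a" "a' < 2 * A t" using aS HS(2) by auto
    then have hA: "h \<le> real (A t)" unfolding h_def by linarith
    obtain y y' where y: "0 \<le> y" "y \<le> 1" "0 \<le> y'" "y' \<le> 1" "\<bar>y - y'\<bar> \<le> 1 - \<delta>"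
      "\<bar>cf_tail [a] y - cf_tail [a'] y'\<bar> / (4 * q\<^sup>2) \<le> diameter V"
      using sep[of "[a]" "[a']"] aS HS(1) by blast
    have "\<kappa> * (h / (real (A t))\<^sup>2 * (1 / q\<^sup>2)) \<le> \<delta> / 16 * (h / (real (A t))\<^sup>2 * (1 / q\<^sup>2))"
      using \<kappa>(3) h by (intro mult_right_mono) auto
    also have "\<dots> = \<delta> * h / (4 * (real (A t))\<^sup>2) / (4 * q\<^sup>2)" by simp
    also have "\<dots> \<le> \<bar>cf_tail [a] y - cf_tail [a'] y'\<bar> / (4 * q\<^sup>2)"
      unfolding h_def using aS HS(2) lt y by (intro divide_right_mono digit_separation) auto
    also have "\<dots> \<le> diameter V" by (rule y)
    finally have "(\<kappa> * (h / (real (A t))\<^sup>2 * (1 / q\<^sup>2))) powr \<theta> \<le> diameter V powr \<theta>"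
      using \<theta> \<kappa> h by (intro powr_mono2) auto
    then have "\<kappa> powr \<theta> * ((h / (real (A t))\<^sup>2) powr \<theta> * w) \<le> diameter V powr \<theta>"
      unfolding w(2) powr_mult .
    then have w': "w * (h / (real (A t))\<^sup>2) powr \<theta> \<le> \<kappa> powr (- \<theta>) * diameter V powr \<theta>"
      using \<kappa> by (simp add: powr_minus field_simps)
    have "(\<Sum>c\<in>H. mass t c) = real (card S) / real (A t)"
      unfolding HS(1) using False by (simp add: mass_def card_image inj_on_def)
    also have "real (card S) \<le> real (card {a..a'})" using card_mono[OF _ range] by simp
    also have "\<dots> \<le> 2 * h" using h lt by (simp add: h_def of_nat_diff)
    finally have Hm: "(\<Sum>c\<in>H. mass t c) \<le> 2 * h / real (A t)" using A by (simp add: divide_right_mono)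
    \<comment> \<open>h / A \<le> 1 and \<theta> < 1 give h / A \<le> (h / A)^\<theta>, which
      exhibits the missing factor A^\<theta>.\<close>
    have key: "h / real (A t) \<le> real (A t) powr \<theta> * (h / (real (A t))\<^sup>2) powr \<theta>"
    proof -
      have "(h / real (A t)) powr 1 \<le> (h / real (A t)) powr \<theta>"
        using \<theta> h hA A by (intro powr_mono') auto
      also have "h / real (A t) = real (A t) * (h / (real (A t))\<^sup>2)" using A by (simp add: power2_eq_square)
      also have "(\<dots>) powr \<theta> = real (A t) powr \<theta> * (h / (real (A t))\<^sup>2) powr \<theta>" by (rule powr_mult)
      finally show ?thesis using h A by (simp add: power2_eq_square)
    qed
    have "(\<Prod>s<t. mass s (b s)) * (\<Sum>c\<in>H. mass t c) \<le> (w * G) * (2 * h / real (A t))"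
      using total total0 Hsum Hm w G h by (intro mult_mono) auto
    also have "\<dots> = 2 * (w * G) * (h / real (A t))" by simp
    also have "\<dots> \<le> 2 * (w * G) * (real (A t) powr \<theta> * (h / (real (A t))\<^sup>2) powr \<theta>)"
      using key w G by (intro mult_left_mono) auto
    also have "\<dots> = 2 * (G * real (A t) powr \<theta>) * (w * (h / (real (A t))\<^sup>2) powr \<theta>)" by (simp add: mult_ac)
    also have "\<dots> \<le> 2 * C0 * (\<kappa> powr (- \<theta>) * diameter V powr \<theta>)"
    proof (rule mult_mono)
      show "2 * (G * real (A t) powr \<theta>) \<le> 2 * C0" using C0[of t] False by (simp add: G_def)
    qed (use w' w(1) C0nn in auto)
    finally show ?thesis by (simp add: mult_ac)
  qed
qed (use \<theta> E finite_choices two_choices mass_sum mass_nonneg point_shrink in auto)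

end

end

section \<open>Choice of positions and sizes of the large digits\<close>

text \<open>Up to the k-th large digit the blocks contribute exp (-l p x k), and the earlier digits,
  whose exponents form a geometric series, exp (l t (2 \<theta> - 1) x k / (\<Lambda> - 1)). The
  factor A^\<theta> adds exp (l t \<theta> x k). The hypothesis leaves room for a p that makes the
  total exponent negative.\<close>

theorem prescribed_growth_positive_measure:
  fixes \<theta> \<Lambda> t :: real
  assumes \<theta>: "1 / 2 < \<theta>" "\<theta> < 1" and \<Lambda>: "1 < \<Lambda>" and t: "0 < t"
    and P: "t * ((2 * \<theta> - 1) / (\<Lambda> - 1) + \<theta>) < pressure \<theta>"
  shows "hausdorff_measure \<theta> {x \<in> unit_irrationals.
    limsup (log_rate x) = ereal t \<and>
    liminf (log_rate x) = ereal (t / \<Lambda>)} \<noteq> 0"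
proof -
  define c0 where "c0 = 2 * \<theta> - 1"
  have c0: "0 < c0" using \<theta> by (simp add: c0_def)
  obtain p where p: "t * (c0 / (\<Lambda> - 1) + \<theta>) < p" "p < pressure \<theta>" using dense[OF P] by (auto simp: c0_def)
  have "0 < t * (c0 / (\<Lambda> - 1) + \<theta>)" using t c0 \<Lambda> \<theta> by (intro mult_pos_pos add_pos_pos divide_pos_pos) auto
  then have p0: "0 < p" using p by simp
  \<comment> \<open>The margin between p and the pressure, accumulated over a long block, outweighs
    the factor \<open>4 powr \<theta>\<close> lost at its end.\<close>
  obtain l' :: nat where l': "\<theta> * ln 4 < real l' * (pressure \<theta> - p)" using reals_Archimedean3[of "pressure \<theta> - p"] p by auto
  define l where "l = max 1 l'"
  have l: "1 \<le> l" by (simp add: l_def)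
  have "real l' * (pressure \<theta> - p) \<le> real l * (pressure \<theta> - p)" using p by (intro mult_right_mono) (auto simp: l_def)
  then have "\<theta> * ln 4 + real l * p < real l * pressure \<theta>" using l' by (simp add: algebra_simps)
  then have "exp (\<theta> * ln 4 + real l * p) < exp (real l * pressure \<theta>)" by simp
  then have "4 powr \<theta> * exp (real l * p) < exp (real l * pressure \<theta>)" by (simp add: exp_add powr_def)
  also have "\<dots> \<le> part_sum \<theta> l" by (rule pressure_props(2)[OF \<theta>(1)])
  finally have big: "4 powr \<theta> * exp (real l * p) < part_sum \<theta> l" .
  \<comment> \<open>Finitely many words already exceed the required sum; this provides the digit
    bound B.\<close>
  obtain F where F: "finite F" "F \<subseteq> words l" "4 powr \<theta> * exp (real l * p) < sum (wt \<theta>) F"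
  proof (rule ccontr)
    assume "\<not> thesis"
    then have "sums_bounded (wt \<theta>) (words l) (4 powr \<theta> * exp (real l * p))"
      using that by (intro sums_boundedI) force
    then show False using part_sum_le[OF \<theta>(1)] big by force
  qed
  have "finite (\<Union>c\<in>F. set c)" using F by auto
  then obtain B' where B': "\<forall>n\<in>(\<Union>c\<in>F. set c). n < B'" using finite_nat_set_iff_bounded by auto
  define B where "B = max 2 B'"
  have B: "2 \<le> B" by (simp add: B_def)
  have FB: "F \<subseteq> {c. set c \<subseteq> {1..B} \<and> length c = l}"
  proof
    fix c assume c: "c \<in> F"
    have "a \<in> {1..B}" if "a \<in> set c" for a
      using c that B' F(2) by (fastforce simp: words_def B_def)
    moreover have "length c = l" using c F(2) by (auto simp: words_def)
    ultimately show "c \<in> {c. set c \<subseteq> {1..B} \<and> length c = l}" by blast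
  qed
  \<comment> \<open>Starting late makes consecutive x k at least 3 apart, so that after rounding a
    block step separates any two large digits.\<close>
  obtain k0 where k0: "3 / (\<Lambda> - 1) < \<Lambda> ^ k0" using real_arch_pow[OF \<Lambda>] by blast
  define x where "x k = \<Lambda> ^ (k + k0)" for k
  have xSuc: "x (Suc k) = \<Lambda> * x k" for k by (simp add: x_def)
  have x1: "1 \<le> x k" for k using \<Lambda> by (simp add: x_def)
  have xgap: "x k + 3 \<le> x (Suc k)" for k
  proof -
    have "3 / (\<Lambda> - 1) < \<Lambda> ^ (k + k0)"
    proof (rule less_le_trans[OF k0])
      show "\<Lambda> ^ k0 \<le> \<Lambda> ^ (k + k0)" using \<Lambda> by (intro power_increasing) auto
    qed
    then have "3 < x k * (\<Lambda> - 1)" using \<Lambda> by (simp add: x_def pos_divide_less_eq)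
    then show ?thesis by (simp add: xSuc algebra_simps)
  qed
  define T where "T k = nat \<lceil>x k\<rceil>" for k
  have T: "x k \<le> real (T k)" "real (T k) < x k + 1" for k using x1[of k] by (auto simp: T_def) linarith+
  have Tgap: "T k + 2 \<le> T (Suc k)" for k
  proof -
    have "real (T k + 2) \<le> real (T (Suc k))" using T(2)[of k] T(1)[of "Suc k"] xgap[of k] by simp
    then show ?thesis by (simp only: of_nat_le_iff)
  qed
  have Tmono: "strict_mono T" unfolding strict_mono_Suc_iff
  proof
    fix k show "T k < T (Suc k)" using Tgap[of k] by simp
  qed
  \<comment> \<open>The added 1 ensures a k \<ge> 2; as the exponential is at least 1, rounding up
    and adding 1 stays within a factor 3.\<close>
  define a where "a k = nat \<lceil>exp (t * real l * x k)\<rceil> + 1" for k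
  have a: "exp (t * real l * x k) \<le> real (a k)" "real (a k) \<le> 3 * exp (t * real l * x k)" "2 \<le> a k" for k
  proof -
    have "0 \<le> t * real l * x k" using t x1[of k] by (intro mult_nonneg_nonneg) auto
    then have e1: "1 \<le> exp (t * real l * x k)" by simp
    have "real (a k) = of_int \<lceil>exp (t * real l * x k)\<rceil> + 1" using e1 by (simp add: a_def)
    then show "exp (t * real l * x k) \<le> real (a k)" "real (a k) \<le> 3 * exp (t * real l * x k)"
      using e1 ceiling_correct[of "exp (t * real l * x k)"] by linarith+
    then show "2 \<le> a k" using e1 unfolding a_def by linarith
  qed
  have amono: "a j \<le> a k" if "j \<le> k" for j k
  proof -
    have "x j \<le> x k" unfolding x_def using \<Lambda> that by (intro power_increasing) auto
    then have "t * real l * x j \<le> t * real l * x k" using t by (intro mult_left_mono) auto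
    then show ?thesis unfolding a_def by (intro add_right_mono nat_mono ceiling_mono) simp
  qed
  define A where "A s = (if s \<in> range T then a (inv T s) else 0)" for s
  have AT: "A (T k) = a k" for k using strict_mono_imp_inj_on[OF Tmono] by (simp add: A_def)
  have Anz: "\<exists>k. s = T k" if "A s \<noteq> 0" for s using that by (auto simp: A_def split: if_splits)
  have between: "A s = 0" if "T k < s" "s < T (Suc k)" for k s
    using that strict_mono_less[OF Tmono] by (auto simp: A_def)
  have below: "A s = 0" if "s < T 0" for s
    using that strict_mono_less[OF Tmono] by (auto simp: A_def)
  interpret sparse_digits B l A
  proof
    show "A s \<noteq> 1" for s
    proof
      assume "A s = 1"
      then obtain k where "s = T k" using Anz[of s] by auto
      then show False using AT[of k] a(3)[of k] \<open>A s = 1\<close> by simp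
    qed
    show "A (Suc s) = 0" if s: "A s \<noteq> 0" for s
    proof -
      obtain k where "s = T k" using Anz[OF s] by blast
      then show ?thesis using Tgap[of k] by (intro between[of k]) auto
    qed
  qed (use B l in auto)
  define r where "r = 4 powr \<theta> / U \<theta>"
  have U: "4 powr \<theta> * exp (real l * p) < U \<theta>"
  proof -
    have "finite blocks" unfolding blocks_def by (auto intro: finite_lists_length_eq)
    then have "sum (wt \<theta>) F \<le> U \<theta>" unfolding U_def[OF \<theta>]
      using FB by (intro sum_mono2) (auto simp: blocks_def)
    then show ?thesis using F(3) by simp
  qed
  have Upos: "0 < U \<theta>" using U_pos[OF \<theta>] .
  have r: "0 \<le> r" "r \<le> exp (- (real l * p))"
  proof -
    show "0 \<le> r" using Upos by (simp add: r_def)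
    have "4 powr \<theta> \<le> exp (- (real l * p)) * U \<theta>"
      using U by (simp add: exp_minus field_simps)
    then show "r \<le> exp (- (real l * p))" using Upos by (simp add: r_def pos_divide_le_eq)
  qed
  have r1: "r \<le> 1" using r(2) p0 by (auto elim: order_trans)
  have growth0: "growth \<theta> s = r" if "A s = 0" for s using that by (simp add: growth_def[OF \<theta>] r_def)
  have growth_nonneg: "0 \<le> growth \<theta> s" for s using r(1) by (simp add: growth_def[OF \<theta>] r_def)
  define M where "M = ln 16 + c0 * ln 3"
  \<comment> \<open>The logarithm of the bound at \<open>T k\<close>: T k - k block steps, k large
    digits with constant M each, and the sum of x j over j < k, which is (x k - x 0) / (\<Lambda> -
    1).\<close>
  define e where "e k = - (real l * p) * (real (T k) - real k) + real k * M + c0 * t * real l * (x k - x 0) / (\<Lambda> - 1)" for k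
  have growthT: "growth \<theta> (T k) \<le> exp (M + c0 * t * real l * x k)" for k
  proof -
    have "real (a k) powr c0 \<le> (3 * exp (t * real l * x k)) powr c0"
      using a(2)[of k] c0 by (intro powr_mono2) auto
    also have "\<dots> = exp (c0 * ln 3 + c0 * t * real l * x k)"
      by (simp add: powr_def ln_mult exp_add algebra_simps)
    finally have "16 * real (a k) powr c0 \<le> 16 * exp (c0 * ln 3 + c0 * t * real l * x k)" by simp
    also have "\<dots> = exp (M + c0 * t * real l * x k)" by (simp add: M_def exp_add)
    finally show ?thesis using a(3)[of k] by (simp add: growth_def[OF \<theta>] AT c0_def)
  qed
  have r_power: "r ^ m \<le> exp (- (real l * p) * real m)" for m
  proof -
    have "r ^ m \<le> exp (- (real l * p)) ^ m" using r by (intro power_mono) auto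
    then show ?thesis by (simp add: mult.commute flip: exp_of_nat_mult)
  qed
  have main: "(\<Prod>s<T k. growth \<theta> s) \<le> exp (e k)" for k
  proof (induction k)
    case 0
    have "(\<Prod>s<T 0. growth \<theta> s) = r ^ T 0" using growth0 below by simp
    then show ?case using r_power[of "T 0"] by (simp add: e_def)
  next
    case (Suc k)
    define m where "m = T (Suc k) - T k - 1"
    have m: "real m = real (T (Suc k)) - real (T k) - 1" using Tgap[of k] by (simp add: m_def of_nat_diff)
    have split: "{..<T (Suc k)} = {..<T k} \<union> ({T k} \<union> {Suc (T k)..<T (Suc k)})" using Tgap[of k] by auto
    have "(\<Prod>s\<in>{Suc (T k)..<T (Suc k)}. growth \<theta> s) = (\<Prod>s\<in>{Suc (T k)..<T (Suc k)}. r)"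
      by (intro prod.cong refl growth0 between[of k]) auto
    then have mid: "(\<Prod>s\<in>{Suc (T k)..<T (Suc k)}. growth \<theta> s) = r ^ m" by (simp add: m_def)
    have "(\<Prod>s<T (Suc k). growth \<theta> s) = (\<Prod>s<T k. growth \<theta> s) * (growth \<theta> (T k) * (\<Prod>s\<in>{Suc (T k)..<T (Suc k)}. growth \<theta> s))"
      unfolding split by (subst prod.union_disjoint, auto)+
    also have "\<dots> \<le> exp (e k) * (exp (M + c0 * t * real l * x k) * exp (- (real l * p) * real m))"
      unfolding mid using Suc growthT[of k] r_power[of m] growth_nonneg r(1)
      by (intro mult_mono mult_nonneg_nonneg) auto
    also have "\<dots> = exp (e k + (M + c0 * t * real l * x k - (real l * p) * real m))" by (simp add: exp_add exp_diff exp_minus field_simps)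
    also have "e k + (M + c0 * t * real l * x k - (real l * p) * real m) = e (Suc k)"
    proof -
      have "(x (Suc k) - x 0) / (\<Lambda> - 1) = (x k - x 0) / (\<Lambda> - 1) + x k"
        using \<Lambda> by (simp add: xSuc field_simps)
      note arg_cong[OF this, of "\<lambda>z. c0 * t * real l * z"]
      then have "c0 * t * real l * (x (Suc k) - x 0) / (\<Lambda> - 1) = c0 * t * real l * (x k - x 0) / (\<Lambda> - 1) + c0 * t * real l * x k"
        unfolding distrib_left times_divide_eq_right .
      then show ?thesis unfolding e_def m by (simp add: algebra_simps)
    qed
    finally show ?case .
  qed
  define \<eta> where "\<eta> = p - t * (c0 / (\<Lambda> - 1) + \<theta>)"
  have \<eta>: "0 < \<eta>" using p by (simp add: \<eta>_def)
  have k_over_x: "(\<lambda>k. real k / x k) \<longlonglongrightarrow> 0"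
  proof -
    have "(\<lambda>k. real k / \<Lambda> ^ k) \<longlonglongrightarrow> 0" using lim_n_over_pown[of \<Lambda>] \<Lambda> by simp
    then have "(\<lambda>k. real k / \<Lambda> ^ k / \<Lambda> ^ k0) \<longlonglongrightarrow> 0 / \<Lambda> ^ k0" using \<Lambda> by (intro tendsto_divide) auto
    then show ?thesis by (simp add: x_def power_add)
  qed
  define N1 where "N1 = real l * p + M"
  \<comment> \<open>Each large digit costs a constant N1, namely M and one omitted block step. This
    linear total is absorbed by the geometric gain l \<eta> x k.\<close>
  obtain C where C: "\<And>k. real k * N1 - real l * \<eta> * x k \<le> C"
  proof -
    have "(\<lambda>k. N1 * (real k / x k)) \<longlonglongrightarrow> N1 * 0" by (intro tendsto_intros k_over_x)
    then have "\<forall>\<^sub>F k in sequentially. N1 * (real k / x k) < real l * \<eta>"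
      using l \<eta> by (intro order_tendstoD(2)[of _ "N1 * 0"]) auto
    then obtain K where K: "\<And>k. K \<le> k \<Longrightarrow> N1 * (real k / x k) < real l * \<eta>"
      by (auto simp: eventually_sequentially)
    let ?f = "\<lambda>k. real k * N1 - real l * \<eta> * x k"
    have "?f k \<le> max 0 (Max (?f ` {..K}))" for k
    proof (cases "K \<le> k")
      case True
      have "0 < x k" using x1[of k] by simp
      then show ?thesis using K[OF True] by (simp add: field_simps)
    next
      case False
      then have "?f k \<le> Max (?f ` {..K})" by (intro Max_ge) auto
      then show ?thesis by simp
    qed
    then show ?thesis by (rule that)
  qed
  define C1 where "C1 = max 1 (exp (\<theta> * ln 3 + C))"
  have C1: "1 \<le> C1" by (simp add: C1_def)
  have atT: "(\<Prod>s<T k. growth \<theta> s) * real (a k) powr \<theta> \<le> C1" for k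
  proof -
    have "real (a k) powr \<theta> \<le> (3 * exp (t * real l * x k)) powr \<theta>"
      using a(2)[of k] \<theta> by (intro powr_mono2) auto
    also have "\<dots> = exp (\<theta> * ln 3 + \<theta> * t * real l * x k)"
      by (simp add: powr_def ln_mult exp_add algebra_simps)
    finally have "(\<Prod>s<T k. growth \<theta> s) * real (a k) powr \<theta> \<le> exp (e k) * exp (\<theta> * ln 3 + \<theta> * t * real l * x k)"
      using main[of k] by (intro mult_mono) auto
    also have "\<dots> = exp (e k + \<theta> * ln 3 + \<theta> * t * real l * x k)" by (simp add: exp_add)
    also have "\<dots> \<le> exp (\<theta> * ln 3 + C)"
    proof -
      have "real l * p * x k \<le> real l * p * real (T k)" using T(1)[of k] p0 by (intro mult_left_mono) auto
      moreover have "c0 * t * real l * (x k - x 0) / (\<Lambda> - 1) \<le> c0 * t * real l * x k / (\<Lambda> - 1)"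
        using c0 t \<Lambda> x1[of 0] by (intro divide_right_mono mult_left_mono) auto
      ultimately have "e k + \<theta> * t * real l * x k \<le> - (real l * p) * x k + real k * N1
          + c0 * t * real l * x k / (\<Lambda> - 1) + \<theta> * t * real l * x k"
        unfolding e_def N1_def by (simp add: algebra_simps)
      also have "\<dots> = real k * N1 - real l * \<eta> * x k" unfolding \<eta>_def by (simp add: algebra_simps)
      also have "\<dots> \<le> C" by (rule C)
      finally show ?thesis by simp
    qed
    finally show ?thesis by (simp add: C1_def)
  qed
  \<comment> \<open>Block steps do not increase the product because r \<le> 1. Just after a large
    digit it has gained at most 16 a^(2 \<theta> - 1) \<le> 16 a^\<theta>, which \<open>atT\<close>
    controls.\<close>
  have bounded: "(\<Prod>s<n. growth \<theta> s) * (if A n = 0 then 1 else real (A n) powr \<theta>) \<le> 16 * C1" for n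
  proof (induction n)
    case 0
    show ?case
    proof (cases "A 0 = 0")
      case True then show ?thesis using C1 by simp
    next
      case False
      then obtain k where "0 = T k" using Anz by blast
      then show ?thesis using atT[of k] AT[of k] a(3)[of k] C1 by auto
    qed
  next
    case (Suc n)
    show ?case
    proof (cases "A (Suc n) = 0")
      case False
      then obtain k where k: "Suc n = T k" using Anz by blast
      have "(\<Prod>s<Suc n. growth \<theta> s) * real (A (Suc n)) powr \<theta> \<le> C1" unfolding k AT by (rule atT)
      then show ?thesis using False C1 by simp
    next
      case True
      have "(\<Prod>s<Suc n. growth \<theta> s) \<le> 16 * C1"
      proof (cases "A n = 0")
        case True
        have "(\<Prod>s<n. growth \<theta> s) * growth \<theta> n \<le> (\<Prod>s<n. growth \<theta> s) * 1"
          unfolding growth0[OF True] using r1 growth_nonneg by (intro mult_left_mono prod_nonneg) auto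
        then show ?thesis using Suc True by simp
      next
        case False
        then obtain k where k: "n = T k" using Anz by blast
        have ak: "1 \<le> real (a k)" using a(3)[of k] by simp
        have "real (a k) powr c0 \<le> real (a k) powr \<theta>" using ak \<theta> by (intro powr_mono) (auto simp: c0_def)
        then have "(\<Prod>s<n. growth \<theta> s) * (16 * real (a k) powr c0) \<le> (\<Prod>s<n. growth \<theta> s) * (16 * real (a k) powr \<theta>)"
          using growth_nonneg by (intro mult_left_mono prod_nonneg) auto
        also have "\<dots> \<le> 16 * C1" using atT[of k] k by simp
        finally show ?thesis using k a(3)[of k] by (simp add: growth_def[OF \<theta>] AT c0_def)
      qed
      then show ?thesis using True by simp
    qed
  qed
  have "(\<lambda>k. 1 / x k) \<longlonglongrightarrow> 0"
  proof -
    have "(\<lambda>k. inverse (\<Lambda> ^ (k + k0))) \<longlonglongrightarrow> 0"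
      using LIMSEQ_ignore_initial_segment[OF LIMSEQ_inverse_realpow_zero[OF \<Lambda>], of k0] .
    then show ?thesis by (simp add: x_def inverse_eq_divide)
  qed
  note inv_x = this
  \<comment> \<open>The successor occurs because partial quotients are indexed from 1.\<close>
  define N where "N k = Suc (offset (T k))" for k
  have offset_T: "real (offset (T k)) = real l * real (T k) - (real l - 1) * real k" for k
  proof -
    have count: "offset n = (\<Sum>s<n. if A s = 0 then l else 1)" for n by (simp add: offset_def)
    show ?thesis
    proof (induction k)
      case 0
      have "offset (T 0) = (\<Sum>s<T 0. l)" unfolding count using below by (intro sum.cong) auto
      then show ?case by simp
    next
      case (Suc k)
      have split: "{..<T (Suc k)} = {..<T k} \<union> ({T k} \<union> {Suc (T k)..<T (Suc k)})" using Tgap[of k] by auto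
      have "(\<Sum>s\<in>{Suc (T k)..<T (Suc k)}. if A s = 0 then l else 1) = (\<Sum>s\<in>{Suc (T k)..<T (Suc k)}. l)"
        using between[of k] by (intro sum.cong) auto
      moreover have "offset (T (Suc k)) = offset (T k) + (1 + (\<Sum>s\<in>{Suc (T k)..<T (Suc k)}. if A s = 0 then l else 1))"
        unfolding count split using a(3)[of k] AT[of k] by (subst sum.union_disjoint, auto)+
      ultimately have "offset (T (Suc k)) = offset (T k) + (1 + l * (T (Suc k) - Suc (T k)))" by simp
      then have "real (offset (T (Suc k))) = real (offset (T k)) + (1 + real l * real (T (Suc k) - Suc (T k)))"
        by (simp only: of_nat_add of_nat_mult of_nat_1)
      moreover have "real (T (Suc k) - Suc (T k)) = real (T (Suc k)) - real (T k) - 1" using Tgap[of k] by (simp add: of_nat_diff)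
      ultimately show ?case unfolding Suc by (simp only:) (simp add: algebra_simps)
    qed
  qed
  have offset_mono: "offset m < offset n" if "m < n" for m n
    unfolding offset_def using that l
  proof (induction n)
    case (Suc n)
    then show ?case by (cases "m = n") auto
  qed simp
  have Nmono: "strict_mono N"
    using Tmono offset_mono by (auto simp: N_def strict_mono_def)
  have T_over_x: "(\<lambda>k. real (T k) / x k) \<longlonglongrightarrow> 1"
  proof (rule tendsto_sandwich)
    show "\<forall>\<^sub>F k in sequentially. 1 \<le> real (T k) / x k"
    proof (intro always_eventually allI)
      fix k show "1 \<le> real (T k) / x k" using T(1)[of k] x1[of k] by (subst le_divide_eq) auto
    qed
    show "\<forall>\<^sub>F k in sequentially. real (T k) / x k \<le> 1 + 1 / x k"
    proof (intro always_eventually allI)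
      fix k show "real (T k) / x k \<le> 1 + 1 / x k"
        using T(2)[of k] x1[of k] by (simp add: field_simps)
    qed
    show "(\<lambda>k. 1 + 1 / x k) \<longlonglongrightarrow> 1" using tendsto_add[OF tendsto_const inv_x, of 1] by simp
  qed simp
  have N_over_x: "(\<lambda>k. real (N k) / x k) \<longlonglongrightarrow> real l"
  proof -
    have "(\<lambda>k. real l * (real (T k) / x k) - (real l - 1) * (real k / x k) + 1 / x k) \<longlonglongrightarrow> real l * 1 - (real l - 1) * 0 + 0"
      by (intro tendsto_intros T_over_x k_over_x inv_x)
    moreover have "real l * (real (T k) / x k) - (real l - 1) * (real k / x k) + 1 / x k = real (N k) / x k" for k
      by (simp add: N_def offset_T diff_divide_distrib add_divide_distrib)
    ultimately show ?thesis by simp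
  qed
  define y where "y k = t * real l * x k" for k
  have y: "0 \<le> y k" for k using t x1[of k] by (auto simp: y_def intro!: mult_nonneg_nonneg)
  have l0: "real l \<noteq> 0" using l by simp
  have lim1: "(\<lambda>k. y k / real (N k)) \<longlonglongrightarrow> t"
  proof -
    have "(\<lambda>k. t * real l / (real (N k) / x k)) \<longlonglongrightarrow> t * real l / real l"
      by (intro tendsto_intros N_over_x l0)
    then show ?thesis using l0 by (simp add: y_def)
  qed
  have lim2: "(\<lambda>k. y k / real (N (Suc k))) \<longlonglongrightarrow> t / \<Lambda>"
  proof -
    have "(\<lambda>k. t * real l / \<Lambda> / (real (N (Suc k)) / x (Suc k))) \<longlonglongrightarrow> t * real l / \<Lambda> / real l"
      by (intro tendsto_intros LIMSEQ_Suc[OF N_over_x] l0)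
    moreover have "t * real l / \<Lambda> / (real (N (Suc k)) / x (Suc k)) = y k / real (N (Suc k))" for k
      using \<Lambda> by (simp add: y_def xSuc)
    ultimately show ?thesis using l0 by simp
  qed
  show ?thesis
  proof (rule sparse_digits_positive_measure[OF \<theta> bounded])
    fix b assume b: "b \<in> paths"
    define z where "z = point b"
    have zi: "z \<in> unit_irrationals" unfolding z_def by (rule cf_lim_irrational) (rule digits_pos[OF b])
    have pq: "partial_quotient z (Suc i) = digits_of b i" for i
      unfolding z_def by (rule partial_quotient_cf_lim) (rule digits_pos[OF b])
    \<comment> \<open>Before the next large digit every digit is at most B times 2 a k, and a k is
      at most 3 exp (y k).\<close>
    define K where "K = ln (6 * real B)"
    have K: "0 \<le> K" using B by (simp add: K_def)
    have est: "y k / real n \<le> ln (real (max_quotient n z)) / real n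
        \<and> ln (real (max_quotient n z)) / real n \<le> (K + y k) / real n" if n: "N k \<le> n" "n < N (Suc k)" for k n
    proof -
      have n1: "1 \<le> n" using n(1) by (simp add: N_def)
      have Mpos: "1 \<le> max_quotient n z" by (rule max_quotient_pos[OF zi n1])
      obtain d where d: "b (T k) = [d]" "a k \<le> d"
        using bt[OF b, of "T k"] a(3)[of k] by (auto simp: choices_def AT split: if_splits)
      have "digits_of b (0 + offset (T k)) = d" using digits_step[OF b, of 0 "T k"] d by simp
      then have "partial_quotient z (N k) = d" unfolding N_def pq by simp
      then have "a k \<le> max_quotient n z"
        using partial_quotient_le_max[of "N k" n z] n d by (simp add: N_def)
      then have "exp (y k) \<le> real (max_quotient n z)" using a(1)[of k] unfolding y_def by linarith
      then have lo: "y k \<le> ln (real (max_quotient n z))" using Mpos by (simp add: ln_ge_iff)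
      obtain m where m: "1 \<le> m" "m \<le> n" "max_quotient n z = partial_quotient z m"
        using max_quotient_attained[OF n1] by blast
      then obtain i where i: "m = Suc i" by (cases m) auto
      have iN: "i < offset (T (Suc k))" using m i n by (simp add: N_def)
      have "digits_of b i \<in> set (concat_upto b (T (Suc k)))"
        unfolding digits_eq[OF b iN] using iN by (intro nth_mem) (simp only: length_concat_upto[OF b])
      then obtain s where s: "s < T (Suc k)" "digits_of b i \<in> set (b s)" by auto
      have "digits_of b i \<le> B * (2 * a k)"
      proof (cases "A s = 0")
        case True
        then have "digits_of b i \<le> B * 1" using bt[OF b, of s] s by (auto simp: choices_def blocks_def)
        also have "\<dots> \<le> B * (2 * a k)" using a(3)[of k] by (intro mult_left_mono) auto
        finally show ?thesis .
      next
        case False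
        then obtain j where j: "s = T j" using Anz by blast
        then have "j \<le> k" using s strict_mono_less[OF Tmono] by simp
        have "digits_of b i \<le> 2 * a j" using bt[OF b, of s] s False unfolding j by (auto simp: choices_def AT)
        also have "\<dots> \<le> 1 * (2 * a k)" using amono[OF \<open>j \<le> k\<close>] by simp
        also have "\<dots> \<le> B * (2 * a k)" using B by (intro mult_right_mono) auto
        finally show ?thesis .
      qed
      then have "max_quotient n z \<le> B * (2 * a k)" using m i pq by simp
      then have "real (max_quotient n z) \<le> real (B * (2 * a k))" by (simp only: of_nat_le_iff)
      also have "\<dots> = 2 * real B * real (a k)" by simp
      also have "\<dots> \<le> 2 * real B * (3 * exp (y k))" using a(2)[of k] by (intro mult_left_mono) (auto simp: y_def)
      finally have "ln (real (max_quotient n z)) \<le> ln (2 * real B * (3 * exp (y k)))"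
        using Mpos B by (subst ln_le_cancel_iff) auto
      also have "\<dots> = K + y k" using B by (simp add: K_def ln_mult_pos)
      finally have up: "ln (real (max_quotient n z)) \<le> K + y k" .
      show ?thesis using lo up by (intro conjI divide_right_mono) auto
    qed
    have "1 \<le> N 0" by (simp add: N_def)
    from limsup_liminf_blocks[OF Nmono this y K est lim1 lim2] zi
    show "point b \<in> {x \<in> unit_irrationals.
      limsup (log_rate x) = ereal t \<and>
      liminf (log_rate x) = ereal (t / \<Lambda>)}" unfolding z_def by simp
  qed
qed

section \<open>From the pressure equation to the dimension\<close>

lemma hausdorff_dim_from_pressure:
  fixes c :: "real \<Rightarrow> real" and E :: "real set"
  assumes c: "continuous_on {1 / 2<..} c" "strict_mono_on {1 / 2<..} c" "\<And>\<theta>. 1 / 2 < \<theta> \<Longrightarrow> 0 < c \<theta>"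
    and up: "\<And>\<theta>. 1 / 2 < \<theta> \<Longrightarrow> pressure \<theta> < c \<theta> \<Longrightarrow> hausdorff_measure \<theta> E = 0"
    and lo: "\<And>\<theta>. 1 / 2 < \<theta> \<Longrightarrow> \<theta> < 1 \<Longrightarrow> c \<theta> < pressure \<theta> \<Longrightarrow> hausdorff_measure \<theta> E \<noteq> 0"
  shows "(\<exists>!\<theta>. 1 / 2 < \<theta> \<and> pressure \<theta> = c \<theta>) \<and>
    hausdorff_dim E = ereal (THE \<theta>. 1 / 2 < \<theta> \<and> pressure \<theta> = c \<theta>)"
proof -
  obtain r where r: "1 / 2 < r" "r < 1" "pressure r = c r"
    "\<And>\<theta>. 1 / 2 < \<theta> \<Longrightarrow> \<theta> < r \<Longrightarrow> c \<theta> < pressure \<theta>" "\<And>\<theta>. r < \<theta> \<Longrightarrow> pressure \<theta> < c \<theta>"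
    using pressure_root[OF c] by blast
  have uniq: "\<theta> = r" if "1 / 2 < \<theta> \<and> pressure \<theta> = c \<theta>" for \<theta>
    using r(4)[of \<theta>] r(5)[of \<theta>] that by (cases \<theta> r rule: linorder_cases) auto
  have "\<exists>!\<theta>. 1 / 2 < \<theta> \<and> pressure \<theta> = c \<theta>" using r(1,3) uniq by blast
  moreover have "(THE \<theta>. 1 / 2 < \<theta> \<and> pressure \<theta> = c \<theta>) = r" 
    using r(1,3) by (intro the_equality uniq) blast+
  moreover have "hausdorff_dim E = ereal r"
    using r by (intro hausdorff_dim_eqI[of r E "1 / 2"] up lo) auto
  ultimately show ?thesis by simp
qed

theorem corollary1p6:
  fixes \<tau> :: real
  assumes "0 < \<tau>"
  shows "(\<exists>!\<theta>. 1 / 2 < \<theta> \<and> pressure \<theta> = \<tau> * \<theta>)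
    \<and> hausdorff_dim {x \<in> unit_irrationals.
          limsup (\<lambda>n. ereal (ln (real (max_quotient n x)) / real n)) = ereal \<tau>}
        = ereal (THE \<theta>. 1 / 2 < \<theta> \<and> pressure \<theta> = \<tau> * \<theta>)
    \<and> (\<exists>!\<theta>. 1 / 2 < \<theta> \<and> pressure \<theta> = \<tau> * (sqrt \<theta> + sqrt (2 * \<theta> - 1))\<^sup>2)
    \<and> hausdorff_dim {x \<in> unit_irrationals.
          liminf (\<lambda>n. ereal (ln (real (max_quotient n x)) / real n)) = ereal \<tau>}
        = ereal (THE \<theta>. 1 / 2 < \<theta> \<and> pressure \<theta> = \<tau> * (sqrt \<theta> + sqrt (2 * \<theta> - 1))\<^sup>2)"
proof -
  note \<tau> = assms
  define E1 where "E1 = {x \<in> unit_irrationals.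
    limsup (log_rate x) = ereal \<tau>}"
  define E2 where "E2 = {x \<in> unit_irrationals.
    liminf (log_rate x) = ereal \<tau>}"
  have 1: "(\<exists>!\<theta>. 1 / 2 < \<theta> \<and> pressure \<theta> = \<tau> * \<theta>) \<and>
    hausdorff_dim E1 = ereal (THE \<theta>. 1 / 2 < \<theta> \<and> pressure \<theta> = \<tau> * \<theta>)"
  proof (rule hausdorff_dim_from_pressure)
    show "hausdorff_measure \<theta> E1 = 0" if "1 / 2 < \<theta>" "pressure \<theta> < \<tau> * \<theta>" for \<theta>
      unfolding E1_def using that \<tau> by (rule limsup_set_null)
    show "hausdorff_measure \<theta> E1 \<noteq> 0" if \<theta>: "1 / 2 < \<theta>" "\<theta> < 1" "\<tau> * \<theta> < pressure \<theta>" for \<theta>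
    proof -
      define g where "g = pressure \<theta> - \<tau> * \<theta>"
      have g: "0 < g" using \<theta> by (simp add: g_def)
      \<comment> \<open>With \<Lambda> = 1 + s, the term \<tau> (2 \<theta> - 1) / s is exactly half
        of the available gap g.\<close>
      define s where "s = 2 * \<tau> * (2 * \<theta> - 1) / g"
      have s: "0 < s" using g \<theta> \<tau> by (simp add: s_def)
      have "\<tau> * ((2 * \<theta> - 1) / (1 + s - 1) + \<theta>) = g / 2 + \<tau> * \<theta>"
        using g \<theta> \<tau> by (simp add: s_def field_simps)
      also have "\<dots> < pressure \<theta>" using g by (simp add: g_def field_simps)
      finally have "hausdorff_measure \<theta> {x \<in> unit_irrationals.
          limsup (log_rate x) = ereal \<tau> \<and>
          liminf (log_rate x) = ereal (\<tau> / (1 + s))} \<noteq> 0" (is "hausdorff_measure \<theta> ?S \<noteq> 0")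
        using \<theta> s \<tau> by (intro prescribed_growth_positive_measure) auto
      moreover have "hausdorff_measure \<theta> ?S \<le> hausdorff_measure \<theta> E1"
        unfolding E1_def by (intro hausdorff_measure_subset) auto
      ultimately show ?thesis by auto
    qed
  qed (use \<tau> in \<open>auto intro!: continuous_intros strict_mono_onI\<close>)
  have 2: "(\<exists>!\<theta>. 1 / 2 < \<theta> \<and> pressure \<theta> = \<tau> * (sqrt \<theta> + sqrt (2 * \<theta> - 1))\<^sup>2) \<and>
    hausdorff_dim E2 = ereal (THE \<theta>. 1 / 2 < \<theta> \<and> pressure \<theta> = \<tau> * (sqrt \<theta> + sqrt (2 * \<theta> - 1))\<^sup>2)"
  proof (rule hausdorff_dim_from_pressure)
    show "hausdorff_measure \<theta> E2 = 0" if "1 / 2 < \<theta>" "pressure \<theta> < \<tau> * (sqrt \<theta> + sqrt (2 * \<theta> - 1))\<^sup>2" for \<theta>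
      unfolding E2_def using that \<tau> by (rule liminf_set_null)
    show "hausdorff_measure \<theta> E2 \<noteq> 0"
      if \<theta>: "1 / 2 < \<theta>" "\<theta> < 1" "\<tau> * (sqrt \<theta> + sqrt (2 * \<theta> - 1))\<^sup>2 < pressure \<theta>" for \<theta>
    proof -
      define u v where "u = sqrt \<theta>" and "v = sqrt (2 * \<theta> - 1)"
      have uv: "0 < u" "0 < v" "\<theta> = u\<^sup>2" "2 * \<theta> - 1 = v\<^sup>2" using \<theta> by (auto simp: u_def v_def)
      \<comment> \<open>With \<Lambda> = 1 + s the bound is \<tau> times v^2 / s + v^2 + u^2 + s
        u^2; equality in v^2 / s + s u^2 \<ge> 2 u v occurs at s = v / u.\<close>
      define s where "s = v / u"
      have s: "0 < s" using uv by (simp add: s_def)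
      have "\<tau> * (1 + s) * ((2 * \<theta> - 1) / (1 + s - 1) + \<theta>) = \<tau> * (u + v)\<^sup>2"
      proof -
        have "v\<^sup>2 / s = u * v" "s * u = v" using uv(1,2) by (simp_all add: s_def power2_eq_square)
        moreover have "(1 + s) * (u * v + u\<^sup>2) = u * v + u\<^sup>2 + (s * u) * v + (s * u) * u"
          by (simp add: power2_eq_square algebra_simps)
        ultimately have "(1 + s) * (v\<^sup>2 / (1 + s - 1) + u\<^sup>2) = (u + v)\<^sup>2"
          by (simp add: power2_eq_square algebra_simps)
        then show ?thesis unfolding uv(4) unfolding uv(3) by (simp add: mult.assoc)
      qed
      also have "\<dots> < pressure \<theta>" using \<theta> by (simp add: u_def v_def)
      finally have "hausdorff_measure \<theta> {x \<in> unit_irrationals.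
          limsup (log_rate x) = ereal (\<tau> * (1 + s)) \<and>
          liminf (log_rate x) = ereal (\<tau> * (1 + s) / (1 + s))} \<noteq> 0"
        (is "hausdorff_measure \<theta> ?S \<noteq> 0")
        using \<theta> s \<tau> by (intro prescribed_growth_positive_measure) auto
      moreover have "hausdorff_measure \<theta> ?S \<le> hausdorff_measure \<theta> E2"
        unfolding E2_def using s by (intro hausdorff_measure_subset) auto
      ultimately show ?thesis by auto
    qed
    show "continuous_on {1 / 2<..} (\<lambda>\<theta>. \<tau> * (sqrt \<theta> + sqrt (2 * \<theta> - 1))\<^sup>2)" by (intro continuous_intros)
    show "0 < \<tau> * (sqrt \<theta> + sqrt (2 * \<theta> - 1))\<^sup>2" if "1 / 2 < \<theta>" for \<theta>
    proof -
      have "0 < sqrt \<theta> + sqrt (2 * \<theta> - 1)" using that by (intro add_pos_pos) auto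
      then show ?thesis using \<tau> by simp
    qed
    show "strict_mono_on {1 / 2<..} (\<lambda>\<theta>. \<tau> * (sqrt \<theta> + sqrt (2 * \<theta> - 1))\<^sup>2)"
    proof (rule strict_mono_onI)
      fix r s :: real assume "r \<in> {1 / 2<..}" "s \<in> {1 / 2<..}" "r < s"
      then have "sqrt r + sqrt (2 * r - 1) < sqrt s + sqrt (2 * s - 1)" "0 \<le> sqrt r + sqrt (2 * r - 1)"
        by (auto intro!: add_strict_mono)
      then have "(sqrt r + sqrt (2 * r - 1))\<^sup>2 < (sqrt s + sqrt (2 * s - 1))\<^sup>2" by (intro power_strict_mono) auto
      then show "\<tau> * (sqrt r + sqrt (2 * r - 1))\<^sup>2 < \<tau> * (sqrt s + sqrt (2 * s - 1))\<^sup>2" using \<tau> by simp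
    qed
  qed
  show ?thesis using 1 2 unfolding E1_def E2_def by blast
qed

end
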